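(* Let $H$ be a finite dimensional Hopf algebra over a field $k$ and let $B\subseteq A$ be an $H$-Hopf--Galois extension with $A\neq0$. Then every intermediate $H$-extension is $Q$-Galois, i.e. for every $Q\in\mathrm{Quot}_{gen}(H)$ the extension $A^{co\,Q}\subseteq A$ is $Q$-Galois, and there is an anti-isomorphism of posets $$\mathrm{Sub}_{H\text{-}ext}(B\subseteq A)\simeq\mathrm{Quot}_{gen}(H),$$ given by $Q\mapsto A^{co\,Q}$.
   Context: A (right) $H$-comodule algebra is an associative unital algebra $A$ with a coassociative and counital coaction $\delta:A\to A\otimes H$, $\delta(a)=a_{(0)}\otimes a_{(1)}$, which is an algebra map; $A^{co\,H}=\{a:\delta(a)=a\otimes 1\}$. $B\subseteq A$ is an $H$-Hopf--Galois extension if $A$ is an $H$-comodule algebra with $B=A^{co\,H}$ and $A\otimes_BA\to A\otimes H$, $a\otimes b\mapsto ab_{(0)}\otimes b_{(1)}$, is bijective. $\mathrm{Quot}_{gen}(H)=\{H/I: I\text{ a coideal and a right ideal of }H\}$, ordered by $H/I\succeq H/J$ iff $I\subseteq J$. For $Q=H/I$ with quotient map $\pi$, $A^{co\,Q}=\{a\in A:(\mathrm{id}\otimes\pi)\delta(a)=a\otimes\pi(1)\}$, a subalgebra of $A$. An intermediate $H$-extension is an extension of the form $A^{co\,Q}\subseteq A$ with $Q\in\mathrm{Quot}_{gen}(H)$; $\mathrm{Sub}_{H\text{-}ext}(B\subseteq A)$ is the poset of all of these, i.e. of the subalgebras $A^{co\,Q}$ ordered by inclusion. The extension $A^{co\,Q}\subseteq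 A$ is $Q$-Galois if $\mathrm{can}_Q:A\otimes_{A^{co\,Q}}A\to A\otimes Q$, $a\otimes b\mapsto ab_{(0)}\otimes\pi(b_{(1)})$, is bijective. *)

theory Defs
  imports Complex_Main "HOL-Library.Poly_Mapping" "HOL-Library.Set_Algebras"
begin

text \<open>
  Tensor products are quotients of the free abelian group on pairs, written as finitely supported
  functions with integer values. An element of a tensor product is thus a coset of the subgroup
  spanned by the usual relations, and two tensors are equal iff they are equal as sets.

  \<open>tensor_rels r S l Y\<close> are the relations of \<open>X \<otimes>\<^bsub>S\<^esub> Y\<close> for scalars \<open>S\<close> acting by \<open>r\<close> from
  the right on the first factor (a whole type) and by \<open>l\<close> from the left on the second factor, which is
  the carrier \<open>Y\<close>. The integer span is the generated subgroup. The class \<open>plus\<close> (not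
  \<open>ab_group_add\<close>) on the second factor allows \<open>Y\<close> to be a quotient \<open>H/I\<close>, whose elements are
  cosets, added by the elementwise addition of Set_Algebras.
\<close>

definition tensor_rels ::
  "('x::plus \<Rightarrow> 's \<Rightarrow> 'x) \<Rightarrow> 's set \<Rightarrow> ('s \<Rightarrow> 'y \<Rightarrow> 'y) \<Rightarrow> 'y::plus set \<Rightarrow> ('x \<times> 'y \<Rightarrow>\<^sub>0 int) set"
  where "tensor_rels r S l Y = module.span frag_cmul
     ({frag_of (x + x', y) - frag_of (x, y) - frag_of (x', y) | x x' y. y \<in> Y}
    \<union> {frag_of (x, y + y') - frag_of (x, y) - frag_of (x, y') | x y y'. y \<in> Y \<and> y' \<in> Y}
    \<union> {frag_of (r x s, y) - frag_of (x, l s y) | x s y. s \<in> S \<and> y \<in> Y})"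

definition tensor ::
  "('x::plus \<Rightarrow> 's \<Rightarrow> 'x) \<Rightarrow> 's set \<Rightarrow> ('s \<Rightarrow> 'y \<Rightarrow> 'y) \<Rightarrow> 'y::plus set \<Rightarrow> ('x \<times> 'y \<Rightarrow>\<^sub>0 int) set set"
  where "tensor r S l Y = {c +o tensor_rels r S l Y | c. Poly_Mapping.keys c \<subseteq> UNIV \<times> Y}"

abbreviation ktensor_rels ::
  "('k \<Rightarrow> 'x::plus \<Rightarrow> 'x) \<Rightarrow> ('k \<Rightarrow> 'y::plus \<Rightarrow> 'y) \<Rightarrow> ('x \<times> 'y \<Rightarrow>\<^sub>0 int) set"
  where "ktensor_rels s t \<equiv> tensor_rels (\<lambda>x c. s c x) UNIV t UNIV"

abbreviation ktensor ::
  "('k \<Rightarrow> 'x::plus \<Rightarrow> 'x) \<Rightarrow> ('k \<Rightarrow> 'y::plus \<Rightarrow> 'y) \<Rightarrow> ('x \<times> 'y \<Rightarrow>\<^sub>0 int) set set"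
  where "ktensor s t \<equiv> tensor (\<lambda>x c. s c x) UNIV t UNIV"

abbreviation ring_tensor :: "'a::ring_1 set \<Rightarrow> ('a \<times> 'a \<Rightarrow>\<^sub>0 int) set set"
  where "ring_tensor C \<equiv> tensor (*) C (*) UNIV"

text \<open>The relations of the threefold tensor product over the ground field, identified as usual
  with both of its bracketings.\<close>

definition ktensor3_rels ::
  "('k \<Rightarrow> 'x::plus \<Rightarrow> 'x) \<Rightarrow> ('k \<Rightarrow> 'y::plus \<Rightarrow> 'y) \<Rightarrow> ('k \<Rightarrow> 'z::plus \<Rightarrow> 'z) \<Rightarrow>
    ('x \<times> 'y \<times> 'z \<Rightarrow>\<^sub>0 int) set"
  where "ktensor3_rels s t u = module.span frag_cmul
     ({frag_of (x + x', y, z) - frag_of (x, y, z) - frag_of (x', y, z) | x x' y z. True}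
    \<union> {frag_of (x, y + y', z) - frag_of (x, y, z) - frag_of (x, y', z) | x y y' z. True}
    \<union> {frag_of (x, y, z + z') - frag_of (x, y, z) - frag_of (x, y, z') | x y z z'. True}
    \<union> {frag_of (s c x, y, z) - frag_of (x, t c y, z) | c x y z. True}
    \<union> {frag_of (x, t c y, z) - frag_of (x, y, u c z) | c x y z. True})"

text \<open>
  Additive maps out of a tensor product are given by their values on pure tensors and computed on a
  representative: \<open>tensor_lift R f\<close> has values in the tensor product with relations \<open>R\<close>,
  \<open>tensor_eval f\<close> has values in a ring. They do not depend on the representative whenever \<open>f\<close> is
  balanced, which is the case for all uses below.
\<close>

definition tensor_repr :: "('p \<Rightarrow>\<^sub>0 int) set \<Rightarrow> ('p \<Rightarrow>\<^sub>0 int)"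
  where "tensor_repr t = (SOME c. c \<in> t)"

definition tensor_lift ::
  "('q \<Rightarrow>\<^sub>0 int) set \<Rightarrow> ('p \<Rightarrow> ('q \<Rightarrow>\<^sub>0 int)) \<Rightarrow> ('p \<Rightarrow>\<^sub>0 int) set \<Rightarrow> ('q \<Rightarrow>\<^sub>0 int) set"
  where "tensor_lift R f t = frag_extend f (tensor_repr t) +o R"

definition tensor_eval :: "('p \<Rightarrow> 'c::ring_1) \<Rightarrow> ('p \<Rightarrow>\<^sub>0 int) set \<Rightarrow> 'c"
  where "tensor_eval f t =
    (\<Sum>p\<in>Poly_Mapping.keys (tensor_repr t). of_int (Poly_Mapping.lookup (tensor_repr t) p) * f p)"

definition tensor_scale ::
  "('k \<Rightarrow> 'x::plus \<Rightarrow> 'x) \<Rightarrow> ('k \<Rightarrow> 'y::plus \<Rightarrow> 'y) \<Rightarrow> 'k \<Rightarrow> ('x \<times> 'y \<Rightarrow>\<^sub>0 int) set \<Rightarrow> ('x \<times> 'y \<Rightarrow>\<^sub>0 int) set"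
  where "tensor_scale s t c = tensor_lift (ktensor_rels s t) (\<lambda>(x, y). frag_of (s c x, y))"

definition tensor_mult ::
  "('k \<Rightarrow> 'x::ring_1 \<Rightarrow> 'x) \<Rightarrow> ('k \<Rightarrow> 'y::ring_1 \<Rightarrow> 'y) \<Rightarrow>
    ('x \<times> 'y \<Rightarrow>\<^sub>0 int) set \<Rightarrow> ('x \<times> 'y \<Rightarrow>\<^sub>0 int) set \<Rightarrow> ('x \<times> 'y \<Rightarrow>\<^sub>0 int) set"
  where "tensor_mult s t p q = tensor_lift (ktensor_rels s t)
    (\<lambda>(x, y). frag_extend (\<lambda>(x', y'). frag_of (x * x', y * y')) (tensor_repr q)) p"

text \<open>The class \<open>ring_1\<close> contains \<open>0 \<noteq> 1\<close>, so that the algebras below are nonzero.\<close>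

locale k_algebra = vector_space scale
  for scale :: "'k::field \<Rightarrow> 'a::ring_1 \<Rightarrow> 'a" +
  assumes scale_mult_left: "scale c x * y = scale c (x * y)"
    and scale_mult_right: "x * scale c y = scale c (x * y)"

text \<open>The sum \<open>+\<close> of cosets below is the addition of the tensor product.\<close>

locale coaction_algebra =
  A: k_algebra sA + H: k_algebra sH
  for sA :: "'k::field \<Rightarrow> 'a::ring_1 \<Rightarrow> 'a"
    and sH :: "'k \<Rightarrow> 'h::ring_1 \<Rightarrow> 'h"
    and \<Delta> :: "'h \<Rightarrow> ('h \<times> 'h \<Rightarrow>\<^sub>0 int) set"
    and \<epsilon> :: "'h \<Rightarrow> 'k"
    and \<delta> :: "'a \<Rightarrow> ('a \<times> 'h \<Rightarrow>\<^sub>0 int) set" +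
  assumes coact_closed: "\<delta> a \<in> ktensor sA sH"
    and coact_add: "\<delta> (a + b) = \<delta> a + \<delta> b"
    and coact_scale: "\<delta> (sA c a) = tensor_scale sA sH c (\<delta> a)"
    and coact_coassoc:
      "tensor_lift (ktensor3_rels sA sH sH)
         (\<lambda>(x, h). frag_extend (\<lambda>(y, g). frag_of (y, g, h)) (tensor_repr (\<delta> x))) (\<delta> a) =
       tensor_lift (ktensor3_rels sA sH sH)
         (\<lambda>(x, h). frag_extend (\<lambda>(g, g'). frag_of (x, g, g')) (tensor_repr (\<Delta> h))) (\<delta> a)"
    and coact_counit: "tensor_eval (\<lambda>(x, h). sA (\<epsilon> h) x) (\<delta> a) = a"
    and coact_mult: "\<delta> (a * b) = tensor_mult sA sH (\<delta> a) (\<delta> b)"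
    and coact_one: "\<delta> 1 = frag_of (1, 1) +o ktensor_rels sA sH"

text \<open>The axioms on \<open>\<Delta>\<close> and the right counit law say that \<open>\<Delta>\<close> is a coaction of \<open>H\<close> on itself.\<close>

locale hopf_algebra = coaction_algebra sH sH \<Delta> \<epsilon> \<Delta>
  for sH :: "'k::field \<Rightarrow> 'h::ring_1 \<Rightarrow> 'h" and \<Delta> and \<epsilon> +
  fixes S :: "'h \<Rightarrow> 'h"
  assumes counit_left: "tensor_eval (\<lambda>(g, h). sH (\<epsilon> g) h) (\<Delta> x) = x"
    and counit_linear: "Vector_Spaces.linear sH (*) \<epsilon>"
    and counit_mult: "\<epsilon> (x * y) = \<epsilon> x * \<epsilon> y"
    and counit_one: "\<epsilon> 1 = 1"
    and antipode_linear: "Vector_Spaces.linear sH sH S"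
    and antipode_left: "tensor_eval (\<lambda>(g, h). S g * h) (\<Delta> x) = sH (\<epsilon> x) 1"
    and antipode_right: "tensor_eval (\<lambda>(g, h). g * S h) (\<Delta> x) = sH (\<epsilon> x) 1"

locale comodule_algebra =
  hopf_algebra sH \<Delta> \<epsilon> S + coaction: coaction_algebra sA sH \<Delta> \<epsilon> \<delta>
  for sH :: "'k::field \<Rightarrow> 'h::ring_1 \<Rightarrow> 'h" and \<Delta> and \<epsilon> and S
    and sA :: "'k \<Rightarrow> 'a::ring_1 \<Rightarrow> 'a" and \<delta>

definition coinvariants ::
  "('k \<Rightarrow> 'a::ring_1 \<Rightarrow> 'a) \<Rightarrow> ('k \<Rightarrow> 'h::ring_1 \<Rightarrow> 'h) \<Rightarrow> ('a \<Rightarrow> ('a \<times> 'h \<Rightarrow>\<^sub>0 int) set) \<Rightarrow> 'a set"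
  where "coinvariants sA sH \<delta> = {a. \<delta> a = frag_of (a, 1) +o ktensor_rels sA sH}"

text \<open>The map \<open>a \<otimes> b \<mapsto> a b\<^sub>0 \<otimes> \<pi> b\<^sub>1\<close>, where \<open>R\<close> are the relations of the target.\<close>

definition canonical_map ::
  "('a::ring_1 \<Rightarrow> ('a \<times> 'h \<Rightarrow>\<^sub>0 int) set) \<Rightarrow> ('h \<Rightarrow> 'q) \<Rightarrow> ('a \<times> 'q \<Rightarrow>\<^sub>0 int) set \<Rightarrow>
    ('a \<times> 'a \<Rightarrow>\<^sub>0 int) set \<Rightarrow> ('a \<times> 'q \<Rightarrow>\<^sub>0 int) set"
  where "canonical_map \<delta> \<pi> R = tensor_lift R
    (\<lambda>(a, b). frag_extend (\<lambda>(b0, b1). frag_of (a * b0, \<pi> b1)) (tensor_repr (\<delta> b)))"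

locale hopf_galois_extension = comodule_algebra sH \<Delta> \<epsilon> S sA \<delta>
  for sH :: "'k::field \<Rightarrow> 'h::ring_1 \<Rightarrow> 'h" and \<Delta> and \<epsilon> and S
    and sA :: "'k \<Rightarrow> 'a::ring_1 \<Rightarrow> 'a" and \<delta> +
  fixes B :: "'a set"
  assumes base_eq: "B = coinvariants sA sH \<delta>"
    and canonical_bij:
      "bij_betw (canonical_map \<delta> id (ktensor_rels sA sH)) (ring_tensor B) (ktensor sA sH)"

text \<open>\<open>tensor_image X Y\<close> is the image of \<open>X \<otimes> Y\<close> in \<open>H \<otimes> H\<close>. The sum in the
  definition of a coideal is the set of all sums of a tensor in the first and one in the second image.\<close>

definition tensor_image ::
  "('k \<Rightarrow> 'h::ring_1 \<Rightarrow> 'h) \<Rightarrow> 'h set \<Rightarrow> 'h set \<Rightarrow> ('h \<times> 'h \<Rightarrow>\<^sub>0 int) set set"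
  where "tensor_image sH X Y = {c +o ktensor_rels sH sH | c. Poly_Mapping.keys c \<subseteq> X \<times> Y}"

definition coideal ::
  "('k::field \<Rightarrow> 'h::ring_1 \<Rightarrow> 'h) \<Rightarrow> ('h \<Rightarrow> ('h \<times> 'h \<Rightarrow>\<^sub>0 int) set) \<Rightarrow> ('h \<Rightarrow> 'k) \<Rightarrow> 'h set \<Rightarrow> bool"
  where "coideal sH \<Delta> \<epsilon> I \<longleftrightarrow> module.subspace sH I \<and>
    \<Delta> ` I \<subseteq> tensor_image sH I UNIV + tensor_image sH UNIV I \<and> (\<forall>x\<in>I. \<epsilon> x = 0)"

definition right_ideal :: "'h::ring_1 set \<Rightarrow> bool"
  where "right_ideal I \<longleftrightarrow>
    0 \<in> I \<and> (\<forall>x\<in>I. \<forall>y\<in>I. x + y \<in> I) \<and> (\<forall>x\<in>I. \<forall>h. x * h \<in> I)"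

definition quotient_space :: "'h::ring_1 set \<Rightarrow> 'h set set"
  where "quotient_space I = range (\<lambda>x. x +o I)"

definition Quot_gen ::
  "('k::field \<Rightarrow> 'h::ring_1 \<Rightarrow> 'h) \<Rightarrow> ('h \<Rightarrow> ('h \<times> 'h \<Rightarrow>\<^sub>0 int) set) \<Rightarrow> ('h \<Rightarrow> 'k) \<Rightarrow> 'h set set set"
  where "Quot_gen sH \<Delta> \<epsilon> = {quotient_space I | I. coideal sH \<Delta> \<epsilon> I \<and> right_ideal I}"

definition quot_ge ::
  "('k::field \<Rightarrow> 'h::ring_1 \<Rightarrow> 'h) \<Rightarrow> ('h \<Rightarrow> ('h \<times> 'h \<Rightarrow>\<^sub>0 int) set) \<Rightarrow> ('h \<Rightarrow> 'k) \<Rightarrow>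
    'h set set \<Rightarrow> 'h set set \<Rightarrow> bool"
  where "quot_ge sH \<Delta> \<epsilon> Q Q' \<longleftrightarrow> (\<exists>I J.
    coideal sH \<Delta> \<epsilon> I \<and> right_ideal I \<and> coideal sH \<Delta> \<epsilon> J \<and> right_ideal J \<and>
    Q = quotient_space I \<and> Q' = quotient_space J \<and> I \<subseteq> J)"

text \<open>For \<open>Q = H/I\<close>, the class of \<open>h\<close> is the unique member of \<open>Q\<close> that contains \<open>h\<close>; similarly
  for the induced scalar multiplication. So neither needs to mention \<open>I\<close>.\<close>

definition quot_proj :: "'h set set \<Rightarrow> 'h \<Rightarrow> 'h set"
  where "quot_proj Q h = (THE X. X \<in> Q \<and> h \<in> X)"

definition quot_scale :: "('k \<Rightarrow> 'h \<Rightarrow> 'h) \<Rightarrow> 'h set set \<Rightarrow> 'k \<Rightarrow> 'h set \<Rightarrow> 'h set"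
  where "quot_scale sH Q c X = (THE Y. Y \<in> Q \<and> sH c ` X \<subseteq> Y)"

abbreviation qtensor_rels ::
  "('k \<Rightarrow> 'a::ring_1 \<Rightarrow> 'a) \<Rightarrow> ('k \<Rightarrow> 'h::ring_1 \<Rightarrow> 'h) \<Rightarrow> 'h set set \<Rightarrow> ('a \<times> 'h set \<Rightarrow>\<^sub>0 int) set"
  where "qtensor_rels sA sH Q \<equiv> tensor_rels (\<lambda>a c. sA c a) UNIV (quot_scale sH Q) Q"

abbreviation qtensor ::
  "('k \<Rightarrow> 'a::ring_1 \<Rightarrow> 'a) \<Rightarrow> ('k \<Rightarrow> 'h::ring_1 \<Rightarrow> 'h) \<Rightarrow> 'h set set \<Rightarrow> ('a \<times> 'h set \<Rightarrow>\<^sub>0 int) set set"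
  where "qtensor sA sH Q \<equiv> tensor (\<lambda>a c. sA c a) UNIV (quot_scale sH Q) Q"

definition quot_coinvariants ::
  "('k \<Rightarrow> 'a::ring_1 \<Rightarrow> 'a) \<Rightarrow> ('k \<Rightarrow> 'h::ring_1 \<Rightarrow> 'h) \<Rightarrow> ('a \<Rightarrow> ('a \<times> 'h \<Rightarrow>\<^sub>0 int) set) \<Rightarrow>
    'h set set \<Rightarrow> 'a set"
  where "quot_coinvariants sA sH \<delta> Q = {a.
    tensor_lift (qtensor_rels sA sH Q) (\<lambda>(x, h). frag_of (x, quot_proj Q h)) (\<delta> a) =
    frag_of (a, quot_proj Q 1) +o qtensor_rels sA sH Q}"

definition quot_galois ::
  "('k \<Rightarrow> 'a::ring_1 \<Rightarrow> 'a) \<Rightarrow> ('k \<Rightarrow> 'h::ring_1 \<Rightarrow> 'h) \<Rightarrow> ('a \<Rightarrow> ('a \<times> 'h \<Rightarrow>\<^sub>0 int) set) \<Rightarrow>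
    'h set set \<Rightarrow> bool"
  where "quot_galois sA sH \<delta> Q \<longleftrightarrow>
    bij_betw (canonical_map \<delta> (quot_proj Q) (qtensor_rels sA sH Q))
      (ring_tensor (quot_coinvariants sA sH \<delta> Q)) (qtensor sA sH Q)"

definition Sub_ext ::
  "('k::field \<Rightarrow> 'a::ring_1 \<Rightarrow> 'a) \<Rightarrow> ('k \<Rightarrow> 'h::ring_1 \<Rightarrow> 'h) \<Rightarrow>
    ('h \<Rightarrow> ('h \<times> 'h \<Rightarrow>\<^sub>0 int) set) \<Rightarrow> ('h \<Rightarrow> 'k) \<Rightarrow> ('a \<Rightarrow> ('a \<times> 'h \<Rightarrow>\<^sub>0 int) set) \<Rightarrow> 'a set set"
  where "Sub_ext sA sH \<Delta> \<epsilon> \<delta> = quot_coinvariants sA sH \<delta> ` Quot_gen sH \<Delta> \<epsilon>"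

definition poset_anti_iso ::
  "('p \<Rightarrow> 'q) \<Rightarrow> 'p set \<Rightarrow> ('p \<Rightarrow> 'p \<Rightarrow> bool) \<Rightarrow> 'q set \<Rightarrow> ('q \<Rightarrow> 'q \<Rightarrow> bool) \<Rightarrow> bool"
  where "poset_anti_iso f P leP Q leQ \<longleftrightarrow>
    bij_betw f P Q \<and> (\<forall>x\<in>P. \<forall>y\<in>P. leP x y \<longleftrightarrow> leQ (f y) (f x))"

end

theory Submission
  imports Defs "HOL-Library.Function_Algebras"
begin

text \<open>
  Let \<open>D \<subseteq> H\<^sup>*\<close> be the algebra of functionals that vanish on \<open>I\<close>, so that \<open>D\<close> acts on \<open>A\<close> and \<open>A\<^sup>c\<^sup>o\<^sup>Q\<close> is its
  ring of invariants. Suppose that \<open>\<epsilon> h = (\<Sum>k. \<Gamma>\<^sub>k (h S g\<^sub>k))\<close> for all \<open>h\<close>, with left integrals \<open>\<Gamma>\<^sub>k\<close> of \<open>D\<close>. Surjectivity of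
  the canonical map of \<open>A\<close> over \<open>B\<close> gives elements \<open>x\<close>, \<open>y\<close> of \<open>A\<close> with \<open>a = (\<Sum>\<Gamma>\<^sub>k (a x) y)\<close> for all \<open>a\<close>; here
  \<open>\<Gamma>\<^sub>k (a x)\<close> lies in \<open>A\<^sup>c\<^sup>o\<^sup>Q\<close> and depends only on the action of \<open>D\<close> on \<open>a\<close>. Hence a tensor that is killed by
  the canonical map of \<open>Q\<close> is zero. Comparing kernels in \<open>A \<otimes> H\<close> then recovers \<open>I\<close> and the order.

  The integrals \<open>\<Gamma>\<^sub>k\<close> come from an integral of \<open>H\<^sup>*\<close> and the \<open>D\<close>-linear maps \<open>H/I \<rightarrow> H\<close>, provided that the
  latter separate points. This is a dimension count in the style of Skryabin: if \<open>V = D/L\<close> maximizes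
  \<open>dim Hom\<^sub>D(V, H) / dim V\<close>, then so does \<open>V \<otimes> H\<^sup>*\<close>, which contains a copy of \<open>D\<close>. This forces
  \<open>dim Hom\<^sub>D(X, H) \<le> dim X \<cdot> dim H / dim D\<close> for all finite-dimensional \<open>X\<close>.
\<close>

section \<open>Finite-dimensional subspaces\<close>

text \<open>For \<open>I = 0\<close> one integral of \<open>H*\<close> already yields
  \<open>\<epsilon>\<close> by the Frobenius property. For general \<open>I\<close> the algebra
  \<open>D\<close> need not be stable under the antipode, and this is what forces the count.
  \<open>D\<close> is a coideal subalgebra of \<open>H*\<close>: the coideal condition on
  \<open>I\<close> makes it an algebra, and the right ideal condition puts \<open>d(_ * h)\<close>
  into \<open>D\<close>, which lets \<open>D\<close> act diagonally on
  \<open>V \<otimes> H*\<close>. The count uses left exactness of \<open>Hom_D(-, H)\<close>. If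
  \<open>V \<otimes> H*\<close> has the maximal ratio, each of its submodules has at least that
  ratio; the copy of \<open>D\<close> has the ratio \<open>dim H / dim D\<close>, because
  \<open>Hom_D(D, H) = H\<close>. The upper bound then works both ways: applied to the kernel of a
  free presentation of \<open>H/I\<close>, it becomes a lower bound for
  \<open>Hom_D(H/I, H)\<close>, which exceeds the upper bound for \<open>Hom_D(H/X, H)\<close> as
  soon as \<open>X\<close> strictly contains \<open>I\<close>. The antipode in \<open>h S g\<close>
  stems from rewriting a preimage of \<open>1 \<otimes> g\<close> under the canonical map: it
  satisfies \<open>x_0 y \<otimes> x_1 = 1 \<otimes> S g\<close>.\<close>

locale lin_space = vector_space
begin

text \<open>Spaces of all functions on \<open>H\<close> are infinite-dimensional when
  \<open>H\<close> is infinite, so finiteness has to be a property of subspaces and not of the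
  ambient type.\<close>

definition fin_dim :: "'b set \<Rightarrow> bool"
  where "fin_dim V \<longleftrightarrow> (\<exists>F. finite F \<and> V \<subseteq> span F)"

lemma fin_dim_subset: "fin_dim V \<Longrightarrow> W \<subseteq> V \<Longrightarrow> fin_dim W"
  by (auto simp: fin_dim_def)

lemma fin_dim_basis:
  assumes "subspace V" "fin_dim V"
  obtains C where "C \<subseteq> V" "finite C" "independent C" "span C = V" "card C = dim V"
proof -
  obtain C where C: "C \<subseteq> V" "independent C" "V \<subseteq> span C" "card C = dim V"
    using basis_exists by metis
  obtain F where F: "finite F" "V \<subseteq> span F"
    using assms(2) by (auto simp: fin_dim_def)
  have "finite C"
    using independent_span_bound[OF F(1) C(2)] C(1) F(2) by blast
  moreover have "span C = V"
    using C assms(1) by (metis span_minimal subset_antisym)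
  ultimately show thesis using that C by blast
qed

lemma independent_card_le_dim_fin:
  assumes "independent C" "C \<subseteq> V" "subspace V" "fin_dim V"
  shows "finite C" "card C \<le> dim V"
proof -
  obtain E where E: "finite E" "span E = V" "card E = dim V"
    using fin_dim_basis[OF assms(3,4)] by metis
  show "finite C" "card C \<le> dim V"
    using independent_span_bound[OF E(1) assms(1)] assms(2) E by auto
qed

lemma dim_mono_fin:
  assumes "subspace V" "subspace W" "fin_dim W" "V \<subseteq> W"
  shows "dim V \<le> dim W"
proof -
  obtain C where C: "C \<subseteq> V" "independent C" "card C = dim V"
    using fin_dim_basis[OF assms(1) fin_dim_subset[OF assms(3,4)]] by metis
  show ?thesis
    using independent_card_le_dim_fin(2)[OF C(2) _ assms(2,3)] C assms(4) by auto
qed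

lemma subspace_eq_of_dim:
  assumes "subspace V" "subspace W" "fin_dim W" "V \<subseteq> W" "dim W \<le> dim V"
  shows "V = W"
proof (rule ccontr)
  assume "V \<noteq> W"
  then obtain w where w: "w \<in> W" "w \<notin> V" using assms(4) by blast
  obtain C where C: "C \<subseteq> V" "finite C" "independent C" "span C = V" "card C = dim V"
    using fin_dim_basis[OF assms(1) fin_dim_subset[OF assms(3,4)]] by metis
  have "independent (insert w C)"
    using w C by (simp add: independent_insertI)
  then have "card (insert w C) \<le> dim W"
    using independent_card_le_dim_fin(2) w C assms by blast
  moreover have "w \<notin> C" using w C by blast
  ultimately show False using C assms(5) by simp
qed

lemma dim_less_fin:
  assumes "subspace V" "subspace W" "fin_dim W" "V \<subset> W"
  shows "dim V < dim W"
  using subspace_eq_of_dim[OF assms(1-3)] dim_mono_fin[OF assms(1-3)] assms(4)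
  by (metis linorder_not_less psubset_eq)

lemma fin_dim_zero: "fin_dim {0}" "dim {0} = 0"
proof -
  show "fin_dim {0}" unfolding fin_dim_def by (rule exI[of _ "{}"]) auto
  show "dim {0} = 0" using dim_le_card[of "{0}" "{}"] by simp
qed

lemma dim_pos_fin: "subspace V \<Longrightarrow> fin_dim V \<Longrightarrow> v \<in> V \<Longrightarrow> v \<noteq> 0 \<Longrightarrow> 0 < dim V"
  using dim_less_fin[of "{0}" V] fin_dim_zero by (auto simp: subspace_single_0 subspace_def psubset_eq)

end

locale lin_space_pair = vs1: lin_space s1 + vs2: lin_space s2
  for s1 :: "'k::field \<Rightarrow> 'b::ab_group_add \<Rightarrow> 'b" and s2 :: "'k \<Rightarrow> 'c::ab_group_add \<Rightarrow> 'c"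
begin

sublocale vector_space_pair s1 s2 ..

text \<open>Finiteness of \<open>V\<close> is a conclusion here, so that a space of homomorphisms
  can be bounded from a kernel and an image alone. A basis of the kernel is extended to one of
  \<open>V\<close>, and \<open>T\<close> is injective on the span of the added vectors.\<close>

lemma rank_nullity:
  assumes T: "Vector_Spaces.linear s1 s2 T" and V: "vs1.subspace V"
    and fK: "vs1.fin_dim {v \<in> V. T v = 0}" and fI: "vs2.fin_dim (T ` V)"
  shows "vs1.fin_dim V" "vs1.dim V = vs1.dim {v \<in> V. T v = 0} + vs2.dim (T ` V)"
proof -
  interpret T: Vector_Spaces.linear s1 s2 T by (rule T)
  let ?K = "{v \<in> V. T v = 0}"
  have sK: "vs1.subspace ?K"
    using V by (auto simp: vs1.subspace_def T.add T.scale)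
  have sI: "vs2.subspace (T ` V)"
    using V T.subspace_image by blast
  obtain K where K: "K \<subseteq> ?K" "finite K" "vs1.independent K" "vs1.span K = ?K"
      "card K = vs1.dim ?K"
    by (rule vs1.fin_dim_basis[OF sK fK])
  obtain J where J: "J \<subseteq> T ` V" "finite J" "vs2.independent J" "vs2.span J = T ` V"
      "card J = vs2.dim (T ` V)"
    by (rule vs2.fin_dim_basis[OF sI fI])
  obtain G where G: "G \<subseteq> V" "finite G" "J = T ` G"
    using J(1,2) by (metis finite_subset_image)
  have sp: "v \<in> vs1.span (K \<union> G)" if v: "v \<in> V" for v
  proof -
    have "T v \<in> vs2.span (T ` G)" using v J(4) G(3) by blast
    also have "\<dots> = T ` vs1.span G" by (rule T.span_image)
    finally obtain g where g: "g \<in> vs1.span G" "T v = T g" by blast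
    have "g \<in> V" using g(1) G(1) V vs1.span_minimal by blast
    then have "v - g \<in> ?K" using v V g(2) by (simp add: vs1.subspace_diff T.diff)
    then have "v - g \<in> vs1.span K" using K(4) by blast
    then have "v - g \<in> vs1.span (K \<union> G)" "g \<in> vs1.span (K \<union> G)"
      using g(1) vs1.span_mono by (meson Un_upper1 Un_upper2 subsetD)+
    then have "(v - g) + g \<in> vs1.span (K \<union> G)" by (rule vs1.span_add)
    then show ?thesis by simp
  qed
  show fV: "vs1.fin_dim V"
    unfolding vs1.fin_dim_def using sp K(2) G(2) by blast
  obtain C where C: "K \<subseteq> C" "C \<subseteq> V" "vs1.independent C" "V \<subseteq> vs1.span C"
    using vs1.maximal_independent_subset_extend[of K V] K by blast
  have fC: "finite C" using vs1.independent_card_le_dim_fin(1)[OF C(3,2) V fV] .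
  have spC: "vs1.span C = V" using C V vs1.span_minimal by blast
  have dV: "vs1.dim V = card C"
    using vs1.dim_span_eq_card_independent[OF C(3)] spC by simp
  have inj: "inj_on T (vs1.span (C - K))"
  proof (rule inj_onI)
    fix x y assume xy: "x \<in> vs1.span (C - K)" "y \<in> vs1.span (C - K)" "T x = T y"
    then have d: "x - y \<in> vs1.span (C - K)" by (simp add: vs1.span_diff)
    have "x - y \<in> V" using d spC vs1.span_mono[of "C - K" C] by blast
    then have "x - y \<in> ?K" using xy by (simp add: T.diff)
    then have "x - y \<in> vs1.span K" using K(4) by blast
    then have "x - y \<in> vs1.span K \<inter> vs1.span (C - K)" using d by blast
    also have "\<dots> = {0}"
    proof (rule ccontr)
      assume ne: "vs1.span K \<inter> vs1.span (C - K) \<noteq> {0}"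
      then obtain z where z: "z \<in> vs1.span K" "z \<in> vs1.span (C - K)" "z \<noteq> 0"
        using vs1.span_zero by blast
      obtain r where r: "z = (\<Sum>v\<in>K. s1 (r v) v)"
        using z(1) unfolding vs1.span_finite[OF K(2)] by blast
      obtain q where q: "z = (\<Sum>v\<in>C - K. s1 (q v) v)"
        using z(2) unfolding vs1.span_finite[OF finite_Diff[OF fC]] by blast
      have "(\<Sum>v\<in>C. s1 (if v \<in> K then r v else - q v) v)
          = (\<Sum>v\<in>K. s1 (r v) v) + (\<Sum>v\<in>C - K. s1 (- q v) v)"
        by (subst sum.subset_diff[OF C(1) fC]) (simp add: add.commute)
      also have "\<dots> = z - z"
        using r q by (simp add: sum_negf vs1.scale_minus_left)
      finally have s0: "(\<Sum>v\<in>C. s1 (if v \<in> K then r v else - q v) v) = 0" by simp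
      have "r v = 0" if "v \<in> K" for v
        using vs1.independentD[OF C(3) fC order_refl s0, of v] that C(1) by auto
      then show False using r z(3) by simp
    qed
    finally show "x = y" by simp
  qed
  have ind: "vs2.independent (T ` (C - K))"
    using T.linear_axioms linear_independent_injective_image inj
      vs1.independent_mono[OF C(3)] by blast
  have "T ` V = T ` vs1.span C" using spC by simp
  also have "\<dots> = vs2.span (T ` C)" by (rule T.span_image[symmetric])
  also have "\<dots> \<subseteq> vs2.span (T ` (C - K))"
  proof (rule vs2.span_minimal)
    show "T ` C \<subseteq> vs2.span (T ` (C - K))"
    proof
      fix y assume "y \<in> T ` C"
      then obtain c where c: "c \<in> C" "y = T c" by blast
      show "y \<in> vs2.span (T ` (C - K))"
      proof (cases "c \<in> K")
        case True
        then have "y = 0" using K(1) c by blast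
        then show ?thesis by (simp add: vs2.span_zero)
      next
        case False
        then show ?thesis using c by (simp add: vs2.span_base)
      qed
    qed
  qed simp
  finally have "T ` V \<subseteq> vs2.span (T ` (C - K))" .
  moreover have sub: "T ` (C - K) \<subseteq> T ` V" using C(2) by blast
  ultimately have "vs2.dim (T ` V) = card (T ` (C - K))"
    using vs2.basis_card_eq_dim[OF sub _ ind] by simp
  also have "\<dots> = card (C - K)"
    using card_image inj_on_subset[OF inj] vs1.span_superset by blast
  also have "\<dots> = card C - card K" using K(2) C(1) card_Diff_subset by blast
  finally show "vs1.dim V = vs1.dim ?K + vs2.dim (T ` V)"
    using dV K(5) card_mono[OF fC C(1)] by simp
qed

lemma rank_nullity_fin_dim:
  assumes T: "Vector_Spaces.linear s1 s2 T" and V: "vs1.subspace V" and fV: "vs1.fin_dim V"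
  shows "vs2.fin_dim (T ` V)" "vs1.dim V = vs1.dim {v \<in> V. T v = 0} + vs2.dim (T ` V)"
proof -
  interpret T: Vector_Spaces.linear s1 s2 T by (rule T)
  obtain C where C: "finite C" "vs1.span C = V"
    by (rule vs1.fin_dim_basis[OF V fV])
  have "T ` V = vs2.span (T ` C)" using C(2) T.span_image by metis
  then show f: "vs2.fin_dim (T ` V)"
    unfolding vs2.fin_dim_def using C(1) by blast
  show "vs1.dim V = vs1.dim {v \<in> V. T v = 0} + vs2.dim (T ` V)"
    by (rule rank_nullity(2)[OF T V vs1.fin_dim_subset[OF fV] f]) blast
qed

end

lemma (in vector_space) separating_functional:
  assumes W: "subspace W" and x: "x \<notin> W"
  obtains u where "Vector_Spaces.linear scale (*) u" "\<And>w. w \<in> W \<Longrightarrow> u w = 0" "u x = 1"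
proof -
  interpret k: vector_space "(*) :: 'a \<Rightarrow> 'a \<Rightarrow> 'a"
    by unfold_locales (simp_all add: algebra_simps)
  interpret p: vector_space_pair scale "(*) :: 'a \<Rightarrow> 'a \<Rightarrow> 'a" ..
  obtain C where C: "C \<subseteq> W" "independent C" "W \<subseteq> span C"
    using basis_exists by metis
  have sp: "span C = W" using C W span_minimal by blast
  have ind: "independent (insert x C)"
    using x C sp by (simp add: independent_insertI)
  obtain u where u: "Vector_Spaces.linear scale (*) u" "\<forall>y\<in>insert x C. u y = (if y = x then 1 else 0)"
    using p.linear_independent_extend[OF ind, of "\<lambda>y. if y = x then 1 else 0"] by blast
  interpret u: Vector_Spaces.linear scale "(*)" u by (rule u(1))
  have "u w = 0" if w: "w \<in> W" for w
  proof -
    have "w \<in> span C" using w sp by simp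
    then show ?thesis
    proof (induction rule: span_induct_alt)
      case base then show ?case by (rule u.zero)
    next
      case (step c v z)
      then show ?case using u(2) x C(1) by (auto simp: u.add u.scale)
    qed
  qed
  then show thesis using that u by simp
qed

definition fun_scale :: "('k \<Rightarrow> 'b \<Rightarrow> 'b) \<Rightarrow> 'k \<Rightarrow> ('a \<Rightarrow> 'b) \<Rightarrow> 'a \<Rightarrow> 'b"
  where "fun_scale s c f = (\<lambda>x. s c (f x))"

lemma vector_space_fun_scale: "vector_space s \<Longrightarrow> vector_space (fun_scale s)"
  unfolding vector_space_def fun_scale_def by (auto simp: fun_eq_iff)

lemma vector_space_field: "vector_space ((*) :: 'k::field \<Rightarrow> 'k \<Rightarrow> 'k)"
  by unfold_locales (simp_all add: algebra_simps)

section \<open>Evaluation of tensors\<close>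

text \<open>A bare form of linearity that can be derived by introduction rules without first
  producing the vector spaces on both sides.\<close>

definition lin :: "('k \<Rightarrow> 'x::plus \<Rightarrow> 'x) \<Rightarrow> ('k \<Rightarrow> 'y::plus \<Rightarrow> 'y) \<Rightarrow> ('x \<Rightarrow> 'y) \<Rightarrow> bool"
  where "lin s t f \<longleftrightarrow> (\<forall>x y. f (x + y) = f x + f y) \<and> (\<forall>c x. f (s c x) = t c (f x))"

lemma linI: "(\<And>x y. f (x + y) = f x + f y) \<Longrightarrow> (\<And>c x. f (s c x) = t c (f x)) \<Longrightarrow> lin s t f"
  by (simp add: lin_def)

lemma lin_add: "lin s t f \<Longrightarrow> f (x + y) = f x + f y"
  and lin_scale: "lin s t f \<Longrightarrow> f (s c x) = t c (f x)"
  by (simp_all add: lin_def)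

lemma lin_0: "lin s t f \<Longrightarrow> f 0 = 0" for f :: "'x::ab_group_add \<Rightarrow> 'y::ab_group_add"
  by (metis add_cancel_right_right lin_add)

lemma lin_diff: "lin s t f \<Longrightarrow> f (x - y) = f x - f y" for f :: "'x::ab_group_add \<Rightarrow> 'y::ab_group_add"
  by (metis add_diff_cancel diff_add_cancel lin_add)

lemma lin_sum: "lin s t f \<Longrightarrow> f (sum g X) = (\<Sum>i\<in>X. f (g i))"
  for f :: "'x::ab_group_add \<Rightarrow> 'y::ab_group_add"
  by (induction X rule: infinite_finite_induct) (simp_all add: lin_0 lin_add)

lemma linear_of_lin:
  "vector_space s \<Longrightarrow> vector_space t \<Longrightarrow> lin s t f \<Longrightarrow> Vector_Spaces.linear s t f"
  by (simp add: Vector_Spaces.linear_iff lin_def)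

lemma lin_of_linear: "Vector_Spaces.linear s t f \<Longrightarrow> lin s t f"
  by (simp add: Vector_Spaces.linear_iff lin_def)

lemma lin_compose: "lin t r u \<Longrightarrow> lin s t g \<Longrightarrow> lin s r (\<lambda>x. u (g x))"
  by (simp add: lin_def)

text \<open>The value of \<open>tensor_eval\<close> on an explicit representative. Balanced maps
  send the relations to 0, and this is how equalities of tensors are tested throughout.\<close>

definition frag_eval :: "('p \<Rightarrow> 'c::ring_1) \<Rightarrow> ('p \<Rightarrow>\<^sub>0 int) \<Rightarrow> 'c"
  where "frag_eval f c = (\<Sum>p\<in>Poly_Mapping.keys c. of_int (Poly_Mapping.lookup c p) * f p)"

lemma frag_eval_superset:
  assumes "finite X" "Poly_Mapping.keys c \<subseteq> X"
  shows "frag_eval f c = (\<Sum>p\<in>X. of_int (Poly_Mapping.lookup c p) * f p)"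
  unfolding frag_eval_def
  by (rule sum.mono_neutral_left) (use assms in \<open>auto simp: in_keys_iff\<close>)

lemma frag_eval_0 [simp]: "frag_eval f 0 = 0"
  by (simp add: frag_eval_def)

lemma frag_eval_frag_of [simp]: "frag_eval f (frag_of p) = f p"
  by (simp add: frag_eval_def)

lemma frag_eval_add: "frag_eval f (c + d) = frag_eval f c + frag_eval f d"
proof -
  let ?X = "Poly_Mapping.keys c \<union> Poly_Mapping.keys d"
  have "Poly_Mapping.keys (c + d) \<subseteq> ?X" by (rule Poly_Mapping.keys_add)
  then show ?thesis
    by (simp add: frag_eval_superset[of ?X] lookup_add sum.distrib ring_distribs)
qed

lemma frag_eval_diff: "frag_eval f (c - d) = frag_eval f c - frag_eval f d"
  by (metis add_diff_cancel diff_add_cancel frag_eval_add)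

lemma frag_eval_cmul: "frag_eval f (frag_cmul k c) = of_int k * frag_eval f c"
proof -
  have "Poly_Mapping.keys (frag_cmul k c) \<subseteq> Poly_Mapping.keys c" by (rule keys_cmul)
  then show ?thesis
    by (simp add: frag_eval_superset[of "Poly_Mapping.keys c"] sum_distrib_left mult.assoc)
qed

lemma frag_eval_cong:
  "(\<And>p. p \<in> Poly_Mapping.keys c \<Longrightarrow> f p = g p) \<Longrightarrow> frag_eval f c = frag_eval g c"
  by (simp add: frag_eval_def)

lemma frag_eval_extend: "frag_eval f (frag_extend g c) = frag_eval (\<lambda>p. frag_eval f (g p)) c"
  using subset_UNIV
  by (induction c rule: frag_induction) (simp_all add: frag_extend_diff frag_eval_diff)

lemma frag_eval_fun_sum: "frag_eval (\<lambda>p. \<Sum>i\<in>X. f i p) c = (\<Sum>i\<in>X. frag_eval (f i) c)"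
  by (simp add: frag_eval_def sum_distrib_left) (rule sum.swap)

lemma frag_eval_additive:
  fixes T :: "'c::ring_1 \<Rightarrow> 'd::ring_1"
  assumes "\<And>x y. T (x + y) = T x + T y"
  shows "T (frag_eval f c) = frag_eval (\<lambda>p. T (f p)) c"
proof -
  have T0: "T 0 = 0" by (metis add_cancel_right_right assms)
  have Td: "T (x - y) = T x - T y" for x y by (metis add_diff_cancel diff_add_cancel assms)
  show ?thesis
    using subset_UNIV
    by (induction c rule: frag_induction) (simp_all add: frag_eval_diff T0 Td)
qed

lemma tensor_eval_eq: "tensor_eval f t = frag_eval f (tensor_repr t)"
  by (simp add: tensor_eval_def frag_eval_def)

section \<open>Relation subgroups, their cosets, and balanced maps\<close>

abbreviation frag_span :: "('p \<Rightarrow>\<^sub>0 int) set \<Rightarrow> ('p \<Rightarrow>\<^sub>0 int) set"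
  where "frag_span \<equiv> module.span frag_cmul"

lemma module_frag_cmul: "module frag_cmul"
  by unfold_locales (simp_all add: frag_cmul_distrib frag_cmul_distrib2)

lemmas frag_span_base = module.span_base[OF module_frag_cmul]
  and frag_span_zero = module.span_zero[OF module_frag_cmul]
  and frag_span_add = module.span_add[OF module_frag_cmul]
  and frag_span_diff = module.span_diff[OF module_frag_cmul]
  and frag_span_cmul = module.span_scale[OF module_frag_cmul]
  and frag_span_mono = module.span_mono[OF module_frag_cmul]

lemma frag_eval_span:
  assumes "c \<in> frag_span X" "\<And>x. x \<in> X \<Longrightarrow> frag_eval f x = 0"
  shows "frag_eval f c = 0"
  by (rule module.span_induct_alt[OF module_frag_cmul assms(1)])
    (simp_all add: assms(2) frag_eval_add frag_eval_cmul)

lemma frag_extend_span: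
  assumes "c \<in> frag_span X" "\<And>x. x \<in> X \<Longrightarrow> frag_extend f x \<in> frag_span Y"
  shows "frag_extend f c \<in> frag_span Y"
  by (rule module.span_induct_alt[OF module_frag_cmul assms(1)])
    (simp_all add: assms(2) frag_extend_add frag_extend_cmul frag_span_zero frag_span_add frag_span_cmul)

definition frag_subgroup :: "('p \<Rightarrow>\<^sub>0 int) set \<Rightarrow> bool"
  where "frag_subgroup R \<longleftrightarrow> 0 \<in> R \<and> (\<forall>x\<in>R. \<forall>y\<in>R. x - y \<in> R)"

lemma frag_subgroup_zero: "frag_subgroup R \<Longrightarrow> 0 \<in> R"
  and frag_subgroup_diff: "frag_subgroup R \<Longrightarrow> x \<in> R \<Longrightarrow> y \<in> R \<Longrightarrow> x - y \<in> R"
  by (auto simp: frag_subgroup_def)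

lemma frag_subgroup_add: "frag_subgroup R \<Longrightarrow> x \<in> R \<Longrightarrow> y \<in> R \<Longrightarrow> x + y \<in> R"
proof -
  assume R: "frag_subgroup R" "x \<in> R" "y \<in> R"
  have "x - (0 - y) \<in> R" using R by (intro frag_subgroup_diff frag_subgroup_zero)
  then show ?thesis by simp
qed

lemma frag_subgroup_sum:
  "frag_subgroup R \<Longrightarrow> (\<And>i. i \<in> X \<Longrightarrow> f i \<in> R) \<Longrightarrow> sum f X \<in> R"
  by (induction X rule: infinite_finite_induct) (auto simp: frag_subgroup_zero frag_subgroup_add)

lemma frag_subgroup_span: "frag_subgroup (frag_span X)"
  by (simp add: frag_subgroup_def frag_span_zero frag_span_diff)

lemma frag_subgroup_tensor_rels [simp]: "frag_subgroup (tensor_rels r S l Y)"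
  unfolding tensor_rels_def by (rule frag_subgroup_span)

lemma frag_subgroup_ktensor3_rels [simp]: "frag_subgroup (ktensor3_rels s t u)"
  unfolding ktensor3_rels_def by (rule frag_subgroup_span)

lemma coset_eq_iff:
  assumes "frag_subgroup R"
  shows "c +o R = d +o R \<longleftrightarrow> c - d \<in> R"
proof
  assume "c +o R = d +o R"
  moreover have "c \<in> c +o R" using frag_subgroup_zero[OF assms] by (force simp: elt_set_plus_def)
  ultimately show "c - d \<in> R" by (auto simp: elt_set_plus_def)
next
  assume cd: "c - d \<in> R"
  show "c +o R = d +o R"
  proof (intro equalityI subsetI)
    fix x assume "x \<in> c +o R"
    then obtain r where "r \<in> R" "x = c + r" by (auto simp: elt_set_plus_def)
    then have "x = d + ((c - d) + r)" "(c - d) + r \<in> R"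
      using cd assms by (auto intro: frag_subgroup_add)
    then show "x \<in> d +o R" unfolding elt_set_plus_def by blast
  next
    fix x assume "x \<in> d +o R"
    then obtain r where "r \<in> R" "x = d + r" by (auto simp: elt_set_plus_def)
    then have "x = c + (r - (c - d))" "r - (c - d) \<in> R"
      using cd assms by (auto intro: frag_subgroup_diff)
    then show "x \<in> c +o R" unfolding elt_set_plus_def by blast
  qed
qed

text \<open>\<open>tensor_repr\<close> is an arbitrary choice; that it differs from a known
  representative by a relation is all that can be used about it.\<close>

lemma tensor_repr_coset:
  assumes "frag_subgroup R"
  shows "tensor_repr (c +o R) - c \<in> R" "tensor_repr (c +o R) +o R = c +o R"
proof -
  have "c \<in> c +o R" using frag_subgroup_zero[OF assms] by (force simp: elt_set_plus_def)
  then have "tensor_repr (c +o R) \<in> c +o R" unfolding tensor_repr_def by (rule someI)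
  then show "tensor_repr (c +o R) - c \<in> R" by (auto simp: elt_set_plus_def)
  then show "tensor_repr (c +o R) +o R = c +o R" using assms by (simp add: coset_eq_iff)
qed

lemma coset_add:
  assumes "frag_subgroup R"
  shows "(c +o R) + (d +o R) = (c + d) +o R"
proof (intro equalityI subsetI)
  fix x assume "x \<in> (c +o R) + (d +o R)"
  then obtain r r' where "r \<in> R" "r' \<in> R" "x = (c + r) + (d + r')"
    by (auto simp: elt_set_plus_def set_plus_def)
  then have "x = (c + d) + (r + r')" "r + r' \<in> R" using assms by (auto intro: frag_subgroup_add)
  then show "x \<in> (c + d) +o R" unfolding elt_set_plus_def by blast
next
  fix x assume "x \<in> (c + d) +o R"
  then obtain r where "r \<in> R" "x = (c + 0) + (d + r)" by (auto simp: elt_set_plus_def add.assoc)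
  then show "x \<in> (c +o R) + (d +o R)"
    using frag_subgroup_zero[OF assms] by (fastforce simp: elt_set_plus_def set_plus_def)
qed

definition bilin ::
  "('k \<Rightarrow> 'x::plus \<Rightarrow> 'x) \<Rightarrow> ('k \<Rightarrow> 'y::plus \<Rightarrow> 'y) \<Rightarrow> ('k \<Rightarrow> 'c::plus \<Rightarrow> 'c) \<Rightarrow> ('x \<Rightarrow> 'y \<Rightarrow> 'c) \<Rightarrow> bool"
  where "bilin s t r F \<longleftrightarrow> (\<forall>y. lin s r (\<lambda>x. F x y)) \<and> (\<forall>x. lin t r (F x))"

lemma bilinI: "(\<And>y. lin s r (\<lambda>x. F x y)) \<Longrightarrow> (\<And>x. lin t r (\<lambda>y. F x y)) \<Longrightarrow> bilin s t r F"
  by (simp add: bilin_def)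

lemma bilin_left: "bilin s t r F \<Longrightarrow> lin s r (\<lambda>x. F x y)"
  and bilin_right: "bilin s t r F \<Longrightarrow> lin t r (\<lambda>y. F x y)"
  by (simp_all add: bilin_def)

lemma frag_eval_tensor_rels:
  fixes F :: "'x::plus \<Rightarrow> 'y::plus \<Rightarrow> 'c::ring_1"
  assumes "c \<in> tensor_rels r S l Y"
    and "\<And>x x' y. y \<in> Y \<Longrightarrow> F (x + x') y = F x y + F x' y"
    and "\<And>x y y'. y \<in> Y \<Longrightarrow> y' \<in> Y \<Longrightarrow> F x (y + y') = F x y + F x y'"
    and "\<And>x s y. s \<in> S \<Longrightarrow> y \<in> Y \<Longrightarrow> F (r x s) y = F x (l s y)"
  shows "frag_eval (\<lambda>(x, y). F x y) c = 0"
  using assms(1) unfolding tensor_rels_def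
  by (rule frag_eval_span) (auto simp: frag_eval_diff assms)

lemma frag_eval_ktensor_rels:
  fixes F :: "'x::plus \<Rightarrow> 'y::plus \<Rightarrow> 'c::ring_1"
  assumes "c \<in> ktensor_rels s t" "bilin s t r F"
  shows "frag_eval (\<lambda>(x, y). F x y) c = 0"
  using assms(1)
  by (rule frag_eval_tensor_rels)
    (simp_all add: lin_add[OF bilin_left[OF assms(2)]] lin_add[OF bilin_right[OF assms(2)]]
      lin_scale[OF bilin_left[OF assms(2)]] lin_scale[OF bilin_right[OF assms(2)]])

lemma frag_eval_ktensor3_rels:
  fixes F :: "'x::plus \<Rightarrow> 'y::plus \<Rightarrow> 'z::plus \<Rightarrow> 'c::ring_1"
  assumes "c \<in> ktensor3_rels s t u"
    and 1: "\<And>y z. lin s r (\<lambda>x. F x y z)" and 2: "\<And>x z. lin t r (\<lambda>y. F x y z)"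
    and 3: "\<And>x y. lin u r (\<lambda>z. F x y z)"
  shows "frag_eval (\<lambda>(x, y, z). F x y z) c = 0"
  using assms(1) unfolding ktensor3_rels_def
  by (rule frag_eval_span)
    (auto simp: frag_eval_diff lin_add[OF 1] lin_add[OF 2] lin_add[OF 3] lin_scale[OF 1]
      lin_scale[OF 2] lin_scale[OF 3])

lemma frag_eval_ktensor_coset:
  fixes F :: "'x::plus \<Rightarrow> 'y::plus \<Rightarrow> 'c::ring_1"
  assumes "bilin s t r F" "tensor_repr T +o ktensor_rels s t = c +o ktensor_rels s t"
  shows "frag_eval (\<lambda>(x, y). F x y) (tensor_repr T) = frag_eval (\<lambda>(x, y). F x y) c"
proof -
  have "tensor_repr T - c \<in> ktensor_rels s t"
    using assms(2) by (simp add: coset_eq_iff)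
  from frag_eval_ktensor_rels[OF this assms(1)] show ?thesis by (simp add: frag_eval_diff)
qed

lemma tensor_coset:
  assumes "T \<in> tensor r S l Y"
  obtains c where "Poly_Mapping.keys c \<subseteq> UNIV \<times> Y" "T = c +o tensor_rels r S l Y"
    "tensor_repr T +o tensor_rels r S l Y = T"
proof -
  obtain c where c: "Poly_Mapping.keys c \<subseteq> UNIV \<times> Y" "T = c +o tensor_rels r S l Y"
    using assms unfolding tensor_def by blast
  show thesis
    by (rule that[OF c]) (simp add: c(2) tensor_repr_coset(2))
qed

section \<open>Sweedler calculus\<close>

text \<open>With respect to a basis \<open>B\<close> of \<open>H\<close>, a coaction is \<open>\<delta> a = (\<Sum>b\<in>B. coact_comp b a \<otimes> b)\<close>, so that
  \<open>sweedler F a\<close> is \<open>F a\<^sub>0 a\<^sub>1\<close> for bilinear \<open>F\<close>.\<close>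

definition coact_comp ::
  "('k::field \<Rightarrow> 'a::ring_1 \<Rightarrow> 'a) \<Rightarrow> ('k \<Rightarrow> 'h::ring_1 \<Rightarrow> 'h) \<Rightarrow> 'h set \<Rightarrow>
    ('a \<Rightarrow> ('a \<times> 'h \<Rightarrow>\<^sub>0 int) set) \<Rightarrow> 'h \<Rightarrow> 'a \<Rightarrow> 'a"
  where "coact_comp sA sH B \<delta> b a =
    frag_eval (\<lambda>(x, h). sA (module.representation sH B h b) x) (tensor_repr (\<delta> a))"

definition sweedler ::
  "('k::field \<Rightarrow> 'a::ring_1 \<Rightarrow> 'a) \<Rightarrow> ('k \<Rightarrow> 'h::ring_1 \<Rightarrow> 'h) \<Rightarrow> 'h set \<Rightarrow>
    ('a \<Rightarrow> ('a \<times> 'h \<Rightarrow>\<^sub>0 int) set) \<Rightarrow> ('a \<Rightarrow> 'h \<Rightarrow> 'c::comm_monoid_add) \<Rightarrow> 'a \<Rightarrow> 'c"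
  where "sweedler sA sH B \<delta> F a = (\<Sum>b\<in>B. F (coact_comp sA sH B \<delta> b a) b)"

locale fd_coaction = coaction_algebra sA sH \<Delta> \<epsilon> \<delta>
  for sA :: "'k::field \<Rightarrow> 'a::ring_1 \<Rightarrow> 'a"
    and sH :: "'k \<Rightarrow> 'h::ring_1 \<Rightarrow> 'h"
    and \<Delta> :: "'h \<Rightarrow> ('h \<times> 'h \<Rightarrow>\<^sub>0 int) set"
    and \<epsilon> :: "'h \<Rightarrow> 'k"
    and \<delta> :: "'a \<Rightarrow> ('a \<times> 'h \<Rightarrow>\<^sub>0 int) set" +
  fixes B :: "'h set"
  assumes finite_B: "finite B" and indep_B: "\<not> module.dependent sH B"
    and span_B: "module.span sH B = UNIV"
begin

abbreviation co where "co b h \<equiv> module.representation sH B h b"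
abbreviation comp where "comp \<equiv> coact_comp sA sH B \<delta>"
abbreviation sw :: "('a \<Rightarrow> 'h \<Rightarrow> 'c::comm_monoid_add) \<Rightarrow> 'a \<Rightarrow> 'c" where "sw \<equiv> sweedler sA sH B \<delta>"

lemma vs_A: "vector_space sA" and vs_H: "vector_space sH"
  by unfold_locales

lemma co_lin: "lin sH (*) (co b)"
  by (rule lin_of_linear[OF H.linear_representation[OF indep_B span_B]])

lemma co_sum: "(\<Sum>b\<in>B. sH (co b h) b) = h"
  by (rule H.sum_representation_eq[OF indep_B _ finite_B order_refl]) (simp add: span_B)

lemma co_basis: "b \<in> B \<Longrightarrow> b' \<in> B \<Longrightarrow> co b b' = (if b = b' then 1 else 0)"
  by (subst H.representation_basis[OF indep_B]) auto

lemma lin_expand: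
  fixes t :: "'k \<Rightarrow> 'c::ab_group_add \<Rightarrow> 'c"
  assumes "lin sH t f"
  shows "f h = (\<Sum>b\<in>B. t (co b h) (f b))"
  by (subst co_sum[of h, symmetric]) (simp only: lin_sum[OF assms] lin_scale[OF assms])

lemma bilin_comp: "bilin sA sH sA (\<lambda>x h. sA (co b h) x)"
  by (rule bilinI; rule linI)
    (simp_all add: A.scale_right_distrib A.scale_left_distrib lin_add[OF co_lin] lin_scale[OF co_lin]
      mult.commute)

lemma coact_repr: "tensor_repr (\<delta> a) +o ktensor_rels sA sH = \<delta> a"
  using coact_closed by (rule tensor_coset)

lemma comp_lin: "lin sA sA (comp b)"
proof (rule linI)
  fix x y
  have e: "tensor_repr (\<delta> (x + y)) +o ktensor_rels sA sH =
      (tensor_repr (\<delta> x) + tensor_repr (\<delta> y)) +o ktensor_rels sA sH"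
    unfolding coset_add[OF frag_subgroup_tensor_rels, symmetric] coact_repr by (rule coact_add)
  show "comp b (x + y) = comp b x + comp b y"
    unfolding coact_comp_def frag_eval_ktensor_coset[OF bilin_comp e] frag_eval_add by (rule refl)
next
  fix c x
  have e: "tensor_repr (\<delta> (sA c x)) +o ktensor_rels sA sH =
      frag_extend (\<lambda>(x, y). frag_of (sA c x, y)) (tensor_repr (\<delta> x)) +o ktensor_rels sA sH"
    by (subst coact_repr) (simp add: coact_scale tensor_scale_def tensor_lift_def)
  have "comp b (sA c x) = frag_eval (\<lambda>p. case p of (x, h) \<Rightarrow> sA (co b h) (sA c x)) (tensor_repr (\<delta> x))"
    unfolding coact_comp_def frag_eval_ktensor_coset[OF bilin_comp e] frag_eval_extend
    by (rule frag_eval_cong) auto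
  also have "\<dots> = frag_eval (\<lambda>p. sA c (case p of (x, h) \<Rightarrow> sA (co b h) x)) (tensor_repr (\<delta> x))"
    by (simp add: case_prod_unfold mult.commute)
  also have "\<dots> = sA c (comp b x)"
    unfolding coact_comp_def by (rule frag_eval_additive[symmetric]) (rule A.scale_right_distrib)
  finally show "comp b (sA c x) = sA c (comp b x)" .
qed

text \<open>Moving the coordinates of the second leg across the tensor sign reduces every bilinear
  evaluation to the components along \<open>B\<close>. This is what justifies Sweedler notation as a
  finite sum.\<close>

lemma frag_eval_bilin:
  fixes F :: "'a \<Rightarrow> 'h \<Rightarrow> 'c::ring_1"
  assumes F: "bilin sA sH t F"
  shows "frag_eval (\<lambda>(x, h). F x h) c = (\<Sum>b\<in>B. F (frag_eval (\<lambda>(x, h). sA (co b h) x) c) b)"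
proof -
  have *: "F x h = (\<Sum>b\<in>B. F (sA (co b h) x) b)" for x h
  proof -
    have "F x h = F x (\<Sum>b\<in>B. sH (co b h) b)" by (simp only: co_sum)
    also have "\<dots> = (\<Sum>b\<in>B. F (sA (co b h) x) b)"
      by (simp only: lin_sum[OF bilin_right[OF F]] lin_scale[OF bilin_right[OF F]] lin_scale[OF bilin_left[OF F]])
    finally show ?thesis .
  qed
  have "frag_eval (\<lambda>(x, h). F x h) c = frag_eval (\<lambda>p. \<Sum>b\<in>B. F (case p of (x, h) \<Rightarrow> sA (co b h) x) b) c"
    by (rule frag_eval_cong) (auto simp: *[of "fst _"] intro: *)
  also have "\<dots> = (\<Sum>b\<in>B. frag_eval (\<lambda>p. F (case p of (x, h) \<Rightarrow> sA (co b h) x) b) c)"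
    by (rule frag_eval_fun_sum)
  also have "\<dots> = (\<Sum>b\<in>B. F (frag_eval (\<lambda>(x, h). sA (co b h) x) c) b)"
    by (rule sum.cong[OF refl], rule frag_eval_additive[symmetric]) (rule lin_add[OF bilin_left[OF F]])
  finally show ?thesis .
qed

lemma frag_eval_coact:
  fixes F :: "'a \<Rightarrow> 'h \<Rightarrow> 'c::ring_1"
  assumes "bilin sA sH t F"
  shows "frag_eval (\<lambda>(x, h). F x h) (tensor_repr (\<delta> a)) = sw F a"
  unfolding sweedler_def coact_comp_def by (rule frag_eval_bilin[OF assms])

lemma frag_eval_coact_coset:
  fixes F :: "'a \<Rightarrow> 'h \<Rightarrow> 'c::ring_1"
  assumes "bilin sA sH t F" "\<delta> a = c +o ktensor_rels sA sH"
  shows "frag_eval (\<lambda>(x, h). F x h) c = sw F a"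
  using frag_eval_ktensor_coset[OF assms(1) coact_repr[THEN trans, OF assms(2)]]
    frag_eval_coact[OF assms(1), of a]
  by simp

lemma sw_lin:
  fixes t :: "'k \<Rightarrow> 'c::ab_group_add \<Rightarrow> 'c"
  assumes t: "vector_space t" and F: "\<And>h. lin sA t (\<lambda>x. F x h)"
  shows "lin sA t (sw F)"
proof -
  interpret t: vector_space t by (rule t)
  show ?thesis
    by (rule linI) (simp_all add: sweedler_def lin_add[OF comp_lin] lin_scale[OF comp_lin]
        lin_add[OF F] lin_scale[OF F] sum.distrib t.scale_sum_right)
qed

lemma sw_counit: "sw (\<lambda>x h. sA (\<epsilon> h) x) a = a" if "lin sH (*) \<epsilon>"
proof -
  have "bilin sA sH sA (\<lambda>x h. sA (\<epsilon> h) x)"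
    by (rule bilinI; rule linI)
      (simp_all add: A.scale_right_distrib A.scale_left_distrib lin_add[OF that] lin_scale[OF that] mult.commute)
  from frag_eval_coact[OF this, of a] coact_counit[of a] show ?thesis
    by (simp add: tensor_eval_eq)
qed

lemma sw_one: "sw F 1 = F 1 1" if "bilin sA sH t F" for F :: "'a \<Rightarrow> 'h \<Rightarrow> 'c::ring_1"
  using frag_eval_coact_coset[OF that coact_one] by simp

lemma bilin_mult:
  fixes F :: "'a \<Rightarrow> 'h \<Rightarrow> 'c::ring_1"
  assumes F: "bilin sA sH t F"
  shows "bilin sA sH t (\<lambda>x' h'. F (x * x') (h * h'))" "bilin sA sH t (\<lambda>x h. F (x * x') (h * h'))"
  by (rule bilinI; rule linI; simp add: ring_distribs A.scale_mult_left A.scale_mult_right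
      H.scale_mult_left H.scale_mult_right lin_add[OF bilin_left[OF F]] lin_add[OF bilin_right[OF F]]
      lin_scale[OF bilin_left[OF F]] lin_scale[OF bilin_right[OF F]])+

lemma sw_mult:
  fixes F :: "'a \<Rightarrow> 'h \<Rightarrow> 'c::ring_1"
  assumes F: "bilin sA sH t F" and t: "vector_space t"
  shows "sw F (a * b) = sw (\<lambda>x h. sw (\<lambda>x' h'. F (x * x') (h * h')) b) a"
proof -
  have bi: "bilin sA sH t (\<lambda>x h. sw (\<lambda>x' h'. F (x * x') (h * h')) b)"
  proof -
    interpret t: vector_space t by (rule t)
    note l = bilin_mult(2)[OF F]
    show ?thesis
      by (rule bilinI; rule linI)
        (simp_all add: sweedler_def sum.distrib t.scale_sum_right lin_add[OF bilin_left[OF l]]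
          lin_add[OF bilin_right[OF l]] lin_scale[OF bilin_left[OF l]] lin_scale[OF bilin_right[OF l]])
  qed
  have "\<delta> (a * b) = frag_extend (\<lambda>(x, y). frag_extend (\<lambda>(x', y'). frag_of (x * x', y * y'))
      (tensor_repr (\<delta> b))) (tensor_repr (\<delta> a)) +o ktensor_rels sA sH"
    by (simp add: coact_mult tensor_mult_def tensor_lift_def)
  from frag_eval_coact_coset[OF F this] have "sw F (a * b) =
      frag_eval (\<lambda>(x, y). frag_eval (\<lambda>(x', y'). F (x * x') (y * y')) (tensor_repr (\<delta> b))) (tensor_repr (\<delta> a))"
    by (simp add: frag_eval_extend case_prod_unfold)
  also have "\<dots> = sw (\<lambda>x h. sw (\<lambda>x' h'. F (x * x') (h * h')) b) a"
    by (simp add: frag_eval_coact[OF bilin_mult(1)[OF F]] frag_eval_coact[OF bi])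
  finally show ?thesis .
qed

end

locale fd_hopf_algebra = hopf_algebra sH \<Delta> \<epsilon> S
  for sH :: "'k::field \<Rightarrow> 'h::ring_1 \<Rightarrow> 'h" and \<Delta> and \<epsilon> and S +
  fixes B :: "'h set"
  assumes finite_basis: "finite B" and indep_basis: "\<not> module.dependent sH B"
    and span_basis: "module.span sH B = UNIV"
begin

sublocale fd_coaction sH sH \<Delta> \<epsilon> \<Delta> B
  by unfold_locales (rule finite_basis indep_basis span_basis)+

lemma counit_lin: "lin sH (*) \<epsilon>" and antipode_lin: "lin sH sH S"
  by (rule lin_of_linear[OF counit_linear] lin_of_linear[OF antipode_linear])+

end

locale fd_comodule_algebra = fd_hopf_algebra sH \<Delta> \<epsilon> S B + comodule_algebra sH \<Delta> \<epsilon> S sA \<delta>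
  for sH :: "'k::field \<Rightarrow> 'h::ring_1 \<Rightarrow> 'h" and \<Delta> and \<epsilon> and S and B
    and sA :: "'k \<Rightarrow> 'a::ring_1 \<Rightarrow> 'a" and \<delta>
begin

sublocale coA: fd_coaction sA sH \<Delta> \<epsilon> \<delta> B
  by unfold_locales (rule finite_basis indep_basis span_basis)+

text \<open>The coassociativity axiom is an equality of cosets; a trilinear \<open>F\<close>
  vanishes on the threefold relations and so may be evaluated on both sides.\<close>

lemma coact_coassoc_sw:
  fixes F :: "'a \<Rightarrow> 'h \<Rightarrow> 'h \<Rightarrow> 'c::ring_1"
  assumes t: "vector_space t" and 1: "\<And>g h. lin sA t (\<lambda>x. F x g h)" and 2: "\<And>x h. lin sH t (\<lambda>g. F x g h)"
    and 3: "\<And>x g. lin sH t (\<lambda>h. F x g h)"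
  shows "coA.sw (\<lambda>x h. coA.sw (\<lambda>y g. F y g h) x) a = coA.sw (\<lambda>x h. sw (\<lambda>g g'. F x g g') h) a"
proof -
  interpret t: vector_space t by (rule t)
  have b1: "bilin sA sH t (\<lambda>x h. coA.sw (\<lambda>y g. F y g h) x)"
  proof (rule bilinI)
    show "lin sA t (coA.sw (\<lambda>y g. F y g h))" for h by (rule coA.sw_lin[OF t 1])
    show "lin sH t (\<lambda>h. coA.sw (\<lambda>y g. F y g h) x)" for x
      by (rule linI) (simp_all add: sweedler_def lin_add[OF 3] lin_scale[OF 3] sum.distrib t.scale_sum_right)
  qed
  have b2: "bilin sA sH t (\<lambda>x h. sw (\<lambda>g g'. F x g g') h)"
  proof (rule bilinI)
    show "lin sH t (sw (\<lambda>g g'. F x g g'))" for x by (rule sw_lin[OF t 2])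
    show "lin sA t (\<lambda>x. sw (\<lambda>g g'. F x g g') h)" for h
      by (rule linI) (simp_all add: sweedler_def lin_add[OF 1] lin_scale[OF 1] sum.distrib t.scale_sum_right)
  qed
  have b3: "bilin sA sH t (\<lambda>y g. F y g h)" for h by (rule bilinI[OF 1 2])
  have b4: "bilin sH sH t (\<lambda>g g'. F x g g')" for x by (rule bilinI[OF 2 3])
  let ?l = "frag_extend (\<lambda>(x, h). frag_extend (\<lambda>(y, g). frag_of (y, g, h)) (tensor_repr (\<delta> x))) (tensor_repr (\<delta> a))"
  let ?r = "frag_extend (\<lambda>(x, h). frag_extend (\<lambda>(g, g'). frag_of (x, g, g')) (tensor_repr (\<Delta> h))) (tensor_repr (\<delta> a))"
  have "?l - ?r \<in> ktensor3_rels sA sH sH"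
    using coaction.coact_coassoc[of a] by (simp add: tensor_lift_def coset_eq_iff)
  from frag_eval_ktensor3_rels[OF this 1 2 3]
  have "frag_eval (\<lambda>(x, y, z). F x y z) ?l = frag_eval (\<lambda>(x, y, z). F x y z) ?r"
    by (simp add: frag_eval_diff)
  moreover have "frag_eval (\<lambda>(x, y, z). F x y z) ?l = coA.sw (\<lambda>x h. coA.sw (\<lambda>y g. F y g h) x) a"
    using coA.frag_eval_coact[OF b1, of a] coA.frag_eval_coact[OF b3]
    by (simp add: frag_eval_extend case_prod_unfold)
  moreover have "frag_eval (\<lambda>(x, y, z). F x y z) ?r = coA.sw (\<lambda>x h. sw (\<lambda>g g'. F x g g') h) a"
    using coA.frag_eval_coact[OF b2, of a] frag_eval_coact[OF b4]
    by (simp add: frag_eval_extend case_prod_unfold)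
  ultimately show ?thesis by simp
qed

end

section \<open>The Hopf algebra axioms in Sweedler form\<close>

context fd_hopf_algebra
begin

lemma coassoc:
  fixes F :: "'h \<Rightarrow> 'h \<Rightarrow> 'h \<Rightarrow> 'c::ring_1"
  assumes "vector_space t" "\<And>g h. lin sH t (\<lambda>x. F x g h)" "\<And>x h. lin sH t (\<lambda>g. F x g h)"
    "\<And>x g. lin sH t (\<lambda>h. F x g h)"
  shows "sw (\<lambda>x h. sw (\<lambda>y g. F y g h) x) a = sw (\<lambda>x h. sw (\<lambda>g g'. F x g g') h) a"
proof -
  interpret c: fd_comodule_algebra sH \<Delta> \<epsilon> S B sH \<Delta> by unfold_locales
  show ?thesis by (rule c.coact_coassoc_sw[OF assms])
qed

lemma lin_of_sw:
  fixes F :: "'h \<Rightarrow> 'h \<Rightarrow> 'c::ring_1" and f :: "'c \<Rightarrow> 'd::ring_1"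
  shows "lin t r f \<Longrightarrow> f (sw F x) = sw (\<lambda>a b. f (F a b)) x"
  by (simp add: sweedler_def lin_sum)

lemma lin_id: "lin s s (\<lambda>x. x)"
  by (simp add: lin_def)

lemma lin_mult_left: "lin s sH g \<Longrightarrow> lin s sH (\<lambda>x. g x * c)"
  and lin_mult_right: "lin s sH g \<Longrightarrow> lin s sH (\<lambda>x. c * g x)"
  and lin_kmult_left: "lin s (*) u \<Longrightarrow> lin s (*) (\<lambda>x. u x * k)"
  and lin_kmult_right: "lin s (*) u \<Longrightarrow> lin s (*) (\<lambda>x. k * u x)"
  and lin_scale_left: "lin s (*) u \<Longrightarrow> lin s sH (\<lambda>x. sH (u x) c)"
  and lin_scale_right: "lin s sH g \<Longrightarrow> lin s sH (\<lambda>x. sH k (g x))"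
  by (simp_all add: lin_def ring_distribs A.scale_mult_left A.scale_mult_right A.scale_left_distrib
      A.scale_right_distrib ac_simps)

lemma lin_sw_fun:
  fixes F :: "'x::plus \<Rightarrow> 'h \<Rightarrow> 'h \<Rightarrow> 'c::ab_group_add"
  assumes "vector_space t" "\<And>a b. lin s t (\<lambda>x. F x a b)"
  shows "lin s t (\<lambda>x. sw (F x) y)"
proof -
  interpret t: vector_space t by (rule assms(1))
  show ?thesis
    by (rule linI) (simp_all add: sweedler_def lin_add[OF assms(2)] lin_scale[OF assms(2)] sum.distrib
        t.scale_sum_right)
qed

lemma lin_sw_arg:
  fixes F :: "'h \<Rightarrow> 'h \<Rightarrow> 'c::ab_group_add"
  assumes "vector_space t" "\<And>b. lin sH t (\<lambda>a. F a b)" "lin s sH g"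
  shows "lin s t (\<lambda>x. sw F (g x))"
  by (rule lin_compose[OF sw_lin[OF assms(1,2)] assms(3)])

lemma lin_sum_fun:
  fixes F :: "'i \<Rightarrow> 'x::plus \<Rightarrow> 'c::ab_group_add"
  assumes "vector_space t" "\<And>i. i \<in> X \<Longrightarrow> lin s t (F i)"
  shows "lin s t (\<lambda>x. \<Sum>i\<in>X. F i x)"
proof -
  interpret t: vector_space t by (rule assms(1))
  show ?thesis
    by (rule linI) (simp_all add: lin_add[OF assms(2)] lin_scale[OF assms(2)] sum.distrib t.scale_sum_right)
qed

text \<open>Closure rules that discharge the linearity side conditions of Sweedler computations;
  local \<open>rules\<close> extend them by the functionals at hand.\<close>

lemmas lin_rules = lin_id lin_mult_left lin_mult_right lin_kmult_left lin_kmult_right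
  lin_scale_left lin_scale_right lin_sw_fun lin_sw_arg lin_sum_fun vs_H vector_space_field
  lin_compose[OF counit_lin] lin_compose[OF antipode_lin] lin_compose[OF co_lin] bilinI

lemma sw_counit_left:
  fixes f :: "'h \<Rightarrow> 'c::ring_1"
  assumes f: "lin sH t f"
  shows "sw (\<lambda>a b. t (\<epsilon> a) (f b)) x = f x"
proof -
  have b: "bilin sH sH sH (\<lambda>g h. sH (\<epsilon> g) h)" by (intro lin_rules)
  have "sw (\<lambda>a b. sH (\<epsilon> a) b) x = x"
    using frag_eval_coact[OF b, of x] counit_left[of x] by (simp add: tensor_eval_eq)
  then have "f x = f (sw (\<lambda>a b. sH (\<epsilon> a) b) x)" by simp
  also have "\<dots> = sw (\<lambda>a b. t (\<epsilon> a) (f b)) x"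
    by (simp add: lin_of_sw[OF f] lin_scale[OF f])
  finally show ?thesis by simp
qed

lemma sw_counit_right:
  fixes f :: "'h \<Rightarrow> 'c::ring_1"
  assumes f: "lin sH t f"
  shows "sw (\<lambda>a b. t (\<epsilon> b) (f a)) x = f x"
proof -
  have "f x = f (sw (\<lambda>a b. sH (\<epsilon> b) a) x)" using sw_counit[OF counit_lin, of x] by simp
  also have "\<dots> = sw (\<lambda>a b. t (\<epsilon> b) (f a)) x"
    by (simp add: lin_of_sw[OF f] lin_scale[OF f])
  finally show ?thesis by simp
qed

lemma sw_antipode_left:
  fixes f :: "'h \<Rightarrow> 'c::ring_1"
  assumes f: "lin sH t f"
  shows "sw (\<lambda>a b. f (S a * b)) x = t (\<epsilon> x) (f 1)"
proof -
  have b: "bilin sH sH sH (\<lambda>g h. S g * h)" by (intro lin_rules)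
  have "sw (\<lambda>a b. S a * b) x = sH (\<epsilon> x) 1"
    using frag_eval_coact[OF b, of x] antipode_left[of x] by (simp add: tensor_eval_eq)
  then have "f (sw (\<lambda>a b. S a * b) x) = f (sH (\<epsilon> x) 1)" by (rule arg_cong)
  then show ?thesis unfolding lin_of_sw[OF f] lin_scale[OF f] .
qed

lemma sw_antipode_right:
  fixes f :: "'h \<Rightarrow> 'c::ring_1"
  assumes f: "lin sH t f"
  shows "sw (\<lambda>a b. f (a * S b)) x = t (\<epsilon> x) (f 1)"
proof -
  have b: "bilin sH sH sH (\<lambda>g h. g * S h)" by (intro lin_rules)
  have "sw (\<lambda>a b. a * S b) x = sH (\<epsilon> x) 1"
    using frag_eval_coact[OF b, of x] antipode_right[of x] by (simp add: tensor_eval_eq)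
  then have "f (sw (\<lambda>a b. a * S b) x) = f (sH (\<epsilon> x) 1)" by (rule arg_cong)
  then show ?thesis unfolding lin_of_sw[OF f] lin_scale[OF f] .
qed

end

section \<open>Integrals\<close>

context fd_hopf_algebra
begin

lemma bilin_lin:
  assumes "bilin sH sH t F"
  shows "lin s sH g \<Longrightarrow> lin s t (\<lambda>x. F (g x) y)" "lin s sH g \<Longrightarrow> lin s t (\<lambda>x. F y (g x))"
  using lin_compose[OF bilin_left[OF assms]] lin_compose[OF bilin_right[OF assms]] by blast+

text \<open>Consider \<open>S(x_1) x_2 S(x_4)_1 \<otimes> x_3 S(x_4)_2\<close>. Cancelling
  \<open>S(x_1) x_2\<close> gives the left side; comultiplying
  \<open>x_1 S(x_2) = \<epsilon>(x) 1\<close> gives the right side. It is the half step towards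
  \<open>antipode_anticomult\<close>.\<close>

lemma antipode_twist:
  fixes F :: "'h \<Rightarrow> 'h \<Rightarrow> 'c::ring_1"
  assumes t: "vector_space t" and F: "bilin sH sH t F"
  shows "sw (\<lambda>a b. sw (\<lambda>c d. F c (a * d)) (S b)) x = F (S x) 1"
proof -
  note rules = lin_rules t bilin_lin[OF F]
  let ?G = "\<lambda>s b a. sw (\<lambda>a1 a2. sw (\<lambda>c d. F (s * (a1 * c)) (a2 * d)) (S b)) a"
  \<comment> \<open>This is \<open>\<Delta>(y_1 S y_2) = \<epsilon>(y) 1 \<otimes> 1\<close>, with
    \<open>s\<close> kept as a left factor of the first leg.\<close>
  have 1: "sw (\<lambda>a b. ?G s b a) y = t (\<epsilon> y) (F s 1)" for s y
  proof -
    have bs: "bilin sH sH t (\<lambda>p q. F (s * p) q)" by (intro rules)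
    have "sw (\<lambda>a b. ?G s b a) y = sw (\<lambda>a b. sw (\<lambda>p q. F (s * p) q) (a * S b)) y"
      by (simp add: sw_mult[OF bs t])
    also have "\<dots> = t (\<epsilon> y) (sw (\<lambda>p q. F (s * p) q) 1)"
      by (rule sw_antipode_right) (intro rules)
    finally show ?thesis by (simp add: sw_one[OF bs])
  qed
  have "F (S x) 1 = sw (\<lambda>p q. t (\<epsilon> q) (F (S p) 1)) x"
    by (rule sw_counit_right[symmetric]) (intro rules)
  also have "\<dots> = sw (\<lambda>p q. sw (\<lambda>a b. ?G (S p) b a) q) x"
    by (simp add: 1)
  also have "\<dots> = sw (\<lambda>q b. sw (\<lambda>p a. ?G (S p) b a) q) x"
    by (rule coassoc[OF t, symmetric]; intro rules)
  also have "\<dots> = sw (\<lambda>q b. sw (\<lambda>u a2. sw (\<lambda>p a1. sw (\<lambda>c d. F (S p * a1 * c) (a2 * d)) (S b)) u) q) x"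
    by (subst coassoc[OF t, symmetric]; (intro rules)?) (simp add: mult.assoc)
  also have "\<dots> = sw (\<lambda>q b. sw (\<lambda>u a2. t (\<epsilon> u) (sw (\<lambda>c d. F (1 * c) (a2 * d)) (S b))) q) x"
    by (subst sw_antipode_left[of t "\<lambda>z. sw (\<lambda>c d. F (z * c) (_ * d)) (S _)"]; (intro rules)?) (rule refl)
  also have "\<dots> = sw (\<lambda>q b. sw (\<lambda>c d. F (1 * c) (q * d)) (S b)) x"
    by (subst sw_counit_left[of t "\<lambda>z. sw (\<lambda>c d. F (1 * c) (z * d)) (S _)"]; (intro rules)?) (rule refl)
  finally show ?thesis by simp
qed

text \<open>Apply \<open>antipode_twist\<close> to the leg \<open>S x_2\<close> of
  \<open>S x_2 \<otimes> S x_1\<close>. The second leg then starts with \<open>S(x_1) x_2\<close>,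
  which cancels and leaves \<open>\<Delta>(S x)\<close>.\<close>

lemma antipode_anticomult:
  fixes F :: "'h \<Rightarrow> 'h \<Rightarrow> 'c::ring_1"
  assumes t: "vector_space t" and F: "bilin sH sH t F"
  shows "sw F (S x) = sw (\<lambda>a b. F (S b) (S a)) x"
proof -
  note rules = lin_rules t bilin_lin[OF F]
  have "sw (\<lambda>p q. F (S q) (S p)) x = sw (\<lambda>p q. sw (\<lambda>a b. sw (\<lambda>c d. F c (S p * (a * d))) (S b)) q) x"
  proof -
    have "F (S q) (S p) = sw (\<lambda>a b. sw (\<lambda>c d. F c (S p * (a * d))) (S b)) q" for p q
      using antipode_twist[OF t, of "\<lambda>c d. F c (S p * d)" q] by (simp add: bilinI rules)
    then show ?thesis by simp
  qed
  also have "\<dots> = sw (\<lambda>q b. sw (\<lambda>p a. sw (\<lambda>c d. F c (S p * (a * d))) (S b)) q) x"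
    by (rule coassoc[OF t, symmetric]; intro rules)
  also have "\<dots> = sw (\<lambda>q b. sw (\<lambda>p a. sw (\<lambda>c d. F c (S p * a * d)) (S b)) q) x"
    by (simp add: mult.assoc)
  also have "\<dots> = sw (\<lambda>q b. t (\<epsilon> q) (sw (\<lambda>c d. F c (1 * d)) (S b))) x"
    by (subst sw_antipode_left[of t "\<lambda>z. sw (\<lambda>c d. F c (z * d)) (S _)"]; (intro rules)?) (rule refl)
  also have "\<dots> = sw (\<lambda>c d. F c (1 * d)) (S x)"
    by (rule sw_counit_left) (intro rules)
  finally show ?thesis by simp
qed

lemma antipode_one: "S 1 = 1"
proof -
  have "sw (\<lambda>a b. S a * b) 1 = S 1 * 1"
    by (rule sw_one[of sH]) (intro lin_rules)
  then show ?thesis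
    using sw_antipode_left[OF lin_id[of sH], of 1] by (simp add: counit_one)
qed

definition conv :: "('h \<Rightarrow> 'k) \<Rightarrow> ('h \<Rightarrow> 'k) \<Rightarrow> 'h \<Rightarrow> 'k"
  where "conv u v x = sw (\<lambda>a b. u a * v b) x"

lemma conv_lin:
  assumes u: "lin sH (*) u"
  shows "lin sH (*) (conv u v)"
  unfolding conv_def by (intro lin_rules lin_compose[OF u])

lemma conv_assoc:
  assumes u: "lin sH (*) u" and v: "lin sH (*) v" and w: "lin sH (*) w"
  shows "conv (conv u v) w = conv u (conv v w)"
proof
  fix x
  have "conv (conv u v) w x = sw (\<lambda>a b. sw (\<lambda>c d. u c * (v d * w b)) a) x"
    by (simp add: conv_def sweedler_def sum_distrib_right mult.assoc)
  also have "\<dots> = sw (\<lambda>a b. sw (\<lambda>c d. u a * (v c * w d)) b) x"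
    by (rule coassoc[OF vector_space_field]; intro lin_rules lin_compose[OF u] lin_compose[OF v] lin_compose[OF w])
  also have "\<dots> = conv u (conv v w) x"
    by (simp add: conv_def sweedler_def sum_distrib_left)
  finally show "conv (conv u v) w x = conv u (conv v w) x" .
qed

lemma conv_counit_left: "lin sH (*) u \<Longrightarrow> conv \<epsilon> u = u"
  and conv_counit_right: "lin sH (*) u \<Longrightarrow> conv u \<epsilon> = u"
proof -
  assume u: "lin sH (*) u"
  show "conv \<epsilon> u = u" using sw_counit_left[OF u] by (simp add: conv_def fun_eq_iff)
  show "conv u \<epsilon> = u" using sw_counit_right[OF u] by (simp add: conv_def fun_eq_iff mult.commute)
qed

text \<open>Convolution is the transpose of \<open>\<Delta>\<close>. Hence in the canonical element
  \<open>\<Sum> co b \<otimes> b\<close> a product of dual basis vectors may be traded for a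
  coproduct of basis vectors.\<close>

lemma sum_dual_basis_conv:
  fixes G :: "('h \<Rightarrow> 'k) \<Rightarrow> 'h \<Rightarrow> 'h \<Rightarrow> 'k"
  assumes 0: "\<And>q l m. lin sH (*) q \<Longrightarrow> G q l m = (\<Sum>w\<in>B. q w * G (co w) l m)"
    and 1: "\<And>q m. lin sH (*) (\<lambda>l. G q l m)" and 2: "\<And>q l. lin sH (*) (G q l)"
  shows "(\<Sum>l\<in>B. \<Sum>m\<in>B. G (conv (co l) (co m)) l m) = (\<Sum>w\<in>B. sw (G (co w)) w)"
proof -
  have ex: "F a b = (\<Sum>l\<in>B. \<Sum>m\<in>B. co l a * co m b * F l m)"
    if "\<And>m. lin sH (*) (\<lambda>l. F l m)" "\<And>l. lin sH (*) (F l)" for F :: "'h \<Rightarrow> 'h \<Rightarrow> 'k" and a b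
  proof -
    have "F a b = (\<Sum>l\<in>B. co l a * F l b)" by (rule lin_expand[OF that(1)])
    also have "\<dots> = (\<Sum>l\<in>B. co l a * (\<Sum>m\<in>B. co m b * F l m))"
      by (rule sum.cong[OF refl], rule arg_cong[where f = "(*) _"], rule lin_expand[OF that(2)])
    finally show ?thesis by (simp add: sum_distrib_left mult.assoc)
  qed
  have "(\<Sum>l\<in>B. \<Sum>m\<in>B. G (conv (co l) (co m)) l m)
      = (\<Sum>l\<in>B. \<Sum>m\<in>B. \<Sum>w\<in>B. conv (co l) (co m) w * G (co w) l m)"
    by (intro sum.cong refl 0 conv_lin co_lin)
  also have "\<dots> = (\<Sum>l\<in>B. \<Sum>w\<in>B. \<Sum>m\<in>B. conv (co l) (co m) w * G (co w) l m)"
    by (rule sum.cong[OF refl], rule sum.swap)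
  also have "\<dots> = (\<Sum>w\<in>B. \<Sum>l\<in>B. \<Sum>m\<in>B. conv (co l) (co m) w * G (co w) l m)"
    by (rule sum.swap)
  also have "\<dots> = (\<Sum>w\<in>B. sw (\<lambda>a b. \<Sum>l\<in>B. \<Sum>m\<in>B. co l a * co m b * G (co w) l m) w)"
  proof (rule sum.cong[OF refl])
    fix w
    have "(\<Sum>l\<in>B. \<Sum>m\<in>B. conv (co l) (co m) w * G (co w) l m)
      = (\<Sum>l\<in>B. \<Sum>m\<in>B. \<Sum>b\<in>B. co l (comp b w) * co m b * G (co w) l m)"
      by (simp add: conv_def sweedler_def sum_distrib_right)
    also have "\<dots> = (\<Sum>l\<in>B. \<Sum>b\<in>B. \<Sum>m\<in>B. co l (comp b w) * co m b * G (co w) l m)"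
      by (rule sum.cong[OF refl], rule sum.swap)
    also have "\<dots> = (\<Sum>b\<in>B. \<Sum>l\<in>B. \<Sum>m\<in>B. co l (comp b w) * co m b * G (co w) l m)"
      by (rule sum.swap)
    finally show "(\<Sum>l\<in>B. \<Sum>m\<in>B. conv (co l) (co m) w * G (co w) l m)
      = sw (\<lambda>a b. \<Sum>l\<in>B. \<Sum>m\<in>B. co l a * co m b * G (co w) l m) w"
      by (simp add: sweedler_def)
  qed
  also have "\<dots> = (\<Sum>w\<in>B. sw (G (co w)) w)"
  proof (rule sum.cong[OF refl])
    fix w
    have "(\<lambda>a b. \<Sum>l\<in>B. \<Sum>m\<in>B. co l a * co m b * G (co w) l m) = G (co w)"
      by (intro ext) (rule ex[symmetric, OF 1 2])
    then show "sw (\<lambda>a b. \<Sum>l\<in>B. \<Sum>m\<in>B. co l a * co m b * G (co w) l m) w = sw (G (co w)) w"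
      by simp
  qed
  finally show ?thesis .
qed

lemma conv_expand_right:
  "lin sH (*) q \<Longrightarrow> conv p q z = (\<Sum>w\<in>B. q w * conv p (co w) z)"
proof -
  assume q: "lin sH (*) q"
  have "conv p q z = sw (\<lambda>a b. p a * (\<Sum>w\<in>B. co w b * q w)) z"
    unfolding conv_def lin_expand[OF q, symmetric] by (rule refl)
  also have "\<dots> = (\<Sum>w\<in>B. q w * conv p (co w) z)"
    unfolding conv_def sweedler_def sum_distrib_left
    by (subst sum.swap) (simp add: ac_simps)
  finally show ?thesis .
qed

text \<open>The trace formula behind the existence of integrals (Larson and Sweedler).\<close>

definition trace_integral :: "('h \<Rightarrow> 'k) \<Rightarrow> 'h \<Rightarrow> 'k"
  where "trace_integral p x = (\<Sum>l\<in>B. conv p (co l) (S (x * S l)))"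

lemma trace_integral_lin: "lin sH (*) p \<Longrightarrow> lin sH (*) (trace_integral p)"
  unfolding trace_integral_def by (intro lin_rules lin_compose[OF conv_lin])

text \<open>\<open>trace_integral p x\<close> is the trace of \<open>h \<mapsto> p(z_1) z_2\<close>
  with \<open>z = S (x * S h)\<close>. Here \<open>antipode_twist\<close> creates the factor
  \<open>u 1\<close>, expanding \<open>u\<close> in the dual basis introduces a second index
  \<open>m\<close>, and \<open>sum_dual_basis_conv\<close> merges \<open>l\<close> and
  \<open>m\<close> into components of one vector \<open>w\<close>. By anticomultiplicativity
  \<open>S(w_2) w_3\<close> then appears inside \<open>u\<close> and cancels.\<close>

lemma trace_integral_integral:
  assumes p: "lin sH (*) p" and u: "lin sH (*) u"
  shows "conv u (trace_integral p) x = u 1 * trace_integral p x"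
proof -
  note rules = lin_rules lin_compose[OF p] lin_compose[OF u] lin_compose[OF conv_lin] p u
  let ?G = "\<lambda>q l m. sw (\<lambda>a b. sw (\<lambda>l1 l2. u (a * S l2 * m) * conv p q (S (b * S l1))) l) x"
  have "u 1 * trace_integral p x = (\<Sum>l\<in>B. conv p (co l) (S (x * S l)) * u 1)"
    by (simp add: trace_integral_def sum_distrib_left mult.commute)
  also have "\<dots> = (\<Sum>l\<in>B. sw (\<lambda>a b. sw (\<lambda>c d. conv p (co l) c * u (a * d)) (S b)) (x * S l))"
    by (intro sum.cong refl antipode_twist[OF vector_space_field, symmetric] rules)
  also have "\<dots> = (\<Sum>l\<in>B. \<Sum>m\<in>B. ?G (conv (co l) (co m)) l m)"
  proof (rule sum.cong[OF refl])
    fix l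
    have inner: "sw (\<lambda>c d. conv p (co l) c * u (a * d)) z = (\<Sum>m\<in>B. u (a * m) * conv p (conv (co l) (co m)) z)" for a z
    proof -
      have "sw (\<lambda>c d. conv p (co l) c * u (a * d)) z = conv (conv p (co l)) (\<lambda>d. u (a * d)) z"
        by (simp add: conv_def)
      also have "\<dots> = (\<Sum>m\<in>B. u (a * m) * conv (conv p (co l)) (co m) z)"
        by (rule conv_expand_right) (intro rules)
      finally show ?thesis by (simp add: conv_assoc[OF p co_lin co_lin])
    qed
    have "sw (\<lambda>a b. sw (\<lambda>c d. conv p (co l) c * u (a * d)) (S b)) (x * S l)
        = (\<Sum>m\<in>B. sw (\<lambda>a b. u (a * m) * conv p (conv (co l) (co m)) (S b)) (x * S l))"
      unfolding inner unfolding sweedler_def by (rule sum.swap)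
    also have "\<dots> = (\<Sum>m\<in>B. ?G (conv (co l) (co m)) l m)"
    proof (rule sum.cong[OF refl])
      fix m
      let ?F = "\<lambda>a b. u (a * m) * conv p (conv (co l) (co m)) (S b)"
      have b: "bilin sH sH (*) ?F" by (intro rules)
      show "sw ?F (x * S l) = ?G (conv (co l) (co m)) l m"
        unfolding sw_mult[OF b vector_space_field]
        by (subst antipode_anticomult[OF vector_space_field]; (intro rules)?) (rule refl)
    qed
    finally show "sw (\<lambda>a b. sw (\<lambda>c d. conv p (co l) c * u (a * d)) (S b)) (x * S l)
      = (\<Sum>m\<in>B. ?G (conv (co l) (co m)) l m)" .
  qed
  also have "\<dots> = (\<Sum>w\<in>B. sw (?G (co w)) w)"
  proof (rule sum_dual_basis_conv)
    fix q :: "'h \<Rightarrow> 'k" and l m assume q: "lin sH (*) q"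
    have "?G q l m = sw (\<lambda>a b. sw (\<lambda>l1 l2. \<Sum>w\<in>B. q w * (u (a * S l2 * m) * conv p (co w) (S (b * S l1)))) l) x"
      by (subst conv_expand_right[OF q]) (simp add: sum_distrib_left ac_simps)
    also have "\<dots> = (\<Sum>w\<in>B. q w * ?G (co w) l m)"
      unfolding sweedler_def sum_distrib_left
      by (subst sum.swap, rule sum.cong[OF refl], rule sum.swap)
    finally show "?G q l m = (\<Sum>w\<in>B. q w * ?G (co w) l m)" .
  qed (intro rules)+
  also have "\<dots> = (\<Sum>w\<in>B. sw (\<lambda>a b. u a * conv p (co w) (S (b * S w))) x)"
  proof (rule sum.cong[OF refl])
    fix w
    have "sw (?G (co w)) w = sw (\<lambda>a b. sw (\<lambda>l m. sw (\<lambda>l1 l2. u (a * S l2 * m) * conv p (co w) (S (b * S l1))) l) w) x"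
      unfolding sweedler_def by (subst sum.swap) (rule refl)
    also have "\<dots> = sw (\<lambda>a b. sw (\<lambda>l1 r. sw (\<lambda>l2 m. u (a * (S l2 * m)) * conv p (co w) (S (b * S l1))) r) w) x"
      by (subst coassoc[OF vector_space_field]; (intro rules)?) (simp add: mult.assoc)
    also have "\<dots> = sw (\<lambda>a b. sw (\<lambda>l1 r. \<epsilon> r * (u (a * 1) * conv p (co w) (S (b * S l1)))) w) x"
      by (subst sw_antipode_left[of "(*)" "\<lambda>z. u (_ * z) * conv p (co w) (S (_ * S _))"]; (intro rules)?) (rule refl)
    also have "\<dots> = sw (\<lambda>a b. u (a * 1) * conv p (co w) (S (b * S w))) x"
      by (subst sw_counit_right[of "(*)" "\<lambda>z. u (_ * 1) * conv p (co w) (S (_ * S z))"]; (intro rules)?) (rule refl)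
    finally show "sw (?G (co w)) w = sw (\<lambda>a b. u a * conv p (co w) (S (b * S w))) x" by simp
  qed
  also have "\<dots> = conv u (trace_integral p) x"
    unfolding conv_def[of u] trace_integral_def sweedler_def sum_distrib_left by (rule sum.swap)
  finally show ?thesis by simp
qed

text \<open>Merging the two dual basis sums makes \<open>m_1 S m_2\<close> appear, which cancels.
  The formula serves to show that the integrals just constructed are not all zero.\<close>

lemma sum_trace_integral:
  assumes p: "lin sH (*) p"
  shows "(\<Sum>m\<in>B. trace_integral (conv p (co m)) (x * m)) = p (S x)"
proof -
  note rules = lin_rules lin_compose[OF p] lin_compose[OF conv_lin] p
  have "(\<Sum>m\<in>B. trace_integral (conv p (co m)) (x * m))
      = (\<Sum>m\<in>B. \<Sum>l\<in>B. conv p (conv (co m) (co l)) (S (x * (m * S l))))"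
    by (simp add: trace_integral_def conv_assoc[OF p co_lin co_lin] mult.assoc)
  also have "\<dots> = (\<Sum>w\<in>B. sw (\<lambda>m l. conv p (co w) (S (x * (m * S l)))) w)"
    by (rule sum_dual_basis_conv[of "\<lambda>q m l. conv p q (S (x * (m * S l)))"])
      (rule conv_expand_right | intro rules | assumption)+
  also have "\<dots> = (\<Sum>w\<in>B. \<epsilon> w * conv p (co w) (S x))"
    by (subst sw_antipode_right[of "(*)" "\<lambda>z. conv p (co _) (S (x * z))"]; (intro rules)?) simp
  also have "\<dots> = conv p \<epsilon> (S x)" by (rule conv_expand_right[OF counit_lin, symmetric])
  finally show ?thesis by (simp add: conv_counit_right[OF p])
qed

lemma exists_integral:
  obtains \<Lambda> where "lin sH (*) \<Lambda>" "\<And>u x. lin sH (*) u \<Longrightarrow> conv u \<Lambda> x = u 1 * \<Lambda> x" "\<exists>x. \<Lambda> x \<noteq> 0"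
proof -
  \<comment> \<open>The sum equals \<open>\<epsilon> (S 1) = 1\<close>, so some summand is the value
    of a nonzero integral.\<close>
  have "(\<Sum>m\<in>B. trace_integral (conv \<epsilon> (co m)) (1 * m)) \<noteq> 0"
    using sum_trace_integral[OF counit_lin, of 1] by (simp add: antipode_one counit_one)
  then obtain m where m: "trace_integral (conv \<epsilon> (co m)) (1 * m) \<noteq> 0"
    by (meson sum.neutral)
  show thesis
    by (rule that[of "trace_integral (conv \<epsilon> (co m))"])
      (use m trace_integral_lin trace_integral_integral conv_lin counit_lin in \<open>blast+\<close>)
qed

end

section \<open>Nondegeneracy of the integral and surjectivity of the antipode\<close>

locale fd_hopf_integral = fd_hopf_algebra sH \<Delta> \<epsilon> S B
  for sH :: "'k::field \<Rightarrow> 'h::ring_1 \<Rightarrow> 'h" and \<Delta> and \<epsilon> and S and B +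
  fixes \<Lambda> :: "'h \<Rightarrow> 'k"
  assumes integral_lin: "lin sH (*) \<Lambda>"
    and integral: "lin sH (*) u \<Longrightarrow> conv u \<Lambda> x = u 1 * \<Lambda> x"
    and integral_nonzero: "\<exists>x. \<Lambda> x \<noteq> 0"
begin

lemma eq_if_coordinates:
  assumes "\<And>b. b \<in> B \<Longrightarrow> co b x = co b y"
  shows "x = y"
proof -
  have "(\<Sum>b\<in>B. sH (co b x) b) = (\<Sum>b\<in>B. sH (co b y) b)"
    by (rule sum.cong) (simp_all add: assms)
  then show ?thesis by (simp only: co_sum)
qed

lemma integral_sw: "sw (\<lambda>a b. sH (\<Lambda> b) a) y = sH (\<Lambda> y) 1"
proof (rule eq_if_coordinates)
  fix c assume "c \<in> B"
  have "co c (sw (\<lambda>a b. sH (\<Lambda> b) a) y) = conv (co c) \<Lambda> y"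
    unfolding lin_of_sw[OF co_lin] conv_def by (simp add: lin_scale[OF co_lin] mult.commute)
  then show "co c (sw (\<lambda>a b. sH (\<Lambda> b) a) y) = co c (sH (\<Lambda> y) 1)"
    by (simp add: integral[OF co_lin] lin_scale[OF co_lin] mult.commute)
qed

text \<open>Both sides equal \<open>S(x_1) x_2 w_1 \<Lambda>(x_3 w_2)\<close>: either cancel
  \<open>S(x_1) x_2\<close>, or apply the integral property to \<open>x_2 w\<close>.\<close>

lemma integral_shift: "sw (\<lambda>a b. sH (\<Lambda> (x * b)) a) w = sw (\<lambda>a b. sH (\<Lambda> (b * w)) (S a)) x"
proof -
  note rules = lin_rules lin_compose[OF integral_lin]
  let ?F = "\<lambda>c d. sH (\<Lambda> d) c"
  have b: "bilin sH sH sH ?F" by (intro rules)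
  have "sw (\<lambda>a b. sH (\<Lambda> (b * w)) (S a)) x = sw (\<lambda>a b. S a * sH (\<Lambda> (b * w)) 1) x"
    by (simp add: A.scale_mult_right)
  also have "\<dots> = sw (\<lambda>a b. S a * sw ?F (b * w)) x"
    by (simp add: integral_sw)
  also have "\<dots> = sw (\<lambda>a b. sw (\<lambda>b1 b2. S a * sw (\<lambda>w1 w2. sH (\<Lambda> (b2 * w2)) (b1 * w1)) w) b) x"
    unfolding sw_mult[OF b vs_H] by (subst lin_of_sw[of sH sH "(*) _"]; (intro rules)?) (rule refl)
  also have "\<dots> = sw (\<lambda>b b2. sw (\<lambda>a b1. S a * sw (\<lambda>w1 w2. sH (\<Lambda> (b2 * w2)) (b1 * w1)) w) b) x"
    by (rule coassoc[OF vs_H, symmetric]; intro rules)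
  also have "\<dots> = sw (\<lambda>b b2. sw (\<lambda>a b1. sw (\<lambda>w1 w2. sH (\<Lambda> (b2 * w2)) (S a * b1 * w1)) w) b) x"
    by (subst lin_of_sw[of sH sH "(*) _"]; (intro rules)?) (simp add: A.scale_mult_right mult.assoc)
  also have "\<dots> = sw (\<lambda>b b2. sH (\<epsilon> b) (sw (\<lambda>w1 w2. sH (\<Lambda> (b2 * w2)) (1 * w1)) w)) x"
    by (subst sw_antipode_left[of sH "\<lambda>z. sw (\<lambda>w1 w2. sH (\<Lambda> (_ * w2)) (z * w1)) w"]; (intro rules)?) (rule refl)
  also have "\<dots> = sw (\<lambda>w1 w2. sH (\<Lambda> (x * w2)) (1 * w1)) w"
    by (rule sw_counit_left) (intro rules)
  finally show ?thesis by simp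
qed

text \<open>By \<open>integral_shift\<close> the hypothesis gives
  \<open>w_1 \<Lambda>(x w_2) = 0\<close>. So the vectors satisfying it are stable under
  \<open>w \<mapsto> u(w_1) w_2\<close>, and it suffices that \<open>\<epsilon>\<close> vanishes on
  all of them: with \<open>u = co c\<close> this kills the coordinates of \<open>w\<close>.\<close>

lemma integral_nondegenerate:
  assumes w: "\<And>x. \<Lambda> (x * w) = 0"
  shows "w = 0"
proof (rule eq_if_coordinates)
  note rules = lin_rules lin_compose[OF integral_lin]
  have 0: "sw (\<lambda>a b. sH (\<Lambda> (x * b)) a) v = 0" if "\<And>x. \<Lambda> (x * v) = 0" for x v
    by (subst integral_shift) (simp add: that sweedler_def)
  \<comment> \<open>Here \<open>\<epsilon>(v) \<Lambda>(y) = \<Lambda>(y S(v_1) v_2)\<close>;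
    splitting \<open>v_1\<close> into coordinates produces terms of the form covered by fact
    \<open>0\<close>.\<close>
  have eps: "\<epsilon> v = 0" if v: "\<And>x. \<Lambda> (x * v) = 0" for v
  proof -
    obtain y where y: "\<Lambda> y \<noteq> 0" using integral_nonzero by blast
    have "\<epsilon> v * \<Lambda> (y * 1) = sw (\<lambda>a b. \<Lambda> (y * (S a * b))) v"
      by (rule sw_antipode_left[symmetric]) (intro rules)
    also have "\<dots> = sw (\<lambda>a b. \<Sum>c\<in>B. co c a * \<Lambda> (y * (S c * b))) v"
    proof -
      have "\<Lambda> (y * (S a * b)) = (\<Sum>c\<in>B. co c a * \<Lambda> (y * (S c * b)))" for a b
        by (rule lin_expand) (intro rules)
      then show ?thesis by (rule arg_cong2[where f = sw, OF ext[OF ext] refl])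
    qed
    also have "\<dots> = (\<Sum>c\<in>B. sw (\<lambda>a b. co c a * \<Lambda> (y * S c * b)) v)"
      unfolding sweedler_def mult.assoc by (rule sum.swap)
    also have "\<dots> = (\<Sum>c\<in>B. co c (sw (\<lambda>a b. sH (\<Lambda> (y * S c * b)) a) v))"
      by (simp add: lin_of_sw[OF co_lin] lin_scale[OF co_lin] mult.commute)
    also have "\<dots> = 0" by (simp add: 0[OF v] lin_0[OF co_lin])
    finally show ?thesis using y by simp
  qed
  fix c assume "c \<in> B"
  let ?v = "sw (\<lambda>a b. sH (co c a) b) w"
  have "\<Lambda> (x * ?v) = 0" for x
  proof -
    have "\<Lambda> (x * ?v) = sw (\<lambda>a b. \<Lambda> (x * sH (co c a) b)) w"
      by (rule lin_of_sw[of sH "(*)"]) (intro rules)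
    also have "\<dots> = co c (sw (\<lambda>a b. sH (\<Lambda> (x * b)) a) w)"
      by (simp add: lin_of_sw[OF co_lin] lin_scale[OF co_lin] A.scale_mult_right lin_scale[OF integral_lin] mult.commute)
    finally show ?thesis by (simp add: 0[OF w] lin_0[OF co_lin])
  qed
  from eps[OF this] have "sw (\<lambda>a b. \<epsilon> b * co c a) w = 0"
    by (simp add: lin_of_sw[OF counit_lin] lin_scale[OF counit_lin] mult.commute)
  then show "co c w = co c 0"
    by (simp add: sw_counit_right[OF co_lin] lin_0[OF co_lin])
qed

text \<open>The Frobenius property: \<open>w \<mapsto> \<Lambda>(_ * w)\<close> is injective by
  nondegeneracy, hence onto the dual by dimension. \<open>?M\<close> identifies functionals with
  vectors through the basis, so that an endomorphism of \<open>H\<close> results.\<close>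

lemma integral_represents:
  assumes u: "lin sH (*) u"
  obtains w where "\<And>x. u x = \<Lambda> (x * w)"
proof -
  note rules = lin_rules lin_compose[OF integral_lin]
  let ?M = "\<lambda>w. \<Sum>b\<in>B. sH (\<Lambda> (b * w)) b"
  interpret fd: finite_dimensional_vector_space sH B
    by unfold_locales (rule finite_B indep_B span_B)+
  have M: "lin sH sH ?M" by (intro rules)
  have co_M: "co b (\<Sum>b\<in>B. sH (f b) b) = f b" if b: "b \<in> B" for b f
  proof -
    have "co b (\<Sum>b\<in>B. sH (f b) b) = (\<Sum>b'\<in>B. f b' * co b b')"
      by (simp add: lin_sum[OF co_lin] lin_scale[OF co_lin])
    also have "\<dots> = (\<Sum>b'\<in>B. if b' = b then f b' else 0)"
      using b by (intro sum.cong) (auto simp: co_basis)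
    finally show ?thesis using b finite_B by simp
  qed
  have "inj ?M"
  proof (rule injI)
    fix v w assume "?M v = ?M w"
    then have M0: "?M (v - w) = 0" by (simp add: lin_diff[OF M])
    have "\<Lambda> (x * (v - w)) = 0" for x
    proof -
      have l: "lin sH (*) (\<lambda>x. \<Lambda> (x * (v - w)))" by (intro rules)
      have "\<Lambda> (b * (v - w)) = 0" if b: "b \<in> B" for b
        using co_M[OF b, of "\<lambda>b. \<Lambda> (b * (v - w))"] M0 by (simp add: lin_0[OF co_lin])
      then show ?thesis unfolding lin_expand[OF l, of x] by (intro sum.neutral) simp
    qed
    then show "v = w" using integral_nondegenerate[of "v - w"] by simp
  qed
  then have "surj ?M"
    by (rule fd.linear_inj_imp_surj[OF linear_of_lin[OF vs_H vs_H M]])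
  from surjD[OF this] obtain w where w: "(\<Sum>b\<in>B. sH (u b) b) = ?M w" by blast
  show thesis
  proof (rule that)
    fix x
    have l: "lin sH (*) (\<lambda>x. \<Lambda> (x * w))" by (intro rules)
    have "u b = \<Lambda> (b * w)" if b: "b \<in> B" for b
      using co_M[OF b, of u] unfolding w co_M[OF b] by (rule sym)
    then show "u x = \<Lambda> (x * w)"
      unfolding lin_expand[OF u, of x] lin_expand[OF l, of x] by (intro sum.cong) simp_all
  qed
qed

text \<open>Let \<open>v\<close> vanish on the range of \<open>S\<close>. By
  \<open>integral_shift\<close> it kills \<open>w_1 \<Lambda>(x w_2)\<close>, so
  \<open>v(w_1) w_2\<close> is in the radical of \<open>\<Lambda>\<close> and is 0; the counit then
  gives \<open>v(w) = 0\<close>.\<close>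

lemma antipode_surj: "surj S"
proof (rule ccontr)
  assume "\<not> surj S"
  then obtain h where h: "h \<notin> range S" by blast
  interpret Sl: Vector_Spaces.linear sH sH S by (rule linear_of_lin[OF vs_H vs_H antipode_lin])
  have "A.subspace (range S)" by (rule Sl.subspace_image[OF A.subspace_UNIV])
  then obtain v where v: "Vector_Spaces.linear sH (*) v" "\<And>w. w \<in> range S \<Longrightarrow> v w = 0" "v h = 1"
    using vector_space.separating_functional[OF vs_H _ h] by metis
  note vl = lin_of_linear[OF v(1)]
  note rules = lin_rules lin_compose[OF integral_lin] lin_compose[OF vl] vl
  have "sw (\<lambda>a b. sH (v a) b) w = 0" for w
  proof (rule integral_nondegenerate)
    fix x
    have "\<Lambda> (x * sw (\<lambda>a b. sH (v a) b) w) = sw (\<lambda>a b. \<Lambda> (x * sH (v a) b)) w"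
      by (rule lin_of_sw[of sH "(*)"]) (intro rules)
    also have "\<dots> = v (sw (\<lambda>a b. sH (\<Lambda> (x * b)) a) w)"
      by (simp add: lin_of_sw[OF vl] lin_scale[OF vl] A.scale_mult_right lin_scale[OF integral_lin] mult.commute)
    also have "\<dots> = 0"
      unfolding integral_shift lin_of_sw[OF vl] lin_scale[OF vl] by (simp add: v(2) sweedler_def)
    finally show "\<Lambda> (x * sw (\<lambda>a b. sH (v a) b) w) = 0" .
  qed
  then have "\<epsilon> (sw (\<lambda>a b. sH (v a) b) h) = 0" by (simp add: lin_0[OF counit_lin])
  then have "sw (\<lambda>a b. \<epsilon> b * v a) h = 0"
    by (simp add: lin_of_sw[OF counit_lin] lin_scale[OF counit_lin] mult.commute)
  then show False using sw_counit_right[OF vl, of h] v(3) by simp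
qed

end

section \<open>Modules over the dual of a quotient coalgebra\<close>

abbreviation fdim :: "('k::field \<Rightarrow> 'b::ab_group_add \<Rightarrow> 'b) \<Rightarrow> 'b set \<Rightarrow> bool" where "fdim \<equiv> lin_space.fin_dim"
abbreviation dm :: "('k::field \<Rightarrow> 'b::ab_group_add \<Rightarrow> 'b) \<Rightarrow> 'b set \<Rightarrow> nat" where "dm \<equiv> vector_space.dim"
abbreviation subsp :: "('k::field \<Rightarrow> 'b::ab_group_add \<Rightarrow> 'b) \<Rightarrow> 'b set \<Rightarrow> bool" where "subsp \<equiv> module.subspace"

lemma lin_space_of: "vector_space s \<Longrightarrow> lin_space s"
  by (simp add: lin_space_def)

lemma lin_space_pair_of: "vector_space s1 \<Longrightarrow> vector_space s2 \<Longrightarrow> lin_space_pair s1 s2"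
  by (simp add: lin_space_pair_def lin_space_def)

lemma subspI:
  "vector_space s \<Longrightarrow> 0 \<in> V \<Longrightarrow> (\<And>x y. x \<in> V \<Longrightarrow> y \<in> V \<Longrightarrow> x + y \<in> V) \<Longrightarrow>
    (\<And>c x. x \<in> V \<Longrightarrow> s c x \<in> V) \<Longrightarrow> subsp s V"
  by (simp add: module.subspace_def module_iff_vector_space)

lemma subsp_0: "vector_space s \<Longrightarrow> subsp s V \<Longrightarrow> 0 \<in> V"
  and subsp_add: "vector_space s \<Longrightarrow> subsp s V \<Longrightarrow> x \<in> V \<Longrightarrow> y \<in> V \<Longrightarrow> x + y \<in> V"
  and subsp_scale: "vector_space s \<Longrightarrow> subsp s V \<Longrightarrow> x \<in> V \<Longrightarrow> s c x \<in> V"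
  by (simp_all add: module.subspace_def module_iff_vector_space)

lemma subsp_sum: "vector_space s \<Longrightarrow> subsp s V \<Longrightarrow> (\<And>i. i \<in> X \<Longrightarrow> f i \<in> V) \<Longrightarrow> sum f X \<in> V"
  by (induction X rule: infinite_finite_induct) (auto intro: subsp_0 subsp_add)

lemma subsp_kernel:
  assumes "vector_space s" "vector_space t" "lin s t T" "subsp s V"
  shows "subsp s {v \<in> V. T v = 0}"
proof -
  interpret t: vector_space t by (rule assms(2))
  show ?thesis
    by (rule subspI[OF assms(1)])
      (auto simp: lin_0[OF assms(3)] lin_add[OF assms(3)] lin_scale[OF assms(3)]
        intro: subsp_0[OF assms(1,4)] subsp_add[OF assms(1,4)] subsp_scale[OF assms(1,4)])
qed

lemma subsp_image:
  assumes "vector_space s" "vector_space t" "lin s t T" "subsp s V"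
  shows "subsp t (T ` V)"
  using Vector_Spaces.linear.axioms(3)[OF linear_of_lin[OF assms(1-3)]] assms(4)
  by (rule module_hom.subspace_image)

lemma fdim_subset: "vector_space s \<Longrightarrow> fdim s V \<Longrightarrow> W \<subseteq> V \<Longrightarrow> fdim s W"
  by (rule lin_space.fin_dim_subset[OF lin_space_of])

lemma dm_mono: "vector_space s \<Longrightarrow> subsp s V \<Longrightarrow> subsp s W \<Longrightarrow> fdim s W \<Longrightarrow> V \<subseteq> W \<Longrightarrow> dm s V \<le> dm s W"
  by (rule lin_space.dim_mono_fin[OF lin_space_of])

lemma dm_strict_mono: "vector_space s \<Longrightarrow> subsp s V \<Longrightarrow> subsp s W \<Longrightarrow> fdim s W \<Longrightarrow> V \<subset> W \<Longrightarrow> dm s V < dm s W"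
  by (rule lin_space.dim_less_fin[OF lin_space_of])

lemma fdim_zero: "vector_space s \<Longrightarrow> fdim s {0}" and dm_zero: "vector_space s \<Longrightarrow> dm s {0} = 0"
  by (simp_all add: lin_space.fin_dim_zero lin_space_of)

lemma lin_rank_nullity:
  assumes "vector_space s1" "vector_space s2" "lin s1 s2 T" "subsp s1 V" "fdim s1 V"
  shows "fdim s2 (T ` V)" "dm s1 V = dm s1 {v \<in> V. T v = 0} + dm s2 (T ` V)"
  using lin_space_pair.rank_nullity_fin_dim[OF lin_space_pair_of[OF assms(1,2)]
      linear_of_lin[OF assms(1,2,3)] assms(4,5)] by auto

lemma lin_rank_bound:
  assumes "vector_space s1" "vector_space s2" "lin s1 s2 T" "subsp s1 V"
    and "subsp s2 W" "fdim s2 W" "T ` V \<subseteq> W" "fdim s1 {v \<in> V. T v = 0}"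
  shows "fdim s1 V" "dm s1 V \<le> dm s1 {v \<in> V. T v = 0} + dm s2 W"
proof -
  have f: "fdim s2 (T ` V)" by (rule fdim_subset[OF assms(2,6,7)])
  have s: "subsp s2 (T ` V)" by (rule subsp_image[OF assms(1-4)])
  note rn = lin_space_pair.rank_nullity[OF lin_space_pair_of[OF assms(1,2)]
      linear_of_lin[OF assms(1,2,3)] assms(4,8) f]
  show "fdim s1 V" by (rule rn(1))
  show "dm s1 V \<le> dm s1 {v \<in> V. T v = 0} + dm s2 W"
    using rn(2) dm_mono[OF assms(2) s assms(5,6,7)] by simp
qed

lemma lin_injective_bound:
  assumes "vector_space s1" "vector_space s2" "lin s1 s2 T" "subsp s1 V"
    and "subsp s2 W" "fdim s2 W" "T ` V \<subseteq> W" "\<And>v. v \<in> V \<Longrightarrow> T v = 0 \<Longrightarrow> v = 0"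
  shows "dm s1 V \<le> dm s2 W"
proof -
  have k: "{v \<in> V. T v = 0} = {0}" using assms(8) subsp_0[OF assms(1,4)] lin_0[OF assms(3)] by blast
  show ?thesis
    using lin_rank_bound(2)[OF assms(1-7), unfolded k] by (simp add: fdim_zero dm_zero assms(1))
qed

text \<open>Stands for the quotient map modulo \<open>W\<close>. It is realized as the projection
  along \<open>W\<close> onto a complement, so that no quotient type is needed.\<close>

lemma exists_lin_with_kernel:
  assumes s: "vector_space s" and W: "subsp s W"
  obtains P where "lin s s P" "\<And>v. P v = 0 \<longleftrightarrow> v \<in> W"
proof -
  interpret vector_space s by (rule s)
  interpret p: vector_space_pair s s ..
  obtain C where C: "C \<subseteq> W" "independent C" "W \<subseteq> span C" "card C = dim W"
    by (rule basis_exists)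
  obtain E where E: "C \<subseteq> E" "E \<subseteq> UNIV" "independent E" "UNIV \<subseteq> span E"
    by (rule maximal_independent_subset_extend[OF subset_UNIV C(2)])
  obtain P where P: "Vector_Spaces.linear s s P" "\<forall>x\<in>E. P x = (if x \<in> C then 0 else x)"
    using p.linear_independent_extend[OF E(3), of "\<lambda>x. if x \<in> C then 0 else x"] by blast
  interpret P: Vector_Spaces.linear s s P by (rule P(1))
  have spC: "span C = W" using C W span_minimal by blast
  have P0: "P v = 0" if v: "v \<in> span C" for v
    using v
  proof (induction rule: span_induct_alt)
    case base then show ?case by (rule P.zero)
  next
    case (step c x y)
    then show ?case using P(2) E(1) by (auto simp: P.add P.scale)
  qed
  have "v \<in> W" if v: "P v = 0" for v
  proof -
    have "v \<in> span (C \<union> (E - C))" using E(1) subsetD[OF E(4) UNIV_I, of v] by (simp add: Un_absorb1)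
    then obtain y z where yz: "v = y + z" "y \<in> span C" "z \<in> span (E - C)"
      unfolding span_Un by blast
    have "P z = z" using yz(3)
    proof (induction rule: span_induct_alt)
      case base then show ?case by (rule P.zero)
    next
      case (step c x y)
      then show ?case using P(2) by (auto simp: P.add P.scale)
    qed
    then have "z = 0" using v P0[OF yz(2)] yz(1) by (simp add: P.add)
    then show ?thesis using yz spC by simp
  qed
  then show thesis using that[of P] lin_of_linear[OF P(1)] P0 spC by blast
qed

lemma sum_fun_apply: "(\<Sum>i\<in>X. f i) x = (\<Sum>i\<in>X. f i x)"
  for f :: "'i \<Rightarrow> 'a \<Rightarrow> 'b::comm_monoid_add"
  by (induction X rule: infinite_finite_induct) simp_all

lemma lin_fun_scale_iff: "lin s (fun_scale t) F \<longleftrightarrow> (\<forall>x. lin s t (\<lambda>h. F h x))"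
  by (auto simp: lin_def fun_scale_def fun_eq_iff)

lemma lin_eval: "lin (fun_scale t) t (\<lambda>F. F x)"
  by (simp add: lin_def fun_scale_def)

context fd_hopf_algebra
begin

abbreviation sU :: "'k \<Rightarrow> ('h \<Rightarrow> 'k) \<Rightarrow> 'h \<Rightarrow> 'k" where "sU \<equiv> fun_scale (*)"

lemma vs_U: "vector_space sU"
  by (rule vector_space_fun_scale[OF vector_space_field])

abbreviation sUU :: "'k \<Rightarrow> ('h \<Rightarrow> 'h \<Rightarrow> 'k) \<Rightarrow> 'h \<Rightarrow> 'h \<Rightarrow> 'k" where "sUU \<equiv> fun_scale sU"

text \<open>For finite-dimensional \<open>H\<close> this is \<open>X \<otimes> H*\<close>, kept as a
  set of functions with pointwise operations.\<close>

definition Lin :: "('k \<Rightarrow> 'z \<Rightarrow> 'z) \<Rightarrow> 'z set \<Rightarrow> ('h \<Rightarrow> 'z::ab_group_add) set"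
  where "Lin s X = {F. lin sH s F \<and> (\<forall>h. F h \<in> X)}"

lemma subsp_Lin:
  assumes s: "vector_space s" and X: "subsp s X"
  shows "subsp (fun_scale s) (Lin s X)"
proof -
  interpret s: vector_space s by (rule s)
  show ?thesis
    by (rule subspI[OF vector_space_fun_scale[OF s]])
      (auto simp: Lin_def lin_def fun_scale_def s.scale_right_distrib mult.commute
        intro: subsp_0[OF s X] subsp_add[OF s X] subsp_scale[OF s X])
qed

text \<open>Allow nonzero values on a growing part \<open>A\<close> of the basis only. Evaluation at
  each new basis vector is onto \<open>X\<close>, and its kernel is the previous space.\<close>

lemma Lin_dim:
  assumes s: "vector_space s" and X: "subsp s X" "fdim s X"
  shows "fdim (fun_scale s) (Lin s X)" "dm (fun_scale s) (Lin s X) = card B * dm s X"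
proof -
  interpret s: vector_space s by (rule s)
  note vs = vector_space_fun_scale[OF s]
  define LA where "LA A = {F \<in> Lin s X. \<forall>b\<in>B - A. F b = 0}" for A
  have sub: "subsp (fun_scale s) (LA A)" for A
  proof (rule subspI[OF vs])
    show "0 \<in> LA A" using subsp_0[OF vs subsp_Lin[OF s X(1)]] by (simp add: LA_def)
  next
    fix x y assume "x \<in> LA A" "y \<in> LA A"
    then show "x + y \<in> LA A" using subsp_add[OF vs subsp_Lin[OF s X(1)]] by (simp add: LA_def)
  next
    fix c x assume "x \<in> LA A"
    then show "fun_scale s c x \<in> LA A"
      using subsp_scale[OF vs subsp_Lin[OF s X(1)]] by (auto simp: LA_def) (simp add: fun_scale_def)
  qed
  have "fdim (fun_scale s) (LA A) \<and> dm (fun_scale s) (LA A) = card A * dm s X"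
    if "finite A" "A \<subseteq> B" for A
    using that
  proof (induction A rule: finite_induct)
    case empty
    have "F = 0" if F: "F \<in> LA {}" for F
    proof
      fix h
      have "F h = (\<Sum>b\<in>B. s (co b h) (F b))"
        by (rule lin_expand) (use F in \<open>simp add: LA_def Lin_def\<close>)
      then show "F h = 0 h" using F by (simp add: LA_def)
    qed
    then have "LA {} = {0}" using subsp_0[OF vs sub] by blast
    then show ?case by (simp add: fdim_zero[OF vs] dm_zero[OF vs])
  next
    case (insert b A)
    have ker: "{F \<in> LA (insert b A). F b = 0} = LA A"
      using insert.prems insert.hyps by (auto simp: LA_def)
    have im: "(\<lambda>F. F b) ` LA (insert b A) = X"
    proof (intro equalityI subsetI)
      fix x assume x: "x \<in> X"
      have "(\<lambda>h. s (co b h) x) \<in> LA (insert b A)"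
        using x insert.prems
        by (auto simp: LA_def Lin_def lin_def lin_add[OF co_lin] lin_scale[OF co_lin] co_basis
            s.scale_left_distrib intro: subsp_scale[OF s X(1)])
      moreover have "s (co b b) x = x" using insert.prems by (simp add: co_basis)
      ultimately show "x \<in> (\<lambda>F. F b) ` LA (insert b A)" by (metis (no_types, lifting) image_eqI)
    qed (auto simp: LA_def Lin_def)
    have fk: "fdim (fun_scale s) {F \<in> LA (insert b A). F b = 0}" using ker insert by auto
    have fi: "fdim s ((\<lambda>F. F b) ` LA (insert b A))" using im X by simp
    note rn = lin_space_pair.rank_nullity[OF lin_space_pair_of[OF vs s]
        linear_of_lin[OF vs s lin_eval] sub fk fi]
    then show ?case using insert unfolding ker im by simp
  qed
  from this[OF finite_B order_refl] have "fdim (fun_scale s) (LA B) \<and> dm (fun_scale s) (LA B) = card B * dm s X" .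
  moreover have "LA B = Lin s X" by (auto simp: LA_def)
  ultimately show "fdim (fun_scale s) (Lin s X)" "dm (fun_scale s) (Lin s X) = card B * dm s X" by auto
qed

lemma fdim_H: "fdim sH V"
  unfolding lin_space.fin_dim_def[OF lin_space_of[OF vs_H]] using finite_B span_B by blast

lemma dm_H: "dm sH UNIV = card B"
  using A.dim_span_eq_card_independent[OF indep_B] span_B by simp

text \<open>The transpose of left convolution by \<open>d\<close>, see \<open>lin_R\<close>; this is
  why the order of factors is reversed in \<open>R_R\<close>.\<close>

definition R :: "('h \<Rightarrow> 'k) \<Rightarrow> 'h \<Rightarrow> 'h"
  where "R d h = sw (\<lambda>a b. sH (d a) b) h"

lemma R_lin: "lin sH sH (R d)" if d: "lin sH (*) d"
  unfolding R_def by (intro lin_rules lin_compose[OF d])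

lemma R_lin_left: "lin sU sH (\<lambda>d. R d h)"
  unfolding R_def by (intro lin_rules) (simp_all add: lin_eval)

lemma R_counit: "R \<epsilon> h = h"
  unfolding R_def by (rule sw_counit_left[OF lin_id])

lemma lin_R: "lin sH (*) u \<Longrightarrow> u (R d h) = conv d u h"
  unfolding R_def conv_def by (simp add: lin_of_sw lin_scale)

lemma R_R:
  assumes d: "lin sH (*) d" and e: "lin sH (*) e"
  shows "R d (R e h) = R (conv e d) h"
proof -
  note rules = lin_rules lin_compose[OF d] lin_compose[OF e]
  have "R d (R e h) = sw (\<lambda>a b. sH (e a) (R d b)) h"
    unfolding R_def[of e] by (simp add: lin_of_sw[OF R_lin[OF d]] lin_scale[OF R_lin[OF d]])
  also have "\<dots> = sw (\<lambda>a b. sw (\<lambda>c d'. sH (e a) (sH (d c) d')) b) h"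
    unfolding R_def by (simp add: lin_of_sw[OF A.module_hom_scale_self[unfolded module_hom_iff_linear, THEN lin_of_linear]])
  also have "\<dots> = sw (\<lambda>a b. sw (\<lambda>c d'. sH (e c) (sH (d d') b)) a) h"
    by (rule coassoc[OF vs_H, symmetric]; intro rules)
  also have "\<dots> = R (conv e d) h"
    unfolding R_def conv_def by (simp add: sweedler_def A.scale_sum_left)
  finally show ?thesis .
qed

end

text \<open>The condition on \<open>\<Delta> I\<close> appears dually as \<open>I_conv\<close>: the
  functionals that vanish on \<open>I\<close> are closed under convolution.\<close>

locale coideal_quotient = fd_hopf_integral sH \<Delta> \<epsilon> S B \<Lambda>
  for sH :: "'k::field \<Rightarrow> 'h::ring_1 \<Rightarrow> 'h" and \<Delta> and \<epsilon> and S and B and \<Lambda> +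
  fixes I :: "'h set"
  assumes I_sub: "module.subspace sH I"
    and I_conv: "\<lbrakk>lin sH (*) u; lin sH (*) v; \<And>x. x \<in> I \<Longrightarrow> u x = 0; \<And>x. x \<in> I \<Longrightarrow> v x = 0; x \<in> I\<rbrakk> \<Longrightarrow> conv u v x = 0"
    and I_counit: "x \<in> I \<Longrightarrow> \<epsilon> x = 0"
    and I_mult: "x \<in> I \<Longrightarrow> x * h \<in> I"
begin

text \<open>\<open>D\<close> is the dual algebra of the coalgebra \<open>H/I\<close>. It acts on \<open>H\<close> from the right through \<open>R\<close>.\<close>

definition D :: "('h \<Rightarrow> 'k) set"
  where "D = {f. lin sH (*) f \<and> (\<forall>x\<in>I. f x = 0)}"

lemma D_lin: "d \<in> D \<Longrightarrow> lin sH (*) d"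
  and D_I: "d \<in> D \<Longrightarrow> x \<in> I \<Longrightarrow> d x = 0"
  by (simp_all add: D_def)

lemma D_counit: "\<epsilon> \<in> D"
  by (simp add: D_def counit_lin I_counit)

lemma D_conv: "d \<in> D \<Longrightarrow> e \<in> D \<Longrightarrow> conv d e \<in> D"
  by (auto simp: D_def intro: conv_lin I_conv)

text \<open>In the coproduct of \<open>H*\<close>, which is dual to multiplication, this says that
  the first leg of every \<open>d\<close> stays in \<open>D\<close>. It is the source of the
  \<open>D\<close>-module structure on \<open>V \<otimes> H*\<close>.\<close>

lemma D_translate: "(\<lambda>x. d (x * h)) \<in> D" if d: "d \<in> D"
proof -
  have "lin sH (*) (\<lambda>x. d (x * h))" by (intro lin_rules lin_compose[OF D_lin[OF d]])
  then show ?thesis using d by (simp add: D_def I_mult)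
qed

lemma subsp_D: "subsp sU D"
  by (rule subspI[OF vs_U]) (auto simp: D_def lin_def fun_scale_def ring_distribs)

lemma fdim_D: "fdim sU D"
proof -
  have "d \<in> module.span sU (co ` B)" if "d \<in> D" for d
  proof -
    interpret U: vector_space sU by (rule vs_U)
    have "d = (\<Sum>b\<in>B. sU (d b) (co b))"
    proof
      fix x
      show "d x = (\<Sum>b\<in>B. sU (d b) (co b)) x"
        by (subst lin_expand[OF D_lin[OF that]]) (simp add: sum_fun_apply fun_scale_def mult.commute)
    qed
    also have "\<dots> \<in> U.span (co ` B)"
      by (intro U.span_sum U.span_scale U.span_base) blast
    finally show ?thesis .
  qed
  then show ?thesis
    unfolding lin_space.fin_dim_def[OF lin_space_of[OF vs_U]] using finite_B by blast
qed

lemma in_I_if: "(\<And>d. d \<in> D \<Longrightarrow> d x = 0) \<Longrightarrow> x \<in> I"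
proof (rule ccontr)
  assume "x \<notin> I" and 0: "\<And>d. d \<in> D \<Longrightarrow> d x = 0"
  then obtain u where "Vector_Spaces.linear sH (*) u" "\<And>w. w \<in> I \<Longrightarrow> u w = 0" "u x = 1"
    using vector_space.separating_functional[OF vs_H I_sub] by metis
  then show False using 0[of u] by (simp add: D_def lin_of_linear)
qed

lemma R_I: "d \<in> D \<Longrightarrow> x \<in> I \<Longrightarrow> R d x \<in> I"
  by (rule in_I_if) (simp add: lin_R D_lin D_I D_conv)

definition right_ideal_D :: "('h \<Rightarrow> 'k) set \<Rightarrow> bool"
  where "right_ideal_D L \<longleftrightarrow> subsp sU L \<and> L \<subseteq> D \<and> (\<forall>l\<in>L. \<forall>d\<in>D. conv l d \<in> L)"

text \<open>A copy of \<open>Hom_D(D/L, H)\<close>: a \<open>D\<close>-linear map is recorded by its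
  value at the class of the unit \<open>\<epsilon>\<close>.\<close>

definition perp :: "('h \<Rightarrow> 'k) set \<Rightarrow> 'h set"
  where "perp L = {h. \<forall>l\<in>L. R l h = 0}"

lemma subsp_perp: "L \<subseteq> D \<Longrightarrow> subsp sH (perp L)"
  by (rule subspI[OF vs_H])
    (auto simp: perp_def subset_iff lin_0[OF R_lin[OF D_lin]] lin_add[OF R_lin[OF D_lin]] lin_scale[OF R_lin[OF D_lin]])

end

text \<open>A right \<open>D\<close>-module is a subset of an ambient space, so that submodules of
  function spaces are instances. Linearity of \<open>act\<close> is required on the ambient space,
  the module laws only on \<open>M\<close>.\<close>

locale D_module = coideal_quotient sH \<Delta> \<epsilon> S B \<Lambda> I
  for sH :: "'k::field \<Rightarrow> 'h::ring_1 \<Rightarrow> 'h" and \<Delta> and \<epsilon> and S and B and \<Lambda> and I +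
  fixes sV :: "'k \<Rightarrow> 'v::ab_group_add \<Rightarrow> 'v" and act :: "'v \<Rightarrow> ('h \<Rightarrow> 'k) \<Rightarrow> 'v" and M :: "'v set"
  assumes vs_V: "vector_space sV" and M_sub: "subsp sV M" and M_fdim: "fdim sV M"
    and act_closed: "x \<in> M \<Longrightarrow> d \<in> D \<Longrightarrow> act x d \<in> M"
    and act_lin_left: "lin sV sV (\<lambda>x. act x d)" and act_lin_right: "lin sU sV (act x)"
    and act_conv: "x \<in> M \<Longrightarrow> d \<in> D \<Longrightarrow> e \<in> D \<Longrightarrow> act (act x d) e = act x (conv d e)"
    and act_counit: "x \<in> M \<Longrightarrow> act x \<epsilon> = x"
begin

abbreviation sHom :: "'k \<Rightarrow> ('v \<Rightarrow> 'h) \<Rightarrow> 'v \<Rightarrow> 'h" where "sHom \<equiv> fun_scale sH"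

lemma vs_Hom: "vector_space sHom" by (rule vector_space_fun_scale[OF vs_H])

text \<open>The \<open>D\<close>-linear maps \<open>M/W \<rightarrow> H\<close>, as functions on the ambient space that vanish outside \<open>M\<close>.\<close>

definition Hom :: "'v set \<Rightarrow> ('v \<Rightarrow> 'h) set"
  where "Hom W = {\<theta>. (\<forall>x\<in>M. \<forall>y\<in>M. \<theta> (x + y) = \<theta> x + \<theta> y) \<and> (\<forall>c. \<forall>x\<in>M. \<theta> (sV c x) = sH c (\<theta> x)) \<and>
    (\<forall>x\<in>M. \<forall>d\<in>D. \<theta> (act x d) = R d (\<theta> x)) \<and> (\<forall>x\<in>W. \<theta> x = 0) \<and> (\<forall>x. x \<notin> M \<longrightarrow> \<theta> x = 0)}"

lemma subsp_Hom: "subsp sHom (Hom W)"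
  by (rule subspI[OF vs_Hom])
    (auto simp: Hom_def fun_scale_def A.scale_right_distrib lin_0[OF R_lin[OF D_lin]]
      lin_add[OF R_lin[OF D_lin]] lin_scale[OF R_lin[OF D_lin]] mult.commute)

definition submod :: "'v set \<Rightarrow> bool"
  where "submod W \<longleftrightarrow> subsp sV W \<and> W \<subseteq> M \<and> (\<forall>x\<in>W. \<forall>d\<in>D. act x d \<in> W)"

definition add_cyclic :: "'v set \<Rightarrow> 'v \<Rightarrow> 'v set"
  where "add_cyclic W x = {w + act x d | w d. w \<in> W \<and> d \<in> D}"

text \<open>The annihilator of the class of \<open>x\<close> in \<open>M/W\<close>.\<close>

definition colon :: "'v set \<Rightarrow> 'v \<Rightarrow> ('h \<Rightarrow> 'k) set"
  where "colon W x = {d \<in> D. act x d \<in> W}"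

context
  fixes W x assumes W: "submod W" and x: "x \<in> M"
begin

lemma W_facts: "subsp sV W" "W \<subseteq> M" "w \<in> W \<Longrightarrow> d \<in> D \<Longrightarrow> act w d \<in> W"
  using W by (auto simp: submod_def)

lemma add_cyclic_mem: "W \<subseteq> add_cyclic W x" "x \<in> add_cyclic W x"
proof -
  have "w \<in> add_cyclic W x" if "w \<in> W" for w
    unfolding add_cyclic_def
    using that lin_0[OF act_lin_right, of x] subsp_0[OF vs_U subsp_D] by force
  then show "W \<subseteq> add_cyclic W x" by blast
  show "x \<in> add_cyclic W x"
    unfolding add_cyclic_def
    using act_counit[OF x] D_counit subsp_0[OF vs_V W_facts(1)] by force
qed

lemma submod_add_cyclic: "submod (add_cyclic W x)"
  unfolding submod_def
proof (intro conjI ballI)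
  interpret V: vector_space sV by (rule vs_V)
  show "subsp sV (add_cyclic W x)"
  proof (rule subspI[OF vs_V])
    show "0 \<in> add_cyclic W x" using add_cyclic_mem(1) subsp_0[OF vs_V W_facts(1)] by blast
  next
    fix y z assume "y \<in> add_cyclic W x" "z \<in> add_cyclic W x"
    then obtain w d w' d' where "y = w + act x d" "z = w' + act x d'" "w \<in> W" "d \<in> D" "w' \<in> W" "d' \<in> D"
      unfolding add_cyclic_def by blast
    moreover from this have "y + z = (w + w') + act x (d + d')"
      by (simp add: lin_add[OF act_lin_right] algebra_simps)
    ultimately show "y + z \<in> add_cyclic W x"
      unfolding add_cyclic_def
      using subsp_add[OF vs_V W_facts(1)] subsp_add[OF vs_U subsp_D] by blast
  next
    fix c y assume "y \<in> add_cyclic W x"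
    then obtain w d where "y = w + act x d" "w \<in> W" "d \<in> D"
      unfolding add_cyclic_def by blast
    moreover from this have "sV c y = sV c w + act x (sU c d)"
      by (simp add: lin_scale[OF act_lin_right] V.scale_right_distrib)
    ultimately show "sV c y \<in> add_cyclic W x"
      unfolding add_cyclic_def
      using subsp_scale[OF vs_V W_facts(1)] subsp_scale[OF vs_U subsp_D] by blast
  qed
  show "add_cyclic W x \<subseteq> M"
    unfolding add_cyclic_def using W_facts(2) act_closed[OF x] subsp_add[OF vs_V M_sub] by blast
  fix y d assume "y \<in> add_cyclic W x" and d: "d \<in> D"
  then obtain w e where y: "y = w + act x e" "w \<in> W" "e \<in> D"
    unfolding add_cyclic_def by blast
  then have "act y d = act w d + act x (conv e d)"
    by (simp add: lin_add[OF act_lin_left] act_conv[OF x _ d])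
  then show "act y d \<in> add_cyclic W x"
    unfolding add_cyclic_def using W_facts(3)[OF y(2) d] D_conv[OF y(3) d] by blast
qed

lemma colon_right_ideal: "right_ideal_D (colon W x)"
  unfolding right_ideal_D_def
proof (intro conjI ballI)
  show "subsp sU (colon W x)"
    by (rule subspI[OF vs_U])
      (auto simp: colon_def lin_0[OF act_lin_right] lin_add[OF act_lin_right] lin_scale[OF act_lin_right]
        intro: subsp_0[OF vs_V W_facts(1)] subsp_add[OF vs_V W_facts(1)] subsp_scale[OF vs_V W_facts(1)]
          subsp_0[OF vs_U subsp_D] subsp_add[OF vs_U subsp_D] subsp_scale[OF vs_U subsp_D])
  show "colon W x \<subseteq> D" by (auto simp: colon_def)
  fix l d assume l: "l \<in> colon W x" and d: "d \<in> D"
  then have "act (act x l) d \<in> W" "l \<in> D" by (auto simp: colon_def intro: W_facts(3))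
  then show "conv l d \<in> colon W x" using d by (simp add: colon_def act_conv[OF x] D_conv)
qed

text \<open>The quotient \<open>(W + x D)/W\<close> is isomorphic to \<open>D / colon W x\<close>.
  The equation is in additive form to avoid subtraction of natural numbers.\<close>

lemma dm_add_cyclic: "dm sV (add_cyclic W x) + dm sU (colon W x) = dm sV W + dm sU D"
proof -
  obtain P where P: "lin sV sV P" "\<And>v. P v = 0 \<longleftrightarrow> v \<in> W"
    by (rule exists_lin_with_kernel[OF vs_V W_facts(1)]) blast
  have sub: "subsp sV (add_cyclic W x)" and f: "fdim sV (add_cyclic W x)"
    using submod_add_cyclic fdim_subset[OF vs_V M_fdim] by (auto simp: submod_def)
  have k: "{v \<in> add_cyclic W x. P v = 0} = W" using P(2) add_cyclic_mem(1) by blast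
  have l: "lin sU sV (\<lambda>d. P (act x d))" by (rule lin_compose[OF P(1) act_lin_right])
  have k': "{d \<in> D. P (act x d) = 0} = colon W x" by (simp add: colon_def P(2))
  have "P ` add_cyclic W x = (\<lambda>d. P (act x d)) ` D"
  proof (intro equalityI subsetI)
    fix y assume "y \<in> P ` add_cyclic W x"
    then obtain w d where "w \<in> W" "d \<in> D" "y = P (w + act x d)" unfolding add_cyclic_def by blast
    moreover from this have "P w = 0" using P(2) by blast
    ultimately show "y \<in> (\<lambda>d. P (act x d)) ` D" by (simp add: lin_add[OF P(1)])
  next
    fix y assume "y \<in> (\<lambda>d. P (act x d)) ` D"
    then obtain d where "d \<in> D" "y = P (0 + act x d)" by auto
    moreover from this have "0 + act x d \<in> add_cyclic W x"
      unfolding add_cyclic_def using subsp_0[OF vs_V W_facts(1)] by blast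
    ultimately show "y \<in> P ` add_cyclic W x" by blast
  qed
  then show ?thesis
    using lin_rank_nullity(2)[OF vs_V vs_V P(1) sub f] lin_rank_nullity(2)[OF vs_U vs_V l subsp_D fdim_D]
    unfolding k k' by simp
qed

text \<open>Left exactness of \<open>Hom_D(-, H)\<close>: evaluation at \<open>x\<close> has the
  maps on \<open>M/(W + x D)\<close> as its kernel, and its values are annihilated by
  \<open>colon W x\<close>.\<close>

lemma Hom_add_cyclic:
  assumes f: "fdim sHom (Hom (add_cyclic W x))"
  shows "fdim sHom (Hom W)" "dm sHom (Hom W) \<le> dm sHom (Hom (add_cyclic W x)) + dm sH (perp (colon W x))"
proof -
  have k: "{\<theta> \<in> Hom W. \<theta> x = 0} = Hom (add_cyclic W x)"
  proof (intro equalityI subsetI)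
    fix \<theta> assume t: "\<theta> \<in> {\<theta> \<in> Hom W. \<theta> x = 0}"
    have "\<theta> (w + act x d) = 0" if "w \<in> W" "d \<in> D" for w d
    proof -
      have "w \<in> M" "act x d \<in> M" using that W_facts(2) act_closed[OF x] by auto
      then have "\<theta> (w + act x d) = \<theta> w + R d (\<theta> x)" using t x that(2) by (simp add: Hom_def)
      then show ?thesis using t that by (simp add: Hom_def lin_0[OF R_lin[OF D_lin]])
    qed
    then have "\<theta> y = 0" if "y \<in> add_cyclic W x" for y using that unfolding add_cyclic_def by blast
    then show "\<theta> \<in> Hom (add_cyclic W x)" using t by (simp add: Hom_def)
  next
    fix \<theta> assume "\<theta> \<in> Hom (add_cyclic W x)"
    then show "\<theta> \<in> {\<theta> \<in> Hom W. \<theta> x = 0}" using add_cyclic_mem by (auto simp: Hom_def)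
  qed
  have im: "(\<lambda>\<theta>. \<theta> x) ` Hom W \<subseteq> perp (colon W x)"
  proof clarify
    fix \<theta> assume t: "\<theta> \<in> Hom W"
    show "\<theta> x \<in> perp (colon W x)"
      unfolding perp_def colon_def
    proof clarify
      fix d assume "d \<in> D" "act x d \<in> W"
      then show "R d (\<theta> x) = 0" using t x by (auto simp: Hom_def)
    qed
  qed
  have "colon W x \<subseteq> D" by (auto simp: colon_def)
  from lin_rank_bound[OF vs_Hom vs_H lin_eval subsp_Hom subsp_perp[OF this] fdim_H im, unfolded k, OF f]
  show "fdim sHom (Hom W)" "dm sHom (Hom W) \<le> dm sHom (Hom (add_cyclic W x)) + dm sH (perp (colon W x))"
    by auto
qed

end

text \<open>\<open>hyp\<close> bounds the ratio of \<open>dim Hom_D(D/L, H)\<close> to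
  \<open>dim D/L\<close> by \<open>p/q\<close> for cyclic modules. A filtration of
  \<open>M/W\<close> with cyclic factors carries the bound over to all finite-dimensional
  modules.\<close>

lemma Hom_bound:
  assumes hyp: "\<And>L. right_ideal_D L \<Longrightarrow> q * dm sH (perp L) + p * dm sU L \<le> p * dm sU D"
  shows "submod W \<Longrightarrow> fdim sHom (Hom W) \<and> q * dm sHom (Hom W) + p * dm sV W \<le> p * dm sV M"
proof (induction "dm sV M - dm sV W" arbitrary: W rule: less_induct)
  case less
  note W = less.prems
  have sW: "subsp sV W" "W \<subseteq> M" using W by (auto simp: submod_def)
  show ?case
  proof (cases "W = M")
    case True
    have "Hom M = {0}"
    proof (intro equalityI subsetI)
      fix \<theta> assume "\<theta> \<in> Hom M"
      then have "\<theta> x = 0" for x by (cases "x \<in> M") (auto simp: Hom_def)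
      then show "\<theta> \<in> {0}" by (simp add: fun_eq_iff)
    qed (use subsp_0[OF vs_Hom subsp_Hom] in auto)
    then show ?thesis using True by (simp add: fdim_zero[OF vs_Hom] dm_zero[OF vs_Hom])
  next
    case False
    then obtain x where x: "x \<in> M" "x \<notin> W" using sW by blast
    let ?W' = "add_cyclic W x"
    have W': "submod ?W'" by (rule submod_add_cyclic[OF W x(1)])
    then have sW': "subsp sV ?W'" "?W' \<subseteq> M" by (auto simp: submod_def)
    have "W \<subset> ?W'" using add_cyclic_mem[OF W x(1)] x(2) by blast
    then have "dm sV W < dm sV ?W'"
      by (rule dm_strict_mono[OF vs_V sW(1) sW'(1) fdim_subset[OF vs_V M_fdim sW'(2)]])
    moreover have "dm sV ?W' \<le> dm sV M" by (rule dm_mono[OF vs_V sW'(1) M_sub M_fdim sW'(2)])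
    ultimately have "fdim sHom (Hom ?W') \<and> q * dm sHom (Hom ?W') + p * dm sV ?W' \<le> p * dm sV M"
      using less.hyps[of ?W'] W' by auto
    then have IH: "fdim sHom (Hom ?W')" "q * dm sHom (Hom ?W') + p * dm sV ?W' \<le> p * dm sV M" by auto
    note H = Hom_add_cyclic[OF W x(1) IH(1)]
    let ?L = "colon W x"
    have "p * dm sV ?W' + p * dm sU ?L = p * dm sV W + p * dm sU D"
      using dm_add_cyclic[OF W x(1)] by (metis add_mult_distrib2)
    moreover have "q * dm sHom (Hom W) \<le> q * dm sHom (Hom ?W') + q * dm sH (perp ?L)"
      using mult_le_mono2[OF H(2), of q] by (simp add: add_mult_distrib2)
    moreover have "q * dm sH (perp ?L) + p * dm sU ?L \<le> p * dm sU D"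
      by (rule hyp[OF colon_right_ideal[OF W x(1)]])
    ultimately show ?thesis using IH(2) H(1) by linarith
  qed
qed

end

section \<open>The dimension estimate\<close>

context fd_hopf_algebra
begin

lemma counit_antipode: "\<epsilon> (S x) = \<epsilon> x"
proof -
  have "\<epsilon> (S x) = sw (\<lambda>a b. \<epsilon> b * \<epsilon> (S a)) x"
    by (rule sw_counit_right[symmetric]) (intro lin_rules)
  also have "\<dots> = sw (\<lambda>a b. \<epsilon> (S a * b)) x" by (simp add: counit_mult mult.commute)
  also have "\<dots> = \<epsilon> x * \<epsilon> 1" by (rule sw_antipode_left[OF counit_lin])
  finally show ?thesis by (simp add: counit_one)
qed

lemma lin_conv_left: "lin sU sU (\<lambda>u. conv u v)" and lin_conv_right: "lin sU sU (conv u)"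
  by (simp_all add: lin_def fun_scale_def conv_def sweedler_def fun_eq_iff ring_distribs sum.distrib
      sum_distrib_left ac_simps)

end

context coideal_quotient
begin

text \<open>The diagonal action on \<open>D \<otimes> H*\<close>, whose elements are written as maps
  \<open>H \<rightarrow> D\<close>. The first leg of the coproduct of \<open>d\<close> multiplies in
  \<open>D\<close> from the right, and the second, say \<open>g\<close>, sends \<open>f\<close> to
  the functional \<open>g(S h_1) f(h_2)\<close> of \<open>h\<close>.\<close>

definition twisted_act :: "('h \<Rightarrow> 'h \<Rightarrow> 'k) \<Rightarrow> ('h \<Rightarrow> 'k) \<Rightarrow> 'h \<Rightarrow> 'h \<Rightarrow> 'k"
  where "twisted_act F d h = sw (\<lambda>a b. conv (F b) (\<lambda>z. d (z * S a))) h"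

lemma twisted_act_apply: "twisted_act F d h x = sw (\<lambda>a b. conv (F b) (\<lambda>z. d (z * S a)) x) h"
  by (simp add: twisted_act_def sweedler_def sum_fun_apply)

lemma Lin_D:
  assumes "F \<in> Lin sU X" "X \<subseteq> D"
  shows "lin sH (*) (\<lambda>h. F h x)" "lin sH (*) (F h)" "F h \<in> D" "F h \<in> X"
  using assms by (auto simp: Lin_def lin_fun_scale_iff intro: D_lin)

lemma twisted_act_closed:
  assumes L: "right_ideal_D L" and F: "F \<in> Lin sU L" and d: "d \<in> D"
  shows "twisted_act F d \<in> Lin sU L"
proof -
  have LD: "L \<subseteq> D" "subsp sU L" using L by (auto simp: right_ideal_D_def)
  note rules = lin_rules lin_compose[OF D_lin[OF d]] lin_compose[OF Lin_D(1)[OF F LD(1)]] lin_compose[OF Lin_D(2)[OF F LD(1)]]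
  have "twisted_act F d h \<in> L" for h
    unfolding twisted_act_def sweedler_def
    by (rule subsp_sum[OF vs_U LD(2)])
      (use L Lin_D(4)[OF F LD(1)] D_translate[OF d] in \<open>auto simp: right_ideal_D_def\<close>)
  moreover have "lin sH (*) (\<lambda>h. twisted_act F d h x)" for x
    unfolding twisted_act_apply conv_def by (intro rules)
  ultimately show ?thesis by (simp add: Lin_def lin_fun_scale_iff)
qed

lemma right_ideal_D_D: "right_ideal_D D"
  by (simp add: right_ideal_D_def subsp_D D_conv)

text \<open>Acting twice yields the twists by \<open>S z_2\<close> and \<open>S z_1\<close>, in this
  order. By \<open>antipode_anticomult\<close> they are the two components of \<open>S z\<close>, at
  which the product \<open>conv d e\<close> is translated.\<close>

lemma twisted_act_conv:
  assumes F: "F \<in> Lin sU D" and d: "d \<in> D" and e: "e \<in> D"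
  shows "twisted_act (twisted_act F d) e = twisted_act F (conv d e)"
proof (intro ext)
  fix h x
  note rules = lin_rules lin_compose[OF D_lin[OF d]] lin_compose[OF D_lin[OF e]]
    lin_compose[OF Lin_D(1)[OF F order_refl]] lin_compose[OF Lin_D(2)[OF F order_refl]]
  have ld: "lin sH (*) (\<lambda>z. d (z * S a))" and le: "lin sH (*) (\<lambda>z. e (z * S a))" for a
    by (intro rules)+
  let ?T = "\<lambda>a c b. conv (conv (F b) (\<lambda>z. d (z * S c))) (\<lambda>z. e (z * S a)) x"
  have "twisted_act (twisted_act F d) e h x = sw (\<lambda>a b. sw (\<lambda>c g. ?T a c g) b) h"
  proof -
    have "conv (twisted_act F d b) (\<lambda>z. e (z * S a)) x = sw (\<lambda>c g. ?T a c g) b" for a b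
      unfolding twisted_act_def[of F d] sweedler_def[of _ _ _ _ _ b] lin_sum[OF lin_conv_left] sum_fun_apply
      by (rule refl)
    then show ?thesis by (simp add: twisted_act_apply)
  qed
  also have "\<dots> = sw (\<lambda>z b. sw (\<lambda>a c. ?T a c b) z) h"
    unfolding conv_def by (rule coassoc[OF vector_space_field, symmetric]; intro rules)
  also have "\<dots> = sw (\<lambda>z b. conv (F b) (\<lambda>y. conv d e (y * S z)) x) h"
  proof -
    have "sw (\<lambda>a c. ?T a c b) z = conv (F b) (\<lambda>y. conv d e (y * S z)) x" for b z
    proof -
      have "conv d e (y * S z) = sw (\<lambda>a c. conv (\<lambda>z. d (z * S c)) (\<lambda>z. e (z * S a)) y) z" for y
      proof -
        have b: "bilin sH sH (*) (\<lambda>a b. d a * e b)" by (intro rules)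
        have "conv d e (y * S z) = sw (\<lambda>y1 y2. sw (\<lambda>a c. d (y1 * S c) * e (y2 * S a)) z) y"
          unfolding conv_def sw_mult[OF b vector_space_field]
          by (subst antipode_anticomult[OF vector_space_field]; (intro rules)?) (rule refl)
        also have "\<dots> = sw (\<lambda>a c. conv (\<lambda>z. d (z * S c)) (\<lambda>z. e (z * S a)) y) z"
          unfolding conv_def sweedler_def by (rule sum.swap)
        finally show ?thesis .
      qed
      then have "(\<lambda>y. conv d e (y * S z)) = sw (\<lambda>a c. conv (\<lambda>z. d (z * S c)) (\<lambda>z. e (z * S a))) z"
        by (simp add: fun_eq_iff sweedler_def sum_fun_apply)
      then have "conv (F b) (\<lambda>y. conv d e (y * S z)) x
          = sw (\<lambda>a c. conv (F b) (conv (\<lambda>z. d (z * S c)) (\<lambda>z. e (z * S a))) x) z"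
        by (simp only: sweedler_def[of _ _ _ _ _ z] lin_sum[OF lin_conv_right] sum_fun_apply)
      then show ?thesis by (simp add: conv_assoc[OF Lin_D(2)[OF F order_refl] ld le])
    qed
    then show ?thesis by simp
  qed
  also have "\<dots> = twisted_act F (conv d e) h x" by (simp add: twisted_act_apply)
  finally show "twisted_act (twisted_act F d) e h x = twisted_act F (conv d e) h x" .
qed

lemma twisted_act_counit:
  assumes F: "F \<in> Lin sU D"
  shows "twisted_act F \<epsilon> = F"
proof (intro ext)
  fix h x
  have "conv (F b) (\<lambda>z. \<epsilon> (z * S a)) x = \<epsilon> a * F b x" for a b
  proof -
    have "(\<lambda>z. \<epsilon> (z * S a)) = sU (\<epsilon> a) \<epsilon>"
      by (simp add: fun_eq_iff fun_scale_def counit_mult counit_antipode mult.commute)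
    then show ?thesis
      using lin_scale[OF lin_conv_right, of "F b" "\<epsilon> a" \<epsilon>] conv_counit_right[OF Lin_D(2)[OF F order_refl]]
      by (simp add: fun_scale_def)
  qed
  then have "twisted_act F \<epsilon> h x = sw (\<lambda>a b. \<epsilon> a * F b x) h" by (simp add: twisted_act_apply)
  also have "\<dots> = F h x" by (rule sw_counit_left[OF Lin_D(1)[OF F order_refl]])
  finally show "twisted_act F \<epsilon> h x = F h x" .
qed

lemma D_module_twisted: "D_module sH \<Delta> \<epsilon> S B \<Lambda> I sUU twisted_act (Lin sU D)"
proof (rule D_module.intro[OF coideal_quotient_axioms], rule D_module_axioms.intro)
  show "vector_space sUU" by (rule vector_space_fun_scale[OF vs_U])
  show "subsp sUU (Lin sU D)" by (rule subsp_Lin[OF vs_U subsp_D])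
  show "fdim sUU (Lin sU D)" by (rule Lin_dim(1)[OF vs_U subsp_D fdim_D])
  show "lin sUU sUU (\<lambda>x. twisted_act x d)" for d
    unfolding lin_fun_scale_iff twisted_act_apply
    by (simp add: lin_def conv_def sweedler_def fun_scale_def ring_distribs sum.distrib sum_distrib_left ac_simps)
  show "lin sU sUU (twisted_act x)" for x
    unfolding lin_fun_scale_iff twisted_act_apply
    by (simp add: lin_def conv_def sweedler_def fun_scale_def ring_distribs sum.distrib sum_distrib_left ac_simps)
qed (simp_all add: twisted_act_closed[OF right_ideal_D_D] twisted_act_conv twisted_act_counit)

text \<open>The other module structure on \<open>D \<otimes> H*\<close>: multiplication in
  \<open>D\<close> alone, which makes it free of rank \<open>dim H\<close>.\<close>

definition free_act :: "('h \<Rightarrow> 'h \<Rightarrow> 'k) \<Rightarrow> ('h \<Rightarrow> 'k) \<Rightarrow> 'h \<Rightarrow> 'h \<Rightarrow> 'k"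
  where "free_act F d h = conv (F h) d"

lemma free_act_closed: "F \<in> Lin sU D \<Longrightarrow> d \<in> D \<Longrightarrow> free_act F d \<in> Lin sU D"
  using lin_compose[OF lin_conv_left]
  by (auto simp: free_act_def[abs_def] Lin_def intro: D_conv)

lemma D_module_free:
  assumes M: "subsp sUU M" "M \<subseteq> Lin sU D" "\<And>F d. F \<in> M \<Longrightarrow> d \<in> D \<Longrightarrow> free_act F d \<in> M"
  shows "D_module sH \<Delta> \<epsilon> S B \<Lambda> I sUU free_act M"
proof (rule D_module.intro[OF coideal_quotient_axioms], rule D_module_axioms.intro)
  show v: "vector_space sUU" by (rule vector_space_fun_scale[OF vs_U])
  show "subsp sUU M" by (rule M)
  show "fdim sUU M" by (rule fdim_subset[OF v Lin_dim(1)[OF vs_U subsp_D fdim_D] M(2)])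
  show "lin sUU sUU (\<lambda>x. free_act x d)" for d
    by (simp add: lin_def free_act_def fun_scale_def[of sU] fun_eq_iff[of "free_act _ _"] lin_add[OF lin_conv_left] lin_scale[OF lin_conv_left])
  show "lin sU sUU (free_act x)" for x
    by (simp add: lin_def free_act_def fun_scale_def[of sU] fun_eq_iff[of "free_act _ _"] lin_add[OF lin_conv_right] lin_scale[OF lin_conv_right])
  fix x assume x: "x \<in> M"
  then have l: "lin sH (*) (x h)" for h using M(2) Lin_D(2) by blast
  show "free_act x \<epsilon> = x" by (simp add: free_act_def fun_eq_iff conv_counit_right[OF l])
  fix d assume d: "d \<in> D"
  show "free_act x d \<in> M" by (rule M(3)[OF x d])
  fix e assume e: "e \<in> D"
  show "free_act (free_act x d) e = free_act x (conv d e)"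
    by (simp add: free_act_def[abs_def] conv_assoc[OF l D_lin[OF d] D_lin[OF e]])
qed

lemma perp_zero: "perp {0} = UNIV"
  by (simp add: perp_def lin_0[OF R_lin_left])

lemma right_ideal_D_zero: "right_ideal_D {0}"
  by (auto simp: right_ideal_D_def lin_0[OF lin_conv_left] subsp_0[OF vs_U subsp_D] vs_U
      intro!: subspI simp: module.scale_zero_right[of sU] module_iff_vector_space)

text \<open>The conclusion says that \<open>L\<close> generates \<open>H\<^sup>*\<close> as a right ideal.\<close>

lemma perp_eq_zero:
  assumes LD: "L \<subseteq> D" and d: "d \<in> D" "d \<noteq> 0" and L: "\<And>h. (\<lambda>x. d (x * h)) \<in> L"
  shows "perp L = {0}"
proof -
  note rules = lin_rules lin_compose[OF D_lin[OF d(1)]]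
  obtain y where y: "d y \<noteq> 0" using d(2) by (auto simp: fun_eq_iff)
  have "h = 0" if h: "h \<in> perp L" for h
  proof -
    have 0: "sw (\<lambda>a r. sH (d (a * e)) r) h = 0" for e
      using h L[of e] by (auto simp: perp_def R_def)
    \<comment> \<open>Insert \<open>h_1 S(h_2)\<close> in front of \<open>y\<close>, so that
      \<open>d(y) h = d(h_1 S(h_2) y) h_3\<close>. Expanding \<open>S h_2\<close> over the basis
      leaves only terms built from \<open>d(h_1 e) h_2\<close>, which are zero by fact
      \<open>0\<close>.\<close>
    have "sH (d (1 * y)) h = sw (\<lambda>z r. sH (\<epsilon> z) (sH (d (1 * y)) r)) h"
      by (rule sw_counit_left[symmetric]) (intro rules)
    also have "\<dots> = sw (\<lambda>z r. sw (\<lambda>a c. sH (d (a * S c * y)) r) z) h"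
      by (subst sw_antipode_right[of sH "\<lambda>z. sH (d (z * y)) _"]; (intro rules)?) (rule refl)
    also have "\<dots> = sw (\<lambda>a z. sw (\<lambda>c r. sH (d (a * S c * y)) r) z) h"
      by (rule coassoc[OF vs_H]; intro rules)
    also have "\<dots> = sw (\<lambda>a z. \<Sum>r\<in>B. \<Sum>m\<in>B. sH (co m (comp r z)) (sH (d (a * S m * y)) r)) h"
    proof -
      have ex: "sH (d (a * S c * y)) r = (\<Sum>m\<in>B. sH (co m c) (sH (d (a * S m * y)) r))" for a c r
        by (rule lin_expand[of sH "\<lambda>c. sH (d (a * S c * y)) r"]) (intro rules)
      have "sw (\<lambda>c r. sH (d (a * S c * y)) r) z
          = (\<Sum>r\<in>B. \<Sum>m\<in>B. sH (co m (comp r z)) (sH (d (a * S m * y)) r))" for a z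
        unfolding sweedler_def by (rule sum.cong[OF refl]) (rule ex)
      then show ?thesis by (simp only:)
    qed
    also have "\<dots> = (\<Sum>r\<in>B. \<Sum>m\<in>B. sw (\<lambda>a z. sH (co m (comp r z)) (sH (d (a * S m * y)) r)) h)"
      unfolding sweedler_def[of _ _ _ _ _ h]
      by (subst sum.swap, rule sum.cong[OF refl], rule sum.swap)
    also have "\<dots> = 0"
    proof (intro sum.neutral ballI)
      fix r m
      have l: "lin sH (*) (\<lambda>z. co m (comp r z))" by (rule lin_compose[OF co_lin comp_lin])
      have "sw (\<lambda>a z. sH (co m (comp r z)) (sH (d (a * S m * y)) r)) h
          = sw (\<lambda>a z. sH (co m (comp r (sH (d (a * (S m * y))) z))) r) h"
        by (simp add: lin_scale[OF l] mult.commute mult.assoc)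
      also have "\<dots> = sH (co m (comp r (sw (\<lambda>a z. sH (d (a * (S m * y))) z) h))) r"
        by (rule lin_of_sw[symmetric]) (rule lin_scale_left[OF l])
      finally show "sw (\<lambda>a z. sH (co m (comp r z)) (sH (d (a * S m * y)) r)) h = 0"
        by (simp add: 0 lin_0[OF l])
    qed
    finally show ?thesis using y by simp
  qed
  then show ?thesis using subsp_0[OF vs_H subsp_perp[OF LD]] by blast
qed

text \<open>On \<open>d \<otimes> f\<close> the summand at \<open>y\<close> is
  \<open>f(y_2) (R d (Z y)) S(y_1)\<close>. If \<open>Z\<close> takes values in
  \<open>perp L\<close>, the result is a \<open>D\<close>-linear map on
  \<open>(D/L) \<otimes> H*\<close>; the value 0 elsewhere follows the convention of
  \<open>Hom\<close>.\<close>

definition twisted_lift :: "('h \<Rightarrow> 'h) \<Rightarrow> ('h \<Rightarrow> 'h \<Rightarrow> 'k) \<Rightarrow> 'h"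
  where "twisted_lift Z F = (if F \<in> Lin sU D then \<Sum>y\<in>B. sw (\<lambda>a b. R (F b) (Z y) * S a) y else 0)"

lemma R_antipode_mult:
  assumes d: "lin sH (*) d"
  shows "R d (w * S a) = sw (\<lambda>s t. R (\<lambda>x. d (x * S t)) w * S s) a"
proof -
  note rules = lin_rules lin_compose[OF d]
  have b: "bilin sH sH sH (\<lambda>a b. sH (d a) b)" by (intro rules)
  have "R d (w * S a) = sw (\<lambda>x y. sw (\<lambda>s t. sH (d (x * S t)) (y * S s)) a) w"
    unfolding R_def sw_mult[OF b vs_H]
    by (subst antipode_anticomult[OF vs_H]; (intro rules)?) (rule refl)
  also have "\<dots> = sw (\<lambda>s t. sw (\<lambda>x y. sH (d (x * S t)) (y * S s)) w) a"
    unfolding sweedler_def by (rule sum.swap)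
  also have "\<dots> = sw (\<lambda>s t. R (\<lambda>x. d (x * S t)) w * S s) a"
    unfolding R_def by (subst lin_of_sw[OF lin_mult_left[OF lin_id]]) (simp add: A.scale_mult_left)
  finally show ?thesis .
qed

text \<open>When \<open>R d\<close> meets the factor \<open>S y_1\<close>,
  \<open>R_antipode_mult\<close> moves a translate \<open>d(_ * S t)\<close> to the other factor.
  This is precisely the twist built into \<open>twisted_act\<close>.\<close>

lemma twisted_lift_linear:
  assumes F: "F \<in> Lin sU D" and d: "d \<in> D"
  shows "sw (\<lambda>a b. R (twisted_act F d b) z * S a) y = R d (sw (\<lambda>a b. R (F b) z * S a) y)"
proof -
  note rules = lin_rules lin_compose[OF D_lin[OF d]] lin_compose[OF R_lin_left]
  have lF: "lin sH sU F" using F by (simp add: Lin_def)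
  have ld: "lin sH (*) (\<lambda>z. d (z * S a))" for a by (intro rules)
  have ld': "lin sH sU (\<lambda>a z. d (z * S a))" unfolding lin_fun_scale_iff by (intro allI rules)
  have lR: "lin s sH g \<Longrightarrow> lin s sH (\<lambda>b. R (conv (F b') (\<lambda>z. d (z * S (g b)))) z)"
    "lin s sH g \<Longrightarrow> lin s sH (\<lambda>b. R (conv (F (g b)) (\<lambda>z. d (z * S a))) z)" for s :: "'k \<Rightarrow> 'h \<Rightarrow> 'h" and g b' a
    by (rule lin_compose[OF R_lin_left], rule lin_compose[OF lin_conv_right], rule lin_compose[OF ld'], assumption)
      (rule lin_compose[OF R_lin_left], rule lin_compose[OF lin_conv_left], rule lin_compose[OF lF], assumption)
  let ?T = "\<lambda>s t b. R (conv (F b) (\<lambda>z. d (z * S t))) z * S s"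
  have "R (twisted_act F d b) z = sw (\<lambda>c e. R (conv (F e) (\<lambda>z. d (z * S c))) z) b" for b
    unfolding twisted_act_def sweedler_def by (rule lin_sum[OF R_lin_left])
  then have "sw (\<lambda>a b. R (twisted_act F d b) z * S a) y = sw (\<lambda>a b. sw (\<lambda>c e. ?T a c e) b) y"
    by (simp add: lin_of_sw[OF lin_mult_left[OF lin_id]])
  also have "\<dots> = sw (\<lambda>a b. sw (\<lambda>s t. ?T s t b) a) y"
    by (rule coassoc[OF vs_H, symmetric]; intro lin_rules lR)
  also have "\<dots> = sw (\<lambda>a b. R d (R (F b) z * S a)) y"
    unfolding R_antipode_mult[OF D_lin[OF d]] R_R[OF ld Lin_D(2)[OF F order_refl]] by (rule refl)
  also have "\<dots> = R d (sw (\<lambda>a b. R (F b) z * S a) y)"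
    by (rule lin_of_sw[OF R_lin[OF D_lin[OF d]], symmetric])
  finally show ?thesis .
qed

text \<open>The values at \<open>\<epsilon> \<otimes> co c\<close> show that the sum of
  \<open>Z y S(y_1) \<otimes> y_2\<close> over \<open>y\<close> is zero. Replacing
  \<open>y_2\<close> by \<open>y_2 v(y_3)\<close> and multiplying the legs cancels the antipode,
  which leaves the sum of \<open>v(y) Z y\<close>; \<open>v = co y\<close> isolates one
  value.\<close>

lemma twisted_lift_injective:
  assumes Z: "lin sH sH Z" and 0: "twisted_lift Z = 0"
  shows "Z = 0"
proof -
  have c0: "(\<Sum>y\<in>B. Z y * S (comp c y)) = 0" if c: "c \<in> B" for c
  proof -
    let ?F = "\<lambda>h. sU (co c h) \<epsilon>"
    have F: "?F \<in> Lin sU D"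
      using subsp_scale[OF vs_U subsp_D D_counit]
      by (simp add: Lin_def lin_fun_scale_iff) (simp add: fun_scale_def lin_rules)
    have "sw (\<lambda>a b. R (?F b) (Z y) * S a) y = Z y * S (comp c y)" for y
    proof -
      have "sw (\<lambda>a b. R (?F b) (Z y) * S a) y = (\<Sum>b\<in>B. sH (co c b) (Z y * S (comp b y)))"
        by (simp add: sweedler_def lin_scale[OF R_lin_left] R_counit A.scale_mult_left)
      also have "\<dots> = (\<Sum>b\<in>B. if b = c then Z y * S (comp b y) else 0)"
        by (rule sum.cong) (auto simp: co_basis c)
      finally show ?thesis using c finite_B by simp
    qed
    then show ?thesis using fun_cong[OF 0, of ?F] F by (simp add: twisted_lift_def)
  qed
  have v0: "(\<Sum>y\<in>B. sH (v y) (Z y)) = 0" if v: "lin sH (*) v" for v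
  proof -
    note rules = lin_rules lin_compose[OF v]
    let ?g = "\<lambda>c. sw (\<lambda>p q. sH (v q) p) c"
    have "sw (\<lambda>a c. Z y * S a * ?g c) y = sH (v y) (Z y)" for y
    proof -
      have "sw (\<lambda>a c. Z y * S a * ?g c) y = sw (\<lambda>a c. sw (\<lambda>p q. sH (v q) (Z y * (S a * p))) c) y"
        by (subst lin_of_sw[OF lin_mult_right[OF lin_id]]) (simp add: A.scale_mult_right mult.assoc)
      also have "\<dots> = sw (\<lambda>r q. sw (\<lambda>a p. sH (v q) (Z y * (S a * p))) r) y"
        by (rule coassoc[OF vs_H, symmetric]; intro rules)
      also have "\<dots> = sw (\<lambda>r q. sH (\<epsilon> r) (sH (v q) (Z y * 1))) y"
        by (subst sw_antipode_left[of sH "\<lambda>x. sH (v _) (Z y * x)"]; (intro rules)?) (rule refl)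
      also have "\<dots> = sH (v y) (Z y * 1)"
        by (rule sw_counit_left) (intro rules)
      finally show ?thesis by simp
    qed
    then have "(\<Sum>y\<in>B. sH (v y) (Z y)) = (\<Sum>y\<in>B. sw (\<lambda>a c. Z y * S a * ?g c) y)" by simp
    also have "\<dots> = (\<Sum>c\<in>B. (\<Sum>y\<in>B. Z y * S (comp c y)) * ?g c)"
      unfolding sweedler_def[of _ _ _ _ "\<lambda>a c. Z _ * S a * _ c"] sum_distrib_right by (rule sum.swap)
    finally show ?thesis by (simp add: c0)
  qed
  have "Z y = 0" if y: "y \<in> B" for y
  proof -
    have "(\<Sum>b\<in>B. sH (co y b) (Z b)) = (\<Sum>b\<in>B. if b = y then Z b else 0)"
      by (rule sum.cong) (auto simp: co_basis y)
    then show ?thesis using v0[OF co_lin[of y]] y finite_B by simp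
  qed
  then show ?thesis unfolding fun_eq_iff by (subst lin_expand[OF Z]) simp
qed

lemma counit_nonzero: "\<epsilon> \<noteq> 0"
  using counit_one fun_cong[of \<epsilon> 0 1] by auto

lemma card_B_pos: "0 < card B" and dm_D_pos: "0 < dm sU D"
proof -
  show "0 < dm sU D"
    by (rule lin_space.dim_pos_fin[OF lin_space_of[OF vs_U] subsp_D fdim_D D_counit counit_nonzero])
  have "B \<noteq> {}" using counit_one lin_expand[OF counit_lin, of 1] by auto
  then show "0 < card B" using finite_B by (simp add: card_gt_0_iff)
qed

text \<open>Let \<open>n = dim H\<close> and let \<open>p/q\<close> be the maximal ratio, attained
  at \<open>L0\<close>. Put \<open>M = D \<otimes> H*\<close>, \<open>W = L0 \<otimes> H*\<close>
  and \<open>W' = W + F0 D\<close>, where \<open>W'/W\<close> is isomorphic to \<open>D\<close>.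
  Then \<open>n p \<le> dim Hom(M/W) \<le> dim Hom(M/W') + n\<close> and
  \<open>q dim Hom(M/W') \<le> p (n q - dim D)\<close>. Eliminating \<open>dim Hom(M/W')\<close>
  gives \<open>p dim D \<le> q n\<close>.\<close>

lemma perp_dim_bound:
  assumes L: "right_ideal_D L"
  shows "dm sU D * dm sH (perp L) + card B * dm sU L \<le> card B * dm sU D"
proof -
  let ?n = "card B" and ?\<D> = "dm sU D"
  have sub: "subsp sU L" "L \<subseteq> D" if "right_ideal_D L" for L using that by (auto simp: right_ideal_D_def)
  have less: "dm sU L < ?\<D>" if "right_ideal_D L" "L \<noteq> D" for L
    using dm_strict_mono[OF vs_U sub(1)[OF that(1)] subsp_D fdim_D] sub(2)[OF that(1)] that(2) by blast
  \<comment> \<open>There may be infinitely many ideals but only finitely many pairs of dimensions,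
    so a maximal ratio exists. The zero ideal contributes the pair in fact \<open>z\<close>.\<close>
  define X where "X = {(dm sH (perp L), ?\<D> - dm sU L) | L. right_ideal_D L \<and> L \<noteq> D}"
  have perp_le: "dm sH (perp L) \<le> ?n" if "right_ideal_D L" for L
    using dm_mono[OF vs_H subsp_perp[OF sub(2)[OF that]] A.subspace_UNIV fdim_H] dm_H by auto
  have "X \<subseteq> {..?n} \<times> {..?\<D>}" using perp_le by (auto simp: X_def)
  then have fX: "finite X" by (rule finite_subset) auto
  have zero_ne: "{0} \<noteq> D" using D_counit counit_nonzero by blast
  have z: "(?n, ?\<D>) \<in> X"
    unfolding X_def using right_ideal_D_zero zero_ne perp_zero dm_H dm_zero[OF vs_U]
    by (metis (mono_tags, lifting) CollectI diff_zero)
  let ?r = "\<lambda>(a, b). real a / real b"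
  have "Max (?r ` X) \<in> ?r ` X" by (rule Max_in) (use fX z in auto)
  then obtain p q where pq: "(p, q) \<in> X" "Max (?r ` X) = real p / real q" by auto
  then obtain L0 where L0: "right_ideal_D L0" "L0 \<noteq> D" "p = dm sH (perp L0)" "q = ?\<D> - dm sU L0"
    by (auto simp: X_def)
  have q: "0 < q" using less[OF L0(1,2)] L0(4) by simp
  have max: "q * a \<le> p * b" if "(a, b) \<in> X" for a b
  proof -
    have b: "0 < b" using that less by (force simp: X_def)
    have "real a / real b \<le> real p / real q"
      unfolding pq(2)[symmetric] by (rule Max_ge) (use fX that in force)+
    then have "real (q * a) \<le> real (p * b)" using b q by (simp add: field_simps)
    then show ?thesis by linarith
  qed
  \<comment> \<open>The improper ideal was left out of \<open>X\<close> to avoid a zero denominator;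
    it satisfies the bound because \<open>\<epsilon> \<in> D\<close> acts as the identity, so that
    \<open>perp D\<close> is zero.\<close>
  have hyp: "q * dm sH (perp L) + p * dm sU L \<le> p * ?\<D>" if "right_ideal_D L" for L
  proof (cases "L = D")
    case True
    have "perp D = {0}"
      using D_counit R_counit by (auto simp: perp_def) (metis D_lin R_lin lin_0)+
    then show ?thesis using True by (simp add: dm_zero[OF vs_H])
  next
    case False
    then have "q * dm sH (perp L) \<le> p * (?\<D> - dm sU L)" using max that by (auto simp: X_def)
    moreover have "p * (?\<D> - dm sU L) + p * dm sU L = p * ?\<D>"
      using less[OF that False] by (simp add: add_mult_distrib2[symmetric])
    ultimately show ?thesis by linarith
  qed
  have p: "0 < p"
  proof -
    have "q * ?n \<le> p * ?\<D>" using max[OF z] .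
    then show ?thesis using q card_B_pos by (metis gr0I mult_is_0 not_le nat_0_less_mult_iff)
  qed
  interpret tw: D_module sH \<Delta> \<epsilon> S B \<Lambda> I sUU twisted_act "Lin sU D"
    by (rule D_module_twisted)
  \<comment> \<open>\<open>?F0\<close> is the tensor of the units of \<open>D\<close> and
    \<open>H*\<close>. Acting on it by \<open>d\<close> gives \<open>h \<mapsto> d(_ * S h)\<close>,
    so it generates the desired copy of \<open>D\<close> modulo \<open>?W\<close>.\<close>
  let ?W = "Lin sU L0" and ?F0 = "\<lambda>h. sU (\<epsilon> h) \<epsilon>"
  have W: "tw.submod ?W"
    unfolding tw.submod_def using subsp_Lin[OF vs_U sub(1)[OF L0(1)]] sub(2)[OF L0(1)]
      twisted_act_closed[OF L0(1)] by (auto simp: Lin_def)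
  have F0: "?F0 \<in> Lin sU D"
    using subsp_scale[OF vs_U subsp_D D_counit]
    by (simp add: Lin_def lin_fun_scale_iff) (simp add: fun_scale_def lin_rules)
  have act_F0: "twisted_act ?F0 d h = (\<lambda>x. d (x * S h))" if d: "d \<in> D" for d h
  proof
    fix x
    have "conv (?F0 b) (\<lambda>z. d (z * S a)) x = \<epsilon> b * d (x * S a)" for a b
      using lin_scale[OF lin_conv_left, of "\<epsilon> b" \<epsilon> "\<lambda>z. d (z * S a)"] conv_counit_left[OF D_lin[OF D_translate[OF d]]]
      by (simp add: fun_scale_def)
    then have "twisted_act ?F0 d h x = sw (\<lambda>a b. \<epsilon> b * d (x * S a)) h" by (simp add: twisted_act_apply)
    also have "\<dots> = d (x * S h)"
      by (rule sw_counit_right) (intro lin_rules lin_compose[OF D_lin[OF d]])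
    finally show "twisted_act ?F0 d h x = d (x * S h)" .
  qed
  \<comment> \<open>Since \<open>S\<close> is onto, a nonzero \<open>d\<close> in the annihilator
    would have all its translates in \<open>L0\<close>. Then \<open>perp L0\<close> would be zero,
    against \<open>p > 0\<close>.\<close>
  have col: "tw.colon ?W ?F0 = {0}"
  proof -
    have "d = 0" if d: "d \<in> tw.colon ?W ?F0" for d
    proof (rule ccontr)
      assume ne: "d \<noteq> 0"
      have dD: "d \<in> D" and "twisted_act ?F0 d \<in> ?W" using d by (auto simp: tw.colon_def)
      then have "(\<lambda>x. d (x * S h)) \<in> L0" for h using act_F0[OF dD] by (auto simp: Lin_def)
      then have "(\<lambda>x. d (x * h)) \<in> L0" for h by (metis antipode_surj surjD)
      from perp_eq_zero[OF sub(2)[OF L0(1)] dD ne this] show False using p L0(3) by (simp add: dm_zero[OF vs_H])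
    qed
    then show ?thesis
      using subsp_0[OF vs_U sub(1)[OF tw.colon_right_ideal[OF W F0]]] by blast
  qed
  let ?W' = "tw.add_cyclic ?W ?F0"
  have W': "tw.submod ?W'" by (rule tw.submod_add_cyclic[OF W F0])
  have b': "fdim tw.sHom (tw.Hom ?W')"
    "q * dm tw.sHom (tw.Hom ?W') + p * dm sUU ?W' \<le> p * dm sUU (Lin sU D)"
    using tw.Hom_bound[OF hyp W'] by auto
  note H = tw.Hom_add_cyclic[OF W F0 b'(1), unfolded col perp_zero dm_H]
  have dW': "dm sUU ?W' = dm sUU ?W + ?\<D>"
    using tw.dm_add_cyclic[OF W F0] by (simp add: col dm_zero[OF vs_U])
  have dM: "dm sUU (Lin sU D) = ?n * ?\<D>" by (rule Lin_dim(2)[OF vs_U subsp_D fdim_D])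
  have dW: "dm sUU ?W = ?n * dm sU L0"
    by (rule Lin_dim(2)[OF vs_U sub(1)[OF L0(1)] fdim_subset[OF vs_U fdim_D sub(2)[OF L0(1)]]])
  have lower: "?n * p \<le> dm tw.sHom (tw.Hom ?W)"
  proof -
    note sp = subsp_perp[OF sub(2)[OF L0(1)]]
    have "dm sH (perp L0) = p" using L0 by simp
    then have "?n * p = dm (fun_scale sH) (Lin sH (perp L0))"
      using Lin_dim(2)[OF vs_H sp fdim_H] by simp
    also have "\<dots> \<le> dm tw.sHom (tw.Hom ?W)"
    proof (rule lin_injective_bound[OF vector_space_fun_scale[OF vs_H] tw.vs_Hom _ subsp_Lin[OF vs_H sp] tw.subsp_Hom H(1)])
      show "lin (fun_scale sH) tw.sHom twisted_lift"
        by (rule linI) (auto simp: fun_eq_iff fun_scale_def twisted_lift_def sweedler_def Lin_D(2)[OF _ order_refl]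
            lin_add[OF R_lin] lin_scale[OF R_lin] ring_distribs sum.distrib A.scale_mult_left A.scale_sum_right)
      show "twisted_lift ` Lin sH (perp L0) \<subseteq> tw.Hom ?W"
      proof clarify
        fix Z assume Z: "Z \<in> Lin sH (perp L0)"
        show "twisted_lift Z \<in> tw.Hom ?W"
          unfolding tw.Hom_def
        proof (intro CollectI conjI ballI allI impI)
          fix F G assume FG: "F \<in> Lin sU D" "G \<in> Lin sU D"
          have "F + G \<in> Lin sU D" by (rule subsp_add[OF tw.vs_V tw.M_sub FG])
          then show "twisted_lift Z (F + G) = twisted_lift Z F + twisted_lift Z G"
            using FG by (simp add: twisted_lift_def sweedler_def lin_add[OF R_lin_left] ring_distribs sum.distrib)
        next
          fix c F assume F: "F \<in> Lin sU D"
          have "fun_scale sU c F \<in> Lin sU D" by (rule subsp_scale[OF tw.vs_V tw.M_sub F])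
          then show "twisted_lift Z (fun_scale sU c F) = sH c (twisted_lift Z F)"
            using F by (simp add: twisted_lift_def sweedler_def fun_scale_def[of sU] lin_scale[OF R_lin_left]
                A.scale_mult_left A.scale_sum_right)
        next
          fix F d assume F: "F \<in> Lin sU D" and d: "d \<in> D"
          then show "twisted_lift Z (twisted_act F d) = R d (twisted_lift Z F)"
            using tw.act_closed[OF F d]
            by (simp add: twisted_lift_def twisted_lift_linear lin_sum[OF R_lin[OF D_lin[OF d]]])
        next
          fix F assume F: "F \<in> ?W"
          have "R (F b) (Z y) = 0" for b y using F Z by (auto simp: Lin_def perp_def)
          then show "twisted_lift Z F = 0" by (simp add: twisted_lift_def sweedler_def)
        next
          fix F assume "F \<notin> Lin sU D"
          then show "twisted_lift Z F = 0" by (simp add: twisted_lift_def)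
        qed
      qed
      show "Z = 0" if "Z \<in> Lin sH (perp L0)" "twisted_lift Z = 0" for Z
        using that twisted_lift_injective by (auto simp: Lin_def)
    qed
    finally show ?thesis .
  qed
  have qn: "p * ?\<D> \<le> q * ?n"
  proof -
    let ?h = "dm tw.sHom (tw.Hom ?W')" and ?l = "dm sU L0"
    have D: "?\<D> = q + ?l" using less[OF L0(1,2)] L0(4) by simp
    have "q * (?n * p) \<le> q * (?h + ?n)" using lower H(2) by (meson le_trans mult_le_mono2)
    moreover have "q * ?h + p * (?n * ?l + ?\<D>) \<le> p * (?n * ?\<D>)" using b'(2) unfolding dW' dM dW .
    moreover have "p * (?n * ?\<D>) = q * (?n * p) + p * (?n * ?l)" unfolding D by algebra
    ultimately show ?thesis by (simp add: algebra_simps)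
  qed
  \<comment> \<open>The maximal ratio \<open>p/q\<close> in \<open>hyp\<close> is replaced by
    \<open>n / dim D\<close>; the positive factor \<open>q\<close> is cancelled at the end.\<close>
  have "q * (?\<D> * dm sH (perp L)) + q * (?n * dm sU L) \<le> q * (?n * ?\<D>)"
  proof -
    have h: "q * dm sH (perp L) + p * dm sU L \<le> p * ?\<D>" by (rule hyp[OF L])
    have le: "dm sU L \<le> ?\<D>" by (rule dm_mono[OF vs_U sub(1)[OF L] subsp_D fdim_D sub(2)[OF L]])
    then obtain r where r: "?\<D> = dm sU L + r" using le_Suc_ex by blast
    have "q * dm sH (perp L) \<le> p * r" using h unfolding r by (simp add: algebra_simps)
    then have "q * dm sH (perp L) * ?\<D> \<le> p * r * ?\<D>" by (rule mult_le_mono1)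
    also have "\<dots> = p * ?\<D> * r" by simp
    also have "\<dots> \<le> q * ?n * r" by (rule mult_le_mono1[OF qn])
    finally have "q * dm sH (perp L) * ?\<D> + q * (?n * dm sU L) \<le> q * ?n * r + q * (?n * dm sU L)" by simp
    also have "\<dots> = q * (?n * ?\<D>)" unfolding r by algebra
    finally show ?thesis by (simp add: ac_simps)
  qed
  then have "q * (?\<D> * dm sH (perp L) + ?n * dm sU L) \<le> q * (?n * ?\<D>)" by (simp only: add_mult_distrib2)
  then show ?thesis using q by simp
qed

end

section \<open>Integrals of the quotient\<close>

context coideal_quotient
begin

text \<open>These are the \<open>D\<close>-linear maps \<open>H/I \<rightarrow> H\<close>, that is,
  the maps of left comodules over \<open>H/I\<close>.\<close>

definition colinear :: "('h \<Rightarrow> 'h) set"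
  where "colinear = {\<phi>. lin sH sH \<phi> \<and> (\<forall>x\<in>I. \<phi> x = 0) \<and> (\<forall>d\<in>D. \<forall>x. \<phi> (R d x) = R d (\<phi> x))}"

text \<open>Here \<open>F\<close> stands for the element \<open>\<Sum> b \<otimes> F b\<close> of
  the free module \<open>H \<otimes> D\<close>, and \<open>pairing \<psi>\<close> is the
  \<open>D\<close>-linear extension of \<open>\<psi>\<close>. For the identity it is the action map
  onto \<open>H\<close>.\<close>

definition pairing :: "('h \<Rightarrow> 'h) \<Rightarrow> ('h \<Rightarrow> 'h \<Rightarrow> 'k) \<Rightarrow> 'h"
  where "pairing \<psi> F = (\<Sum>b\<in>B. R (F b) (\<psi> b))"

text \<open>The element \<open>x \<otimes> \<epsilon>\<close> of \<open>H \<otimes> D\<close>; the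
  sum identifies \<open>H\<close> with its dual through the basis.\<close>

definition embed :: "'h \<Rightarrow> 'h \<Rightarrow> 'h \<Rightarrow> 'k"
  where "embed x h = sU (\<Sum>b\<in>B. co b h * co b x) \<epsilon>"

lemma vs_UU: "vector_space sUU"
  by (rule vector_space_fun_scale[OF vs_U])

lemma vs_HH: "vector_space (fun_scale sH)"
  by (rule vector_space_fun_scale[OF vs_H])

lemma pairing_lin: "lin sUU sH (pairing \<psi>)"
  by (rule linI) (simp_all add: pairing_def fun_scale_def[of sU] lin_add[OF R_lin_left] lin_scale[OF R_lin_left]
      sum.distrib A.scale_sum_right)

lemma pairing_free_act: "F \<in> Lin sU D \<Longrightarrow> d \<in> D \<Longrightarrow> pairing \<psi> (free_act F d) = R d (pairing \<psi> F)"
  by (simp add: pairing_def free_act_def lin_sum[OF R_lin[OF D_lin]] R_R D_lin Lin_D(2)[OF _ order_refl])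

lemma pairing_colinear:
  assumes "\<phi> \<in> colinear" "F \<in> Lin sU D"
  shows "pairing \<phi> F = \<phi> (pairing (\<lambda>x. x) F)"
proof -
  have l: "lin sH sH \<phi>" using assms(1) by (simp add: colinear_def)
  show ?thesis
    using assms by (simp add: pairing_def lin_sum[OF l]) (simp add: colinear_def Lin_D(3)[OF _ order_refl])
qed

lemma embed_Lin: "embed x \<in> Lin sU D"
  unfolding Lin_def embed_def[abs_def]
  using subsp_scale[OF vs_U subsp_D D_counit]
  by (simp add: lin_fun_scale_iff) (simp add: fun_scale_def lin_rules)

lemma pairing_embed: "lin sH sH \<psi> \<Longrightarrow> pairing \<psi> (embed x) = \<psi> x"
proof -
  assume \<psi>: "lin sH sH \<psi>"
  have "(\<Sum>b'\<in>B. co b' b * co b' x) = co b x" if b: "b \<in> B" for b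
  proof -
    have "(\<Sum>b'\<in>B. co b' b * co b' x) = (\<Sum>b'\<in>B. if b' = b then co b' x else 0)"
      by (rule sum.cong) (auto simp: co_basis b)
    then show ?thesis using b finite_B by simp
  qed
  then have "pairing \<psi> (embed x) = (\<Sum>b\<in>B. sH (co b x) (\<psi> b))"
    by (simp add: pairing_def embed_def lin_scale[OF R_lin_left] R_counit)
  then show ?thesis by (simp add: lin_expand[OF \<psi>, symmetric])
qed

text \<open>The kernel of the free presentation \<open>H \<otimes> D \<rightarrow> H/X\<close>,
  which explains the dimension in \<open>preimage_facts\<close>.\<close>

definition preimage :: "'h set \<Rightarrow> ('h \<Rightarrow> 'h \<Rightarrow> 'k) set"
  where "preimage X = {F \<in> Lin sU D. pairing (\<lambda>x. x) F \<in> X}"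

lemma preimage_facts:
  assumes X: "subsp sH X" and XR: "\<And>x d. x \<in> X \<Longrightarrow> d \<in> D \<Longrightarrow> R d x \<in> X"
  shows "subsp sUU (preimage X)" "preimage X \<subseteq> Lin sU D"
    "F \<in> preimage X \<Longrightarrow> d \<in> D \<Longrightarrow> free_act F d \<in> preimage X"
    "dm sUU (preimage X) + card B = card B * dm sU D + dm sH X"
proof -
  note p = pairing_lin[of "\<lambda>x. x"]
  note sL = subsp_Lin[OF vs_U subsp_D]
  show "subsp sUU (preimage X)"
    by (rule subspI[OF vs_UU])
      (auto simp: preimage_def lin_0[OF p] lin_add[OF p] lin_scale[OF p]
        intro: subsp_0[OF vs_H X] subsp_add[OF vs_H X] subsp_scale[OF vs_H X]
          subsp_0[OF vs_UU sL] subsp_add[OF vs_UU sL] subsp_scale[OF vs_UU sL])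
  show "preimage X \<subseteq> Lin sU D" by (auto simp: preimage_def)
  show "F \<in> preimage X \<Longrightarrow> d \<in> D \<Longrightarrow> free_act F d \<in> preimage X"
    by (simp add: preimage_def free_act_closed pairing_free_act XR)
  obtain P where P: "lin sH sH P" "\<And>v. P v = 0 \<longleftrightarrow> v \<in> X"
    by (rule exists_lin_with_kernel[OF vs_H X]) blast
  have k: "{F \<in> Lin sU D. P (pairing (\<lambda>x. x) F) = 0} = preimage X" "{h \<in> UNIV. P h = 0} = X"
    by (auto simp: preimage_def P(2))
  have "(\<lambda>F. P (pairing (\<lambda>x. x) F)) ` Lin sU D = P ` UNIV"
  proof (intro equalityI subsetI)
    fix y assume "y \<in> P ` UNIV"
    then obtain x where "y = P (pairing (\<lambda>x. x) (embed x))" by (auto simp: pairing_embed[OF lin_id])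
    then show "y \<in> (\<lambda>F. P (pairing (\<lambda>x. x) F)) ` Lin sU D" using embed_Lin by blast
  qed blast
  then show "dm sUU (preimage X) + card B = card B * dm sU D + dm sH X"
    using lin_rank_nullity(2)[OF vs_UU vs_H lin_compose[OF P(1) p] sL Lin_dim(1)[OF vs_U subsp_D fdim_D]]
      lin_rank_nullity(2)[OF vs_H vs_H P(1) A.subspace_UNIV fdim_H]
    unfolding k by (simp add: Lin_dim(2)[OF vs_U subsp_D fdim_D] dm_H)
qed

text \<open>The kernel of the presentation contains \<open>x \<otimes> \<epsilon>\<close> for
  \<open>x \<in> I\<close> and \<open>x \<otimes> d - R d x \<otimes> \<epsilon>\<close> for all
  \<open>x\<close>. Vanishing on these two kinds of elements is what \<open>colinear\<close>
  demands.\<close>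

lemma colinear_if:
  assumes \<psi>: "lin sH sH \<psi>" and 0: "\<And>F. F \<in> preimage I \<Longrightarrow> pairing \<psi> F = 0"
  shows "\<psi> \<in> colinear"
  unfolding colinear_def
proof (intro CollectI conjI ballI allI \<psi>)
  fix x assume "x \<in> I"
  then have "embed x \<in> preimage I" by (simp add: preimage_def embed_Lin pairing_embed[OF lin_id])
  from 0[OF this] show "\<psi> x = 0" by (simp add: pairing_embed[OF \<psi>])
next
  fix d x assume d: "d \<in> D"
  let ?F = "free_act (embed x) d - embed (R d x)"
  have "?F \<in> Lin sU D"
    using module.subspace_diff[of sUU] vs_UU module_iff_vector_space
      subsp_Lin[OF vs_U subsp_D] free_act_closed[OF embed_Lin d] embed_Lin by blast
  moreover have "pairing \<chi> ?F = R d (\<chi> x) - \<chi> (R d x)" if "lin sH sH \<chi>" for \<chi>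
    by (simp add: lin_diff[OF pairing_lin] pairing_free_act[OF embed_Lin d] pairing_embed[OF that])
  from this[OF lin_id] this[OF \<psi>] have "pairing (\<lambda>x. x) ?F = 0" "pairing \<psi> ?F = R d (\<psi> x) - \<psi> (R d x)"
    by simp_all
  ultimately have "R d (\<psi> x) - \<psi> (R d x) = 0"
    using 0[of ?F] subsp_0[OF vs_H I_sub] by (simp add: preimage_def)
  then show "\<psi> (R d x) = R d (\<psi> x)" by simp
qed

definition restricted_pairing :: "('h \<Rightarrow> 'h \<Rightarrow> 'k) set \<Rightarrow> ('h \<Rightarrow> 'h) \<Rightarrow> ('h \<Rightarrow> 'h \<Rightarrow> 'k) \<Rightarrow> 'h"
  where "restricted_pairing M \<psi> F = (if F \<in> M then pairing \<psi> F else 0)"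

lemma restricted_pairing_lin:
  "M \<subseteq> Lin sU D \<Longrightarrow> lin (fun_scale sH) (fun_scale sH) (restricted_pairing M)"
  by (rule linI) (auto simp: fun_eq_iff fun_scale_def restricted_pairing_def pairing_def subset_iff
      lin_add[OF R_lin] lin_scale[OF R_lin] Lin_D(2)[OF _ order_refl] sum.distrib A.scale_sum_right)

lemma restricted_pairing_Hom:
  assumes m: "D_module sH \<Delta> \<epsilon> S B \<Lambda> I sUU free_act M" and M: "M \<subseteq> Lin sU D"
    and W: "\<And>F. F \<in> W \<Longrightarrow> pairing \<psi> F = 0"
  shows "restricted_pairing M \<psi> \<in> D_module.Hom sH \<Delta> B I sUU free_act M W"
proof -
  interpret D_module sH \<Delta> \<epsilon> S B \<Lambda> I sUU free_act M by (rule m)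
  show ?thesis
    unfolding Hom_def using M act_closed subsp_add[OF vs_UU M_sub] subsp_scale[OF vs_UU M_sub]
    by (auto simp: restricted_pairing_def lin_add[OF pairing_lin] lin_scale[OF pairing_lin] W
        pairing_free_act subset_iff)
qed

text \<open>Let \<open>X\<close> be the common kernel of the colinear maps and
  \<open>n = dim H\<close>. Pairings restricted to \<open>preimage I\<close> form a space of
  dimension at most \<open>n dim (preimage I) / dim D\<close>, so the kernel \<open>K\<close> of
  restriction has dimension at least \<open>n (n - dim I) / dim D\<close>. Its members are colinear,
  hence vanish on \<open>X\<close>, and so \<open>K\<close> embeds into
  \<open>Hom_D(H/X, H)\<close>, of dimension at most \<open>n (n - dim X) / dim D\<close>. Therefore
  \<open>dim X \<le> dim I\<close>.\<close>

lemma colinear_separates: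
  assumes x: "\<And>\<phi>. \<phi> \<in> colinear \<Longrightarrow> \<phi> x = 0"
  shows "x \<in> I"
proof (rule ccontr)
  assume xI: "x \<notin> I"
  let ?n = "card B" and ?\<D> = "dm sU D"
  define X where "X = {y. \<forall>\<phi>\<in>colinear. \<phi> y = 0}"
  have X: "subsp sH X"
    by (rule subspI[OF vs_H]) (auto simp: X_def colinear_def lin_0 lin_add lin_scale)
  have XR: "R d y \<in> X" if "y \<in> X" "d \<in> D" for y d
    using that by (auto simp: X_def colinear_def lin_0[OF R_lin[OF D_lin]])
  have "I \<subset> X" using xI x by (auto simp: X_def colinear_def)
  then have less: "dm sH I < dm sH X" by (rule dm_strict_mono[OF vs_H I_sub X fdim_H])
  let ?W = "preimage I" and ?V = "preimage X" and ?M = "Lin sU D"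
  note W = preimage_facts[OF I_sub R_I] and V = preimage_facts[OF X XR]
  have mW: "D_module sH \<Delta> \<epsilon> S B \<Lambda> I sUU free_act ?W"
    by (rule D_module_free) (use W in auto)
  have mM: "D_module sH \<Delta> \<epsilon> S B \<Lambda> I sUU free_act ?M"
    by (rule D_module_free) (auto simp: free_act_closed subsp_Lin[OF vs_U subsp_D])
  interpret w: D_module sH \<Delta> \<epsilon> S B \<Lambda> I sUU free_act ?W by (rule mW)
  interpret m: D_module sH \<Delta> \<epsilon> S B \<Lambda> I sUU free_act ?M by (rule mM)
  define K where "K = {\<psi> \<in> Lin sH UNIV. restricted_pairing ?W \<psi> = 0}"
  have s0: "w.submod {0}"
    by (auto simp: w.submod_def lin_0[OF w.act_lin_left] subsp_0[OF vs_UU W(1)]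
        module.subspace_single_0[of sUU] vs_UU module_iff_vector_space)
  have h0: "fdim w.sHom (w.Hom {0})" "?\<D> * dm w.sHom (w.Hom {0}) + ?n * 0 \<le> ?n * dm sUU ?W"
    using w.Hom_bound[OF perp_dim_bound s0] by (auto simp: dm_zero[OF vs_UU])
  have sV: "m.submod ?V" using V by (auto simp: m.submod_def)
  have hV: "fdim m.sHom (m.Hom ?V)" "?\<D> * dm m.sHom (m.Hom ?V) + ?n * dm sUU ?V \<le> ?n * dm sUU ?M"
    using m.Hom_bound[OF perp_dim_bound sV] by auto
  have sE: "subsp (fun_scale sH) (Lin sH UNIV)" by (rule subsp_Lin[OF vs_H A.subspace_UNIV])
  have dE: "fdim (fun_scale sH) (Lin sH UNIV)" "dm (fun_scale sH) (Lin sH UNIV) = ?n * ?n"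
    using Lin_dim[OF vs_H A.subspace_UNIV fdim_H] by (auto simp: dm_H)
  have fK: "fdim (fun_scale sH) K" by (rule fdim_subset[OF vs_HH dE(1)]) (auto simp: K_def)
  have sK: "subsp (fun_scale sH) K"
    unfolding K_def by (rule subsp_kernel[OF vs_HH w.vs_Hom restricted_pairing_lin[OF W(2)] sE])
  have 1: "?n * ?n \<le> dm (fun_scale sH) K + dm w.sHom (w.Hom {0})"
    unfolding dE(2)[symmetric] K_def
  proof (rule lin_rank_bound(2)[OF vs_HH w.vs_Hom restricted_pairing_lin[OF W(2)] sE w.subsp_Hom h0(1)])
    show "restricted_pairing ?W ` Lin sH UNIV \<subseteq> w.Hom {0}"
      using restricted_pairing_Hom[OF mW W(2), of "{0}"] by (auto simp: lin_0[OF pairing_lin])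
    show "fdim (fun_scale sH) {\<psi> \<in> Lin sH UNIV. restricted_pairing ?W \<psi> = 0}" using fK by (simp add: K_def)
  qed
  have Kc: "\<psi> \<in> colinear" if \<psi>: "\<psi> \<in> K" for \<psi>
  proof (rule colinear_if)
    show "lin sH sH \<psi>" using \<psi> by (simp add: K_def Lin_def)
    fix F assume F: "F \<in> ?W"
    have "restricted_pairing ?W \<psi> F = 0" using \<psi> by (simp add: K_def)
    then show "pairing \<psi> F = 0" using F by (simp add: restricted_pairing_def)
  qed
  have 2: "dm (fun_scale sH) K \<le> dm m.sHom (m.Hom ?V)"
  proof (rule lin_injective_bound[OF vs_HH w.vs_Hom restricted_pairing_lin[OF order_refl] sK m.subsp_Hom hV(1)])
    show "restricted_pairing ?M ` K \<subseteq> m.Hom ?V"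
    proof clarify
      fix \<psi> assume "\<psi> \<in> K"
      then have c: "\<psi> \<in> colinear" by (rule Kc)
      show "restricted_pairing ?M \<psi> \<in> m.Hom ?V"
        by (rule restricted_pairing_Hom[OF mM order_refl])
          (use c in \<open>auto simp: preimage_def pairing_colinear X_def\<close>)
    qed
    fix \<psi> assume \<psi>: "\<psi> \<in> K" and 0: "restricted_pairing ?M \<psi> = 0"
    have l: "lin sH sH \<psi>" using \<psi> by (simp add: K_def Lin_def)
    have "\<psi> y = 0" for y
      using fun_cong[OF 0, of "embed y"] by (simp add: restricted_pairing_def embed_Lin pairing_embed[OF l])
    then show "\<psi> = 0" by (simp add: fun_eq_iff)
  qed
  let ?k = "dm (fun_scale sH) K" and ?h = "dm w.sHom (w.Hom {0})"
  have dM: "dm sUU ?M = ?n * ?\<D>" by (rule Lin_dim(2)[OF vs_U subsp_D fdim_D])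
  have "?\<D> * (?n * ?n) \<le> ?\<D> * ?k + ?\<D> * ?h" using mult_le_mono2[OF 1, of ?\<D>] by (simp only: add_mult_distrib2)
  moreover have "?\<D> * ?h \<le> ?n * dm sUU ?W" using h0(2) by simp
  moreover have "?n * dm sUU ?W + ?n * ?n = ?\<D> * (?n * ?n) + ?n * dm sH I"
    using arg_cong[OF W(4), of "\<lambda>x. ?n * x"] by (simp add: algebra_simps)
  moreover have "?\<D> * ?k \<le> ?\<D> * dm m.sHom (m.Hom ?V)" by (rule mult_le_mono2[OF 2])
  moreover have "?\<D> * dm m.sHom (m.Hom ?V) + ?n * dm sUU ?V \<le> ?\<D> * (?n * ?n)"
    using hV(2) unfolding dM by (simp add: ac_simps)
  moreover have "?n * dm sUU ?V + ?n * ?n = ?\<D> * (?n * ?n) + ?n * dm sH X"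
    using arg_cong[OF V(4), of "\<lambda>x. ?n * x"] by (simp add: algebra_simps)
  ultimately have "?n * dm sH X \<le> ?n * dm sH I" by linarith
  then show False using less card_B_pos by simp
qed

definition integrals :: "('h \<Rightarrow> 'k) set"
  where "integrals = {\<Gamma> \<in> D. \<forall>d\<in>D. \<forall>x. conv d \<Gamma> x = d 1 * \<Gamma> x}"

text \<open>The translates are taken by \<open>S g\<close> because this is what the translation
  elements of the extension produce; as \<open>S\<close> is onto, all translates are
  included.\<close>

definition integral_span :: "('h \<Rightarrow> 'k) set"
  where "integral_span = module.span sU {\<lambda>x. \<Gamma> (x * S g) | \<Gamma> g. \<Gamma> \<in> integrals}"

lemma sw_swap: "sw (\<lambda>a b. sw (G a b) x) y = sw (\<lambda>c d. sw (\<lambda>a b. G a b c d) y) x"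
  unfolding sweedler_def by (rule sum.swap)

text \<open>Expand \<open>d(1) \<Lambda>(z q) = d(z_1 q_1) \<Lambda>(z_2 q_2)\<close> at
  \<open>z = \<phi>(x S p)\<close>. The functional \<open>d(_ * q_1)\<close> lies in
  \<open>D\<close>, so it passes through \<open>\<phi>\<close> and becomes
  \<open>d(x_1 S(p_2) q_1)\<close>, where the antipode cancels. For \<open>I = 0\<close> and
  \<open>\<phi>\<close> the identity, the integral obtained is
  \<open>\<epsilon>(y) \<Lambda>\<close>.\<close>

lemma colinear_integral:
  assumes \<phi>: "\<phi> \<in> colinear"
  shows "(\<lambda>x. sw (\<lambda>p q. \<Lambda> (\<phi> (x * S p) * q)) y) \<in> integrals"
  unfolding integrals_def
proof (intro CollectI conjI ballI allI)
  have lf: "lin sH sH \<phi>" and I: "\<And>x. x \<in> I \<Longrightarrow> \<phi> x = 0" and c: "\<And>d x. d \<in> D \<Longrightarrow> \<phi> (R d x) = R d (\<phi> x)"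
    using \<phi> by (auto simp: colinear_def)
  note rules = lin_rules lin_compose[OF integral_lin] lin_compose[OF lf]
  let ?G = "\<lambda>x. sw (\<lambda>p q. \<Lambda> (\<phi> (x * S p) * q)) y"
  have "lin sH (*) ?G" by (intro rules)
  then show "?G \<in> D" by (simp add: D_def I I_mult sweedler_def lin_0[OF integral_lin])
  fix d x assume d: "d \<in> D"
  note rules = rules lin_compose[OF D_lin[OF d]] lin_compose[OF R_lin]
  have ld: "lin sH (*) (\<lambda>z. d (z * r))" for r by (intro rules)
  have "d 1 * ?G x = sw (\<lambda>p q. conv d \<Lambda> (\<phi> (x * S p) * q)) y"
    by (simp add: integral[OF D_lin[OF d]] lin_of_sw[OF lin_kmult_right[OF lin_id]])
  also have "\<dots> = sw (\<lambda>p q. sw (\<lambda>q1 q2. \<Lambda> (R (\<lambda>z. d (z * q1)) (\<phi> (x * S p)) * q2)) q) y"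
  proof -
    have "conv d \<Lambda> (z * q) = sw (\<lambda>q1 q2. \<Lambda> (R (\<lambda>z. d (z * q1)) z * q2)) q" for z q
    proof -
      have b: "bilin sH sH (*) (\<lambda>a b. d a * \<Lambda> b)" by (intro rules)
      have "conv d \<Lambda> (z * q) = sw (\<lambda>z1 z2. sw (\<lambda>q1 q2. d (z1 * q1) * \<Lambda> (z2 * q2)) q) z"
        unfolding conv_def by (rule sw_mult[OF b vector_space_field])
      also have "\<dots> = sw (\<lambda>q1 q2. sw (\<lambda>z1 z2. d (z1 * q1) * \<Lambda> (z2 * q2)) z) q"
        unfolding sweedler_def by (rule sum.swap)
      also have "\<dots> = sw (\<lambda>q1 q2. \<Lambda> (R (\<lambda>z. d (z * q1)) z * q2)) q"
        unfolding R_def by (subst lin_of_sw[of sH "(*)" "\<lambda>z. \<Lambda> (z * _)"]; (intro rules)?)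
          (simp add: A.scale_mult_left lin_scale[OF integral_lin])
      finally show ?thesis .
    qed
    then show ?thesis by simp
  qed
  also have "\<dots> = sw (\<lambda>p q. sw (\<lambda>q1 q2. \<Lambda> (\<phi> (R (\<lambda>z. d (z * q1)) (x * S p)) * q2)) q) y"
    by (simp add: c[OF D_translate[OF d]])
  also have "\<dots> = sw (\<lambda>p q. sw (\<lambda>q1 q2. \<Lambda> (\<phi> (sw (\<lambda>x1 x2. sw (\<lambda>s t. sH (d (x1 * S t * q1)) (x2 * S s)) p) x) * q2)) q) y"
  proof -
    have "R (\<lambda>z. d (z * q1)) (x * S p) = sw (\<lambda>x1 x2. sw (\<lambda>s t. sH (d (x1 * S t * q1)) (x2 * S s)) p) x" for q1 p
    proof -
      have b: "bilin sH sH sH (\<lambda>a b. sH (d (a * q1)) b)" by (intro rules)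
      show ?thesis
        unfolding R_def sw_mult[OF b vs_H]
        by (subst antipode_anticomult[OF vs_H]; (intro rules)?) (rule refl)
    qed
    then show ?thesis by simp
  qed
  also have "\<dots> = sw (\<lambda>x1 x2. sw (\<lambda>p q. sw (\<lambda>q1 q2. sw (\<lambda>s t. d (x1 * (S t * q1)) * \<Lambda> (\<phi> (x2 * S s) * q2)) p) q) y) x"
  proof -
    have "\<Lambda> (\<phi> (sw (\<lambda>x1 x2. sw (\<lambda>s t. sH (d (x1 * S t * q1)) (x2 * S s)) p) x) * q2)
      = sw (\<lambda>x1 x2. sw (\<lambda>s t. d (x1 * (S t * q1)) * \<Lambda> (\<phi> (x2 * S s) * q2)) p) x" for q1 q2 p
    proof -
      have l: "lin sH (*) (\<lambda>z. \<Lambda> (\<phi> z * q2))" by (intro rules)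
      show ?thesis
        by (simp add: lin_of_sw[OF l] lin_scale[OF l] mult.assoc)
    qed
    then show ?thesis by (simp only: sw_swap[where x = x])
  qed
  also have "\<dots> = sw (\<lambda>x1 x2. d x1 * sw (\<lambda>s q. \<Lambda> (\<phi> (x2 * S s) * q)) y) x"
  proof -
    have "sw (\<lambda>p q. sw (\<lambda>q1 q2. sw (\<lambda>s t. d (x1 * (S t * q1)) * \<Lambda> (\<phi> (x2 * S s) * q2)) p) q) y
        = d x1 * sw (\<lambda>s q. \<Lambda> (\<phi> (x2 * S s) * q)) y" for x1 x2
    proof -
      have "sw (\<lambda>p q. sw (\<lambda>q1 q2. sw (\<lambda>s t. d (x1 * (S t * q1)) * \<Lambda> (\<phi> (x2 * S s) * q2)) p) q) y
          = sw (\<lambda>p q2. sw (\<lambda>p q1. sw (\<lambda>s t. d (x1 * (S t * q1)) * \<Lambda> (\<phi> (x2 * S s) * q2)) p) p) y"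
        by (rule coassoc[OF vector_space_field, symmetric]; intro rules)
      also have "\<dots> = sw (\<lambda>p q2. sw (\<lambda>s r. sw (\<lambda>t q1. d (x1 * (S t * q1)) * \<Lambda> (\<phi> (x2 * S s) * q2)) r) p) y"
        by (subst coassoc[OF vector_space_field]; (intro rules)?) (rule refl)
      also have "\<dots> = sw (\<lambda>p q2. sw (\<lambda>s r. \<epsilon> r * (d (x1 * 1) * \<Lambda> (\<phi> (x2 * S s) * q2))) p) y"
        by (subst sw_antipode_left[of "(*)" "\<lambda>z. d (x1 * z) * \<Lambda> (\<phi> (x2 * S _) * _)"]; (intro rules)?) (rule refl)
      also have "\<dots> = sw (\<lambda>p q2. d (x1 * 1) * \<Lambda> (\<phi> (x2 * S p) * q2)) y"
        by (subst sw_counit_right[of "(*)" "\<lambda>z. d (x1 * 1) * \<Lambda> (\<phi> (x2 * S z) * _)"]; (intro rules)?) (rule refl)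
      finally show ?thesis by (simp add: sweedler_def sum_distrib_left)
    qed
    then show ?thesis by simp
  qed
  also have "\<dots> = conv d ?G x" by (simp add: conv_def)
  finally show "conv d ?G x = d 1 * ?G x" by simp
qed

text \<open>With \<open>u = \<Lambda>(_ * w)\<close>, inserting \<open>w_1 S(w_2)\<close> gives
  \<open>u(\<phi> x) = \<Lambda>(\<phi>(x w_1 S(w_2)) w_3)\<close>. This is a sum of the integrals
  of \<open>colinear_integral\<close> translated by \<open>w_1\<close>, which is written as some
  \<open>S g\<close>.\<close>

lemma colinear_in_integral_span:
  assumes \<phi>: "\<phi> \<in> colinear" and u: "lin sH (*) u"
  shows "(\<lambda>x. u (\<phi> x)) \<in> integral_span"
proof -
  interpret U: vector_space sU by (rule vs_U)
  have lf: "lin sH sH \<phi>" using \<phi> by (simp add: colinear_def)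
  note rules = lin_rules lin_compose[OF integral_lin] lin_compose[OF lf]
  obtain w where w: "\<And>x. u x = \<Lambda> (x * w)" using integral_represents[OF u] by metis
  let ?G = "\<lambda>y x. sw (\<lambda>p q. \<Lambda> (\<phi> (x * S p) * q)) y"
  have "u (\<phi> x) = sw (\<lambda>a y. ?G y (x * a)) w" for x
  proof -
    have "u (\<phi> x) = sw (\<lambda>z q. \<epsilon> z * \<Lambda> (\<phi> (x * 1) * q)) w"
      unfolding w by (subst sw_counit_left; (intro rules)?) simp
    also have "\<dots> = sw (\<lambda>z q. sw (\<lambda>a p. \<Lambda> (\<phi> (x * (a * S p)) * q)) z) w"
      by (subst sw_antipode_right[of "(*)" "\<lambda>z. \<Lambda> (\<phi> (x * z) * _)"]; (intro rules)?) (rule refl)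
    also have "\<dots> = sw (\<lambda>a y. sw (\<lambda>p q. \<Lambda> (\<phi> (x * (a * S p)) * q)) y) w"
      by (rule coassoc[OF vector_space_field]; intro rules)
    finally show ?thesis by (simp add: mult.assoc)
  qed
  then have "(\<lambda>x. u (\<phi> x)) = (\<Sum>y\<in>B. (\<lambda>x. ?G y (x * comp y w)))"
    by (simp add: fun_eq_iff sum_fun_apply sweedler_def[of _ _ _ _ _ w])
  also have "\<dots> \<in> integral_span"
    unfolding integral_span_def
  proof (rule U.span_sum)
    fix y assume "y \<in> B"
    obtain g where g: "comp y w = S g" using antipode_surj by (metis surjD)
    show "(\<lambda>x. ?G y (x * comp y w)) \<in> U.span {\<lambda>x. \<Gamma> (x * S g) | \<Gamma> g. \<Gamma> \<in> integrals}"
      unfolding g by (intro U.span_base CollectI exI[of _ "?G y"] exI[of _ g] conjI refl colinear_integral[OF \<phi>])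
  qed
  finally show ?thesis .
qed

text \<open>Otherwise some functional separates \<open>\<epsilon>\<close> from the span, and on
  linear forms it is evaluation at the point \<open>?x\<close> of \<open>H\<close>. All coordinates
  of \<open>\<phi> ?x\<close> vanish for colinear \<open>\<phi>\<close>, so \<open>?x\<close> lies
  in \<open>I\<close>, where \<open>\<epsilon>\<close> is zero.\<close>

lemma counit_in_integral_span: "\<epsilon> \<in> integral_span"
proof (rule ccontr)
  assume n: "\<epsilon> \<notin> integral_span"
  interpret U: vector_space sU by (rule vs_U)
  have "U.subspace integral_span" unfolding integral_span_def by (rule U.subspace_span)
  then obtain ev where l: "Vector_Spaces.linear sU (*) ev" "\<And>f. f \<in> integral_span \<Longrightarrow> ev f = 0" "ev \<epsilon> = 1"
    using U.separating_functional[OF _ n] by metis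
  let ?x = "\<Sum>b\<in>B. sH (ev (co b)) b"
  have ev_x: "f ?x = ev f" if f: "lin sH (*) f" for f
  proof -
    have "f = (\<Sum>b\<in>B. sU (f b) (co b))"
      by (rule ext, subst lin_expand[OF f]) (simp add: sum_fun_apply fun_scale_def mult.commute)
    then have "ev f = ev (\<Sum>b\<in>B. sU (f b) (co b))" by simp
    also have "\<dots> = (\<Sum>b\<in>B. f b * ev (co b))"
      by (simp only: lin_sum[OF lin_of_linear[OF l(1)]] lin_scale[OF lin_of_linear[OF l(1)]])
    finally show ?thesis by (simp add: lin_sum[OF f] lin_scale[OF f] mult.commute)
  qed
  have "?x \<in> I"
  proof (rule colinear_separates, rule eq_if_coordinates)
    fix \<phi> b assume \<phi>: "\<phi> \<in> colinear"
    then have "lin sH sH \<phi>" by (simp add: colinear_def)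
    from ev_x[OF lin_compose[OF co_lin this]] l(2)[OF colinear_in_integral_span[OF \<phi> co_lin]]
    show "co b (\<phi> ?x) = co b 0" by (simp add: lin_0[OF co_lin])
  qed
  then show False using I_counit[of ?x] ev_x[OF counit_lin] l(3) by simp
qed

end

section \<open>Tensor products with a quotient\<close>

lemma tensor_rels_add_left: "y \<in> Y \<Longrightarrow> frag_of (x + x', y) - frag_of (x, y) - frag_of (x', y) \<in> tensor_rels r S l Y"
  and tensor_rels_add_right: "y \<in> Y \<Longrightarrow> y' \<in> Y \<Longrightarrow> frag_of (x, y + y') - frag_of (x, y) - frag_of (x, y') \<in> tensor_rels r S l Y"
  and tensor_rels_scale: "s \<in> S \<Longrightarrow> y \<in> Y \<Longrightarrow> frag_of (r x s, y) - frag_of (x, l s y) \<in> tensor_rels r S l Y"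
  unfolding tensor_rels_def by (rule frag_span_base; blast)+

lemma frag_subgroup_uminus: "frag_subgroup R \<Longrightarrow> - x \<in> R \<longleftrightarrow> x \<in> R"
  using frag_subgroup_diff[of R 0 x] frag_subgroup_diff[of R 0 "- x"] frag_subgroup_zero[of R] by auto

lemma tensor_rels_zero_left: "y \<in> Y \<Longrightarrow> frag_of (0 :: 'x::monoid_add, y) \<in> tensor_rels r S l Y"
  using tensor_rels_add_left[of y Y 0 0 r S l] by (simp add: frag_subgroup_uminus)

lemma tensor_rels_zero_right: "0 \<in> Y \<Longrightarrow> frag_of (x, 0 :: 'y::monoid_add) \<in> tensor_rels r S l Y"
  using tensor_rels_add_right[of 0 Y 0 x r S l] by (simp add: frag_subgroup_uminus)

lemma frag_extend_diff_fun: "frag_extend (\<lambda>p. f p - g p) c = frag_extend f c - frag_extend g c"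
  using subset_UNIV by (induction c rule: frag_induction) (simp_all add: frag_extend_diff)

lemma frag_extend_add_fun: "frag_extend (\<lambda>p. f p + g p) c = frag_extend f c + frag_extend g c"
  using subset_UNIV by (induction c rule: frag_induction) (simp_all add: frag_extend_diff)

lemma frag_extend_mem:
  assumes R: "frag_subgroup R" and f: "\<And>p. p \<in> Poly_Mapping.keys c \<Longrightarrow> f p \<in> R"
  shows "frag_extend f c \<in> R"
proof -
  have "Poly_Mapping.keys c \<subseteq> {p. f p \<in> R}" using f by blast
  then show ?thesis
    by (induction c rule: frag_induction)
      (simp_all add: frag_subgroup_zero[OF R] frag_extend_diff frag_subgroup_diff[OF R])
qed

lemma frag_extend_cong_mod:
  "frag_subgroup R \<Longrightarrow> (\<And>p. p \<in> Poly_Mapping.keys c \<Longrightarrow> f p - g p \<in> R) \<Longrightarrow>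
    frag_extend f c - frag_extend g c \<in> R"
  unfolding frag_extend_diff_fun[symmetric] by (rule frag_extend_mem)

lemma frag_extend_swap:
  "frag_extend (\<lambda>p. frag_extend (f p) e) c = frag_extend (\<lambda>q. frag_extend (\<lambda>p. f p q) c) e"
  using subset_UNIV
  by (induction c rule: frag_induction) (simp_all add: frag_extend_eq_0 frag_extend_diff frag_extend_diff_fun)

lemma frag_of_diff_left:
  fixes x :: "'x::ab_group_add"
  assumes "y \<in> Y"
  shows "frag_of (x - x', y) - (frag_of (x, y) - frag_of (x', y)) \<in> tensor_rels r S l Y"
proof -
  have "- (frag_of (x - x' + x', y) - frag_of (x - x', y) - frag_of (x', y)) \<in> tensor_rels r S l Y"
    using tensor_rels_add_left[OF assms] by (simp only: frag_subgroup_uminus[OF frag_subgroup_tensor_rels])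
  then show ?thesis by (simp add: algebra_simps)
qed

lemma frag_of_diff_right:
  fixes y :: "'y::ab_group_add"
  shows "frag_of (x, y - y') - (frag_of (x, y) - frag_of (x, y')) \<in> tensor_rels r S l UNIV"
proof -
  have "- (frag_of (x, y - y' + y') - frag_of (x, y - y') - frag_of (x, y')) \<in> tensor_rels r S l UNIV"
    using tensor_rels_add_right[OF UNIV_I UNIV_I] by (simp only: frag_subgroup_uminus[OF frag_subgroup_tensor_rels])
  then show ?thesis by (simp add: algebra_simps)
qed

text \<open>Modulo the relations, a sum inside one leg may be taken out as a formal sum of pure
  tensors; this passes between ring values and representatives.\<close>

lemma frag_of_frag_eval_left:
  fixes f :: "'p \<Rightarrow> 'x::ring_1"
  assumes y: "y \<in> Y"
  shows "frag_of (frag_eval f c, y) - frag_extend (\<lambda>p. frag_of (f p, y)) c \<in> tensor_rels r S l Y"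
  using subset_UNIV
proof (induction c rule: frag_induction)
  case zero then show ?case using tensor_rels_zero_left[OF y] by simp
next
  case (one p) then show ?case by (simp add: frag_subgroup_zero)
next
  case (diff a b)
  note s = frag_subgroup_tensor_rels[of r S l Y]
  from frag_subgroup_add[OF s frag_of_diff_left[OF y, of "frag_eval f a" "frag_eval f b"] frag_subgroup_diff[OF s diff]]
  show ?case by (simp add: frag_eval_diff frag_extend_diff algebra_simps)
qed

lemma frag_of_frag_eval_right:
  fixes f :: "'p \<Rightarrow> 'y::ring_1"
  shows "frag_of (x, frag_eval f c) - frag_extend (\<lambda>p. frag_of (x, f p)) c \<in> tensor_rels r S l UNIV"
  using subset_UNIV
proof (induction c rule: frag_induction)
  case zero then show ?case using tensor_rels_zero_right[OF UNIV_I] by simp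
next
  case (one p) then show ?case by (simp add: frag_subgroup_zero)
next
  case (diff a b)
  note s = frag_subgroup_tensor_rels[of r S l UNIV]
  from frag_subgroup_add[OF s frag_of_diff_right[of x "frag_eval f a" "frag_eval f b"] frag_subgroup_diff[OF s diff]]
  show ?case by (simp add: frag_eval_diff frag_extend_diff algebra_simps)
qed

lemma frag_of_sum_right:
  fixes f :: "'i \<Rightarrow> 'y::ab_group_add"
  shows "frag_of (x, \<Sum>i\<in>X. f i) - (\<Sum>i\<in>X. frag_of (x, f i)) \<in> tensor_rels r S l UNIV"
proof (induction X rule: infinite_finite_induct)
  case (insert i X)
  from frag_subgroup_add[OF frag_subgroup_tensor_rels tensor_rels_add_right[OF UNIV_I UNIV_I, of x "f i" "sum f X"] insert.IH]
  show ?case using insert.hyps by (simp add: algebra_simps)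
qed (simp_all add: tensor_rels_zero_right)

context k_algebra
begin

context
  fixes I :: "'a set" assumes I: "subspace I"
begin

lemma zero_in_coset: "h \<in> h +o I"
  using subspace_0[OF I] by (force simp: elt_set_plus_def)

lemma quot_coset_eq_iff: "g +o I = h +o I \<longleftrightarrow> g - h \<in> I"
proof
  assume "g +o I = h +o I"
  then show "g - h \<in> I" using zero_in_coset[of g] by (auto simp: elt_set_plus_def)
next
  assume gh: "g - h \<in> I"
  have *: "x +o I \<subseteq> y +o I" if "x - y \<in> I" for x y
  proof
    fix z assume "z \<in> x +o I"
    then obtain i where "i \<in> I" "z = y + ((x - y) + i)" by (auto simp: elt_set_plus_def)
    then show "z \<in> y +o I" unfolding elt_set_plus_def using subspace_add[OF I that] by blast
  qed
  have "h - g \<in> I" using subspace_neg[OF I gh] by simp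
  then show "g +o I = h +o I" using * gh by blast
qed

lemma quot_proj_eq: "quot_proj (quotient_space I) h = h +o I"
  unfolding quot_proj_def
proof (rule the_equality)
  show "h +o I \<in> quotient_space I \<and> h \<in> h +o I"
    by (simp add: quotient_space_def zero_in_coset)
  fix X assume "X \<in> quotient_space I \<and> h \<in> X"
  then obtain g where "X = g +o I" "h - g \<in> I" by (auto simp: quotient_space_def elt_set_plus_def)
  then show "X = h +o I" using quot_coset_eq_iff[of h g] by simp
qed

lemma quot_scale_eq: "quot_scale scale (quotient_space I) c (h +o I) = scale c h +o I"
  unfolding quot_scale_def
proof (rule the_equality)
  show "scale c h +o I \<in> quotient_space I \<and> scale c ` (h +o I) \<subseteq> scale c h +o I"
    using subspace_scale[OF I] by (auto simp: quotient_space_def elt_set_plus_def scale_right_distrib)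
  fix Y assume Y: "Y \<in> quotient_space I \<and> scale c ` (h +o I) \<subseteq> Y"
  then have "scale c h \<in> Y" using zero_in_coset by blast
  moreover obtain g where g: "Y = g +o I" using Y by (auto simp: quotient_space_def)
  ultimately have "scale c h - g \<in> I" by (auto simp: elt_set_plus_def)
  then show "Y = scale c h +o I" using g quot_coset_eq_iff[of "scale c h" g] by simp
qed

lemma coset_plus_coset: "(g +o I) + (h +o I) = (g + h) +o I"
proof (intro equalityI subsetI)
  fix x assume "x \<in> (g +o I) + (h +o I)"
  then obtain i j where "i \<in> I" "j \<in> I" "x = (g + i) + (h + j)" by (auto simp: elt_set_plus_def set_plus_def)
  then have "x = (g + h) + (i + j)" "i + j \<in> I" by (simp_all add: subspace_add[OF I])
  then show "x \<in> (g + h) +o I" unfolding elt_set_plus_def by blast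
next
  fix x assume "x \<in> (g + h) +o I"
  then obtain i where "i \<in> I" "x = g + (h + i)" by (auto simp: elt_set_plus_def add.assoc)
  then show "x \<in> (g +o I) + (h +o I)"
    unfolding set_plus_def using zero_in_coset[of g] by (auto simp: elt_set_plus_def)
qed

lemma quotient_space_cases: "X \<in> quotient_space I \<longleftrightarrow> (\<exists>h. X = h +o I)"
  by (auto simp: quotient_space_def)

lemma some_in_coset: "(SOME g. g \<in> h +o I) - h \<in> I"
proof -
  have "(SOME g. g \<in> h +o I) \<in> h +o I" by (rule someI[of "\<lambda>g. g \<in> h +o I", OF zero_in_coset])
  then show ?thesis by (auto simp: elt_set_plus_def)
qed

lemma quot_proj_some: "X \<in> quotient_space I \<Longrightarrow> quot_proj (quotient_space I) (SOME g. g \<in> X) = X"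
proof -
  assume "X \<in> quotient_space I"
  then obtain h where X: "X = h +o I" by (auto simp: quotient_space_cases)
  show ?thesis by (simp add: X quot_proj_eq quot_coset_eq_iff some_in_coset)
qed

text \<open>A functional on the quotient is evaluated through an arbitrary member of the coset,
  without constructing a quotient type.\<close>

lemma lin_some:
  fixes d :: "'a \<Rightarrow> 'c::ab_group_add"
  assumes d: "lin scale t d" "\<And>x. x \<in> I \<Longrightarrow> d x = 0"
  shows "d (SOME g. g \<in> h +o I) = d h"
  using d(2)[OF some_in_coset, of h] by (simp add: lin_diff[OF d(1)])

end

end

locale vector_pair = A: k_algebra sA + H: k_algebra sH
  for sA :: "'k::field \<Rightarrow> 'a::ring_1 \<Rightarrow> 'a" and sH :: "'k \<Rightarrow> 'h::ring_1 \<Rightarrow> 'h" +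
  fixes I :: "'h set"
  assumes I: "module.subspace sH I"
begin

abbreviation "Q \<equiv> quotient_space I"

definition push :: "('a \<times> 'h \<Rightarrow>\<^sub>0 int) \<Rightarrow> ('a \<times> 'h set \<Rightarrow>\<^sub>0 int)"
  where "push = frag_extend (\<lambda>(x, h). frag_of (x, quot_proj Q h))"

lemma quot_proj_in: "quot_proj Q h \<in> Q"
  by (subst H.quot_proj_eq[OF I]) (simp add: quotient_space_def)

lemma push_rels: "c \<in> ktensor_rels sA sH \<Longrightarrow> push c \<in> qtensor_rels sA sH Q"
  unfolding tensor_rels_def[of "\<lambda>x c. sA c x" UNIV sH] tensor_rels_def[of _ _ "quot_scale sH Q"] push_def
proof (erule frag_extend_span, fold tensor_rels_def)
  fix x :: "'a \<times> 'h \<Rightarrow>\<^sub>0 int"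
  assume x: "x \<in> {frag_of (x + x', y) - frag_of (x, y) - frag_of (x', y) | x x' y. y \<in> UNIV} \<union>
    {frag_of (x, y + y') - frag_of (x, y) - frag_of (x, y') | x y y'. y \<in> UNIV \<and> y' \<in> UNIV} \<union>
    {frag_of (sA s x, y) - frag_of (x, sH s y) | x s y. s \<in> UNIV \<and> y \<in> UNIV}"
  have add: "quot_proj Q (y + y') = quot_proj Q y + quot_proj Q y'" for y y'
    by (simp add: H.quot_proj_eq[OF I] H.coset_plus_coset[OF I])
  have sc: "quot_proj Q (sH s y) = quot_scale sH Q s (quot_proj Q y)" for s y
    by (simp add: H.quot_proj_eq[OF I] H.quot_scale_eq[OF I])
  from x consider (1) a a' y where "x = frag_of (a + a', y) - frag_of (a, y) - frag_of (a', y)"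
    | (2) a y y' where "x = frag_of (a, y + y') - frag_of (a, y) - frag_of (a, y')"
    | (3) s a y where "x = frag_of (sA s a, y) - frag_of (a, sH s y)" by blast
  then show "frag_extend (\<lambda>(x, h). frag_of (x, quot_proj Q h)) x \<in> qtensor_rels sA sH Q"
  proof cases
    case 1
    then show ?thesis by (simp add: frag_extend_diff tensor_rels_add_left quot_proj_in)
  next
    case 2
    then show ?thesis by (simp add: frag_extend_diff add tensor_rels_add_right quot_proj_in)
  next
    case 3
    then show ?thesis
      using tensor_rels_scale[of s UNIV "quot_proj Q y" Q "\<lambda>x c. sA c x" a "quot_scale sH Q"]
      by (simp add: frag_extend_diff sc quot_proj_in)
  qed
qed

lemma frag_of_expand:
  assumes B: "finite B" "\<not> module.dependent sH B" "module.span sH B = UNIV"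
  shows "c - (\<Sum>b\<in>B. frag_of (frag_eval (\<lambda>(x, h). sA (module.representation sH B h b) x) c, b)) \<in> ktensor_rels sA sH"
  using subset_UNIV
proof (induction c rule: frag_induction)
  case zero
  have "(\<Sum>b\<in>B. frag_of (0 :: 'a, b)) \<in> ktensor_rels sA sH"
    by (rule frag_subgroup_sum) (simp_all add: tensor_rels_zero_left)
  then show ?case by (simp add: frag_subgroup_uminus)
next
  case (one p)
  obtain x h where p: "p = (x, h)" by (cases p)
  let ?co = "\<lambda>b. module.representation sH B h b"
  have "(\<Sum>b\<in>B. sH (?co b) b) = h"
    by (rule H.sum_representation_eq[OF B(2) _ B(1) order_refl]) (simp add: B(3))
  then have "frag_of (x, h) - (\<Sum>b\<in>B. frag_of (x, sH (?co b) b)) \<in> ktensor_rels sA sH"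
    using frag_of_sum_right[of x "\<lambda>b. sH (?co b) b" B] by simp
  moreover have "(\<Sum>b\<in>B. frag_of (sA (?co b) x, b) - frag_of (x, sH (?co b) b)) \<in> ktensor_rels sA sH"
    by (rule frag_subgroup_sum) (simp_all add: tensor_rels_scale[where r = "\<lambda>x c. sA c x"])
  ultimately have "(frag_of (x, h) - (\<Sum>b\<in>B. frag_of (x, sH (?co b) b)))
     - (\<Sum>b\<in>B. frag_of (sA (?co b) x, b) - frag_of (x, sH (?co b) b)) \<in> ktensor_rels sA sH"
    by (rule frag_subgroup_diff[OF frag_subgroup_tensor_rels])
  then show ?case by (simp add: p sum_subtractf)
next
  case (diff a b)
  note s = frag_subgroup_tensor_rels[of "\<lambda>x c. sA c x" UNIV sH UNIV]
  let ?e = "\<lambda>c b. frag_eval (\<lambda>(x, h). sA (module.representation sH B h b) x) c"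
  have "(\<Sum>i\<in>B. frag_of (?e a i - ?e b i, i) - (frag_of (?e a i, i) - frag_of (?e b i, i))) \<in> ktensor_rels sA sH"
    by (rule frag_subgroup_sum[OF s]) (simp add: frag_of_diff_left)
  from frag_subgroup_diff[OF s frag_subgroup_diff[OF s diff] this]
  show ?case by (simp add: frag_eval_diff sum_subtractf sum.distrib algebra_simps)
qed

lemma push_lift:
  assumes "Poly_Mapping.keys c \<subseteq> UNIV \<times> Q"
  shows "push (frag_extend (\<lambda>(x, X). frag_of (x, SOME h. h \<in> X)) c) = c"
proof -
  have "push (frag_extend (\<lambda>(x, X). frag_of (x, SOME h. h \<in> X)) c)
      = frag_extend (\<lambda>(x, X). frag_of (x, quot_proj Q (SOME h. h \<in> X))) c"
    using frag_extend_compose[of "\<lambda>(x, h). frag_of (x, quot_proj Q h)" "\<lambda>(x, X). (x, SOME h. h \<in> X)" c]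
    by (simp add: push_def comp_def case_prod_unfold)
  also have "\<dots> = frag_extend frag_of c"
    by (rule frag_extend_eq) (use assms in \<open>auto simp: H.quot_proj_some[OF I]\<close>)
  finally show ?thesis by (simp add: frag_expansion[symmetric])
qed

text \<open>A tensor in \<open>X \<otimes> H/I\<close> is determined by the functionals on \<open>H\<close> that vanish on \<open>I\<close>, as a basis
  of \<open>H\<close> that extends one of \<open>I\<close> shows.\<close>

lemma qtensor_rels_iff:
  assumes fd: "finite_dimensional_vector_space sH B0" and c: "Poly_Mapping.keys c \<subseteq> UNIV \<times> Q"
  shows "c \<in> qtensor_rels sA sH Q \<longleftrightarrow>
    (\<forall>d. lin sH (*) d \<longrightarrow> (\<forall>x\<in>I. d x = 0) \<longrightarrow> frag_eval (\<lambda>(x, X). sA (d (SOME h. h \<in> X)) x) c = 0)"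
proof (intro iffI allI impI)
  fix d assume "c \<in> qtensor_rels sA sH Q" and d: "lin sH (*) d" "\<forall>x\<in>I. d x = 0"
  note some = H.lin_some[OF I d(1) bspec[OF d(2)]]
  from \<open>c \<in> qtensor_rels sA sH Q\<close>
  show "frag_eval (\<lambda>(x, X). sA (d (SOME h. h \<in> X)) x) c = 0"
  proof (rule frag_eval_tensor_rels)
    fix x y y' s assume y: "y \<in> Q" then obtain h where h: "y = h +o I" by (auto simp: quotient_space_def)
    show "sA (d (SOME h. h \<in> y)) (sA s x) = sA (d (SOME h. h \<in> quot_scale sH Q s y)) x"
      by (simp add: h H.quot_scale_eq[OF I] some lin_scale[OF d(1)] mult.commute)
    assume "y' \<in> Q" then obtain h' where h': "y' = h' +o I" by (auto simp: quotient_space_def)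
    show "sA (d (SOME h. h \<in> y + y')) x = sA (d (SOME h. h \<in> y)) x + sA (d (SOME h. h \<in> y')) x"
      by (simp add: h h' H.coset_plus_coset[OF I] some lin_add[OF d(1)] A.scale_left_distrib)
  qed (simp add: A.scale_right_distrib)
next
  assume 0: "\<forall>d. lin sH (*) d \<longrightarrow> (\<forall>x\<in>I. d x = 0) \<longrightarrow> frag_eval (\<lambda>(x, X). sA (d (SOME h. h \<in> X)) x) c = 0"
  obtain C where C: "C \<subseteq> I" "\<not> H.dependent C" "I \<subseteq> H.span C" "card C = H.dim I"
    by (rule H.basis_exists)
  obtain B where B: "C \<subseteq> B" "B \<subseteq> UNIV" "\<not> H.dependent B" "UNIV \<subseteq> H.span B"
    by (rule H.maximal_independent_subset_extend[OF subset_UNIV C(2)])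
  have fB: "finite B" using finite_dimensional_vector_space.finiteI_independent[OF fd B(3)] .
  have spB: "H.span B = UNIV" using B(4) by blast
  let ?c = "frag_extend (\<lambda>(x, X). frag_of (x, SOME h. h \<in> X)) c"
  let ?e = "\<lambda>b. frag_eval (\<lambda>(x, h). sA (H.representation B h b) x) ?c"
  have "push (?c - (\<Sum>b\<in>B. frag_of (?e b, b))) \<in> qtensor_rels sA sH Q"
    by (rule push_rels[OF frag_of_expand[OF fB B(3) spB]])
  moreover have "push (?c - (\<Sum>b\<in>B. frag_of (?e b, b))) = c - (\<Sum>b\<in>B. frag_of (?e b, quot_proj Q b))"
    using push_lift[OF c] by (simp add: push_def frag_extend_diff frag_extend_sum[OF fB])
  \<comment> \<open>Basis vectors in \<open>C\<close> become zero in the quotient. For any other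
    \<open>b\<close> the coordinate form of \<open>b\<close> vanishes on \<open>I\<close>, so the
    hypothesis applies to it and makes the first leg zero.\<close>
  moreover have "(\<Sum>b\<in>B. frag_of (?e b, quot_proj Q b)) \<in> qtensor_rels sA sH Q"
  proof (rule frag_subgroup_sum[OF frag_subgroup_tensor_rels])
    fix b assume b: "b \<in> B"
    show "frag_of (?e b, quot_proj Q b) \<in> qtensor_rels sA sH Q"
    proof (cases "b \<in> C")
      case True
      then have "quot_proj Q b = 0 +o I"
        using C(1) by (simp only: H.quot_proj_eq[OF I] H.quot_coset_eq_iff[OF I]) auto
      moreover have "(0 +o I) + (0 +o I) = 0 +o I" using H.coset_plus_coset[OF I, of 0 0] by simp
      moreover have "0 +o I \<in> Q" unfolding H.quotient_space_cases[OF I] by blast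
      ultimately show ?thesis
        using tensor_rels_add_right[of "0 +o I" Q "0 +o I" "?e b" "\<lambda>x c. sA c x" UNIV "quot_scale sH Q"]
        by (simp add: frag_subgroup_uminus)
    next
      case False
      have l: "lin sH (*) (\<lambda>h. H.representation B h b)"
        by (rule lin_of_linear[OF H.linear_representation[OF B(3) spB]])
      have v: "H.representation B x b = 0" if x: "x \<in> I" for x
      proof -
        have "x \<in> H.span C" using x C(3) by blast
        then show ?thesis
        proof (induction rule: H.span_induct_alt)
          case base then show ?case by (rule lin_0[OF l])
        next
          case (step k y z)
          then have "H.representation B y b = 0" using False B(1) H.representation_basis[OF B(3)] by force
          then show ?case using step by (simp add: lin_add[OF l] lin_scale[OF l])
        qed
      qed
      have "frag_eval (\<lambda>(x, X). sA (H.representation B (SOME h. h \<in> X) b) x) c = 0"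
        using 0[rule_format, OF l v] .
      then have "?e b = 0" by (simp add: frag_eval_extend case_prod_unfold)
      then show ?thesis by (simp add: tensor_rels_zero_left quot_proj_in)
    qed
  qed
  ultimately have "(c - (\<Sum>b\<in>B. frag_of (?e b, quot_proj Q b))) + (\<Sum>b\<in>B. frag_of (?e b, quot_proj Q b)) \<in> qtensor_rels sA sH Q"
    by (metis (no_types, lifting) frag_subgroup_add frag_subgroup_tensor_rels)
  then show "c \<in> qtensor_rels sA sH Q" by simp
qed

end

section \<open>The Galois extension\<close>

context fd_comodule_algebra
begin

lemma vs_A: "vector_space sA" by (rule coA.vs_A)

definition act :: "('h \<Rightarrow> 'k) \<Rightarrow> 'a \<Rightarrow> 'a"
  where "act u a = coA.sw (\<lambda>x h. sA (u h) x) a"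

lemma bilin_act: "lin sH (*) u \<Longrightarrow> bilin sA sH sA (\<lambda>x h. sA (u h) (y * x))"
  by (rule bilinI; rule linI)
    (simp_all add: coaction.A.scale_right_distrib coaction.A.scale_left_distrib coaction.A.scale_mult_right lin_add lin_scale
      ring_distribs mult.commute)

lemma coA_lin_sw: "lin sA t f \<Longrightarrow> f (coA.sw F x) = coA.sw (\<lambda>a b. f (F a b)) x"
  for F :: "'a \<Rightarrow> 'h \<Rightarrow> 'a" and f :: "'a \<Rightarrow> 'd::ring_1"
  by (simp add: sweedler_def lin_sum)

lemma act_lin: "lin sA sA (act u)"
  unfolding act_def
  by (rule coA.sw_lin[OF vs_A]) (rule linI; simp add: coaction.A.scale_right_distrib mult.commute)

lemma act_lin_left: "lin sU sA (\<lambda>u. act u a)"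
  by (rule linI)
    (simp_all add: act_def sweedler_def fun_scale_def coaction.A.scale_left_distrib sum.distrib coaction.A.scale_sum_right)

lemma lin_mult_A: "lin sA sA (\<lambda>x. y * x)" "lin sA sA (\<lambda>x. x * y)" "lin sA sA (sA k)"
  by (rule linI; simp add: ring_distribs coaction.A.scale_mult_left coaction.A.scale_mult_right
      coaction.A.scale_right_distrib mult.commute)+

lemma act_conv:
  assumes u: "lin sH (*) u" and v: "lin sH (*) v"
  shows "act u (act v a) = act (conv u v) a"
proof -
  have "act u (act v a) = coA.sw (\<lambda>x h. sA (v h) (act u x)) a"
    unfolding act_def[of v] by (simp add: coA_lin_sw[OF act_lin] lin_scale[OF act_lin])
  also have "\<dots> = coA.sw (\<lambda>x h. coA.sw (\<lambda>y g. sA (v h) (sA (u g) y)) x) a"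
    unfolding act_def by (simp only: coA_lin_sw[OF lin_mult_A(3)])
  also have "\<dots> = coA.sw (\<lambda>x h. sw (\<lambda>g g'. sA (v g') (sA (u g) x)) h) a"
    by (rule coact_coassoc_sw[OF vs_A]; rule linI;
        simp add: coaction.A.scale_left_distrib coaction.A.scale_right_distrib lin_add[OF u] lin_add[OF v]
          lin_scale[OF u] lin_scale[OF v] ring_distribs ac_simps)
  also have "\<dots> = act (conv u v) a"
    by (simp add: act_def conv_def sweedler_def coaction.A.scale_sum_left mult.commute)
  finally show ?thesis .
qed

lemma act_counit: "act \<epsilon> a = a"
  unfolding act_def by (rule coA.sw_counit[OF counit_lin])

lemma act_one: "lin sH (*) u \<Longrightarrow> act u 1 = sA (u 1) 1"
  unfolding act_def using coA.sw_one[OF bilin_act[of u 1]] by simp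

lemma act_mult:
  assumes u: "lin sH (*) u"
  shows "act u (a * b) = coA.sw (\<lambda>x h. act (\<lambda>g. u (g * h)) a * x) b"
proof -
  have bi: "bilin sA sH sA (\<lambda>x h. sA (u h) x)" using bilin_act[OF u, of 1] by simp
  have "act u (a * b) = coA.sw (\<lambda>x h. coA.sw (\<lambda>x' h'. sA (u (h * h')) (x * x')) b) a"
    unfolding act_def by (rule coA.sw_mult[OF bi vs_A])
  also have "\<dots> = coA.sw (\<lambda>x' h'. coA.sw (\<lambda>x h. sA (u (h * h')) x * x') a) b"
    unfolding sweedler_def coaction.A.scale_mult_left by (rule sum.swap)
  also have "\<dots> = coA.sw (\<lambda>x h. act (\<lambda>g. u (g * h)) a * x) b"
    unfolding act_def by (simp only: coA_lin_sw[OF lin_mult_A(2)])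
  finally show ?thesis .
qed

lemma act_co: "c \<in> B \<Longrightarrow> act (co c) a = coA.comp c a"
proof -
  assume c: "c \<in> B"
  have "act (co c) a = (\<Sum>b\<in>B. if b = c then coA.comp b a else 0)"
    unfolding act_def sweedler_def by (rule sum.cong) (auto simp: co_basis c)
  then show ?thesis using c finite_B by simp
qed

lemma act_sum_basis:
  "coA.sw (\<lambda>x h. F h * x) b = (\<Sum>m\<in>B. F m * act (co m) b)"
  by (simp add: sweedler_def act_co)

text \<open>In Sweedler notation, \<open>x_0 y u(x_1) = x_0 y_0 u(x_1 y_1 S(y_2))\<close>; the sum
  over \<open>b\<close> carries \<open>y_2\<close> in coordinates.\<close>

lemma act_antipode:
  assumes u: "lin sH (*) u"
  shows "act u x * y = (\<Sum>b\<in>B. act (\<lambda>h. u (h * S b)) (x * act (co b) y))"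
proof -
  have lin_z: "lin sH sA (\<lambda>z. act (\<lambda>h. u (h * z)) x * y')" for y'
  proof -
    have "lin sH sU (\<lambda>z h. u (h * z))"
      unfolding lin_fun_scale_iff by (intro allI lin_rules lin_compose[OF u])
    from lin_compose[OF lin_mult_A(2) lin_compose[OF act_lin_left this]] show ?thesis .
  qed
  note l = lin_add[OF lin_z] lin_scale[OF lin_z]
  have uS: "lin sH (*) (\<lambda>h. u (h * S b))" for b by (intro lin_rules lin_compose[OF u])
  have "(\<Sum>b\<in>B. act (\<lambda>h. u (h * S b)) (x * act (co b) y))
      = coA.sw (\<lambda>y0 r. coA.sw (\<lambda>y' h'. act (\<lambda>h. u (h * (h' * S r))) x * y') y0) y"
    unfolding sweedler_def[of sA _ _ _ _ y] by (simp add: act_co act_mult[OF uS] mult.assoc)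
  also have "\<dots> = coA.sw (\<lambda>y' q. sw (\<lambda>h' r. act (\<lambda>h. u (h * (h' * S r))) x * y') q) y"
    by (rule coact_coassoc_sw[OF vs_A])
      (rule lin_mult_A(1), (rule lin_compose[OF lin_z], intro lin_rules)+)
  also have "\<dots> = coA.sw (\<lambda>y' q. sA (\<epsilon> q) (act (\<lambda>h. u (h * 1)) x * y')) y"
    by (simp only: sw_antipode_right[OF lin_z])
  also have "\<dots> = act u x * act \<epsilon> y"
    unfolding act_def[of \<epsilon>] by (simp add: coA_lin_sw[OF lin_mult_A(1)] coaction.A.scale_mult_right)
  finally show ?thesis by (simp add: act_counit)
qed

lemma frag_eval_canonical:
  assumes u: "lin sH (*) u"
  shows "frag_eval (\<lambda>(x, h). sA (u h) x)
      (frag_extend (\<lambda>(a, b). frag_extend (\<lambda>(b0, b1). frag_of (a * b0, b1)) (tensor_repr (\<delta> b))) c)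
    = frag_eval (\<lambda>(a, b). a * act u b) c"
proof -
  have "frag_eval (\<lambda>(x, h). sA (u h) (a * x)) (tensor_repr (\<delta> b)) = a * act u b" for a b
    using coA.frag_eval_coact[OF bilin_act[OF u, of a], of b]
    by (simp add: act_def coA_lin_sw[OF lin_mult_A(1)] coaction.A.scale_mult_right)
  then show ?thesis by (simp add: frag_eval_extend case_prod_unfold)
qed

end

text \<open>\<open>canonical_surj\<close> says that \<open>1 \<otimes> g\<close> lies in the image
  of the canonical map, with equality in \<open>A \<otimes> H\<close> tested by functionals on
  \<open>H\<close>.\<close>

locale galois_quotient =
  fd_comodule_algebra sH \<Delta> \<epsilon> S B sA \<delta> + coideal_quotient sH \<Delta> \<epsilon> S B \<Lambda> I
  for sH :: "'k::field \<Rightarrow> 'h::ring_1 \<Rightarrow> 'h" and \<Delta> and \<epsilon> and S and B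
    and sA :: "'k \<Rightarrow> 'a::ring_1 \<Rightarrow> 'a" and \<delta> and \<Lambda> and I +
  assumes canonical_surj: "\<exists>e. \<forall>u. lin sH (*) u \<longrightarrow> frag_eval (\<lambda>(a, b). a * act u b) e = sA (u g) 1"
begin

definition C :: "'a set"
  where "C = {a. \<forall>d\<in>D. act d a = sA (d 1) a}"

abbreviation CR :: "('a \<times> 'a \<Rightarrow>\<^sub>0 int) set" where "CR \<equiv> tensor_rels (*) C (*) UNIV"

text \<open>The product rule involves only the translates \<open>d(_ * h)\<close>; these lie in
  \<open>D\<close> and act on \<open>c\<close> by their value \<open>d h\<close> at 1.\<close>

lemma act_C: "c \<in> C \<Longrightarrow> d \<in> D \<Longrightarrow> act d (c * y) = c * act d y"
proof -
  assume c: "c \<in> C" and d: "d \<in> D"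
  have "act d (c * y) = coA.sw (\<lambda>x h. sA (d h) c * x) y"
    using c D_translate[OF d] by (simp add: act_mult[OF D_lin[OF d]] C_def)
  then show ?thesis
    by (simp add: act_def coA_lin_sw[OF lin_mult_A(1)] coaction.A.scale_mult_left coaction.A.scale_mult_right)
qed

lemma act_integral: "\<Gamma> \<in> integrals \<Longrightarrow> act \<Gamma> a \<in> C"
proof -
  assume G: "\<Gamma> \<in> integrals"
  have "act d (act \<Gamma> a) = sA (d 1) (act \<Gamma> a)" if d: "d \<in> D" for d
  proof -
    have "conv d \<Gamma> = sU (d 1) \<Gamma>" using G d by (simp add: integrals_def fun_eq_iff fun_scale_def)
    then show ?thesis
      using G d by (simp add: act_conv D_lin integrals_def lin_scale[OF act_lin_left])
  qed
  then show ?thesis by (simp add: C_def)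
qed

lemma frag_eval_CR:
  assumes "c \<in> CR" and d: "d \<in> D"
  shows "frag_eval (\<lambda>(a, b). a * act d b) c = 0"
  using assms(1)
  by (rule frag_eval_tensor_rels)
    (simp_all add: ring_distribs lin_add[OF act_lin] act_C[OF _ d] mult.assoc)

text \<open>A preimage of \<open>1 \<otimes> g\<close> under
  \<open>x \<otimes> y \<mapsto> x y_0 \<otimes> y_1\<close> also satisfies
  \<open>x_0 y \<otimes> x_1 = 1 \<otimes> S g\<close>, as \<open>act_antipode\<close> converts one
  form into the other.\<close>

lemma translation_elements:
  "\<exists>e. \<forall>u. lin sH (*) u \<longrightarrow> frag_eval (\<lambda>(x, y). act u x * y) e = sA (u (S g)) 1"
proof -
  obtain e where e: "\<And>u. lin sH (*) u \<Longrightarrow> frag_eval (\<lambda>(a, b). a * act u b) e = sA (u g) 1"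
    using canonical_surj by blast
  show ?thesis
  proof (intro exI[of _ e] allI impI)
    fix u assume u: "lin sH (*) u"
    have uS: "lin sH (*) (\<lambda>h. u (h * S b))" for b by (intro lin_rules lin_compose[OF u])
    have l: "lin sH (*) (\<lambda>b. u (1 * S b))" by (intro lin_rules lin_compose[OF u])
    have "frag_eval (\<lambda>(x, y). act u x * y) e
        = frag_eval (\<lambda>p. \<Sum>b\<in>B. act (\<lambda>h. u (h * S b)) (case p of (x, y) \<Rightarrow> x * act (co b) y)) e"
      by (rule frag_eval_cong) (auto simp: act_antipode[OF u])
    also have "\<dots> = (\<Sum>b\<in>B. act (\<lambda>h. u (h * S b)) (frag_eval (\<lambda>(x, y). x * act (co b) y) e))"
      unfolding frag_eval_fun_sum
      by (rule sum.cong[OF refl], rule frag_eval_additive[symmetric]) (rule lin_add[OF act_lin])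
    also have "\<dots> = (\<Sum>b\<in>B. sA (co b g * u (1 * S b)) 1)"
      by (simp add: e co_lin lin_scale[OF act_lin] act_one[OF uS])
    also have "\<dots> = sA (u (1 * S g)) 1"
      unfolding lin_expand[OF l, of g] by (simp add: coaction.A.scale_sum_left)
    finally show "frag_eval (\<lambda>(x, y). act u x * y) e = sA (u (S g)) 1" by simp
  qed
qed

text \<open>Since \<open>x_0 y \<otimes> x_1 = 1 \<otimes> s\<close>, the sum of
  \<open>b_0 x_0 y u(b_1 x_1)\<close> collapses to \<open>b_0 u(b_1 s)\<close>. For \<open>u\<close>
  an integral this is the basic piece of the dual basis formula.\<close>

lemma act_via_integral:
  assumes u: "lin sH (*) u" and e: "\<And>u. lin sH (*) u \<Longrightarrow> frag_eval (\<lambda>(x, y). act u x * y) e = sA (u s) 1"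
  shows "frag_eval (\<lambda>(x, y). act u (b * x) * y) e = act (\<lambda>h. u (h * s)) b"
proof -
  have uS: "lin sH sU (\<lambda>m h. u (h * m))"
    unfolding lin_fun_scale_iff by (intro allI lin_rules lin_compose[OF u])
  have "frag_eval (\<lambda>(x, y). act u (b * x) * y) e
      = frag_eval (\<lambda>p. \<Sum>m\<in>B. act (\<lambda>h. u (h * m)) b * (case p of (x, y) \<Rightarrow> act (co m) x * y)) e"
    by (rule frag_eval_cong) (auto simp: act_mult[OF u] act_sum_basis sum_distrib_right mult.assoc)
  also have "\<dots> = (\<Sum>m\<in>B. act (\<lambda>h. u (h * m)) b * frag_eval (\<lambda>(x, y). act (co m) x * y) e)"
    unfolding frag_eval_fun_sum
    by (rule sum.cong[OF refl], rule frag_eval_additive[symmetric]) (rule distrib_left)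
  also have "\<dots> = (\<Sum>m\<in>B. sA (co m s) (act (\<lambda>h. u (h * m)) b))"
    by (simp add: e co_lin coaction.A.scale_mult_right)
  also have "\<dots> = act (\<lambda>h. u (h * s)) b"
    by (rule lin_expand[OF lin_compose[OF act_lin_left uS], symmetric])
  finally show ?thesis .
qed

text \<open>The counit is a combination of translated integrals, which makes \<open>A\<close> projective over \<open>C\<close>; the
  dual basis moves a tensor in the kernel of the canonical map to zero.\<close>

lemma integral_span_kernel:
  assumes c: "\<And>d. d \<in> D \<Longrightarrow> frag_eval (\<lambda>(a, b). a * act d b) c = 0" and f: "f \<in> integral_span"
  shows "frag_extend (\<lambda>(a, b). frag_of (a, act f b)) c \<in> CR"
proof -
  note s = frag_subgroup_tensor_rels[of "(*)" C "(*)" UNIV]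
  have base: "frag_extend (\<lambda>(a, b). frag_of (a, act (\<lambda>x. \<Gamma> (x * S g)) b)) c \<in> CR"
    if G: "\<Gamma> \<in> integrals" for \<Gamma> g
  proof -
    obtain e where e: "\<And>u. lin sH (*) u \<Longrightarrow> frag_eval (\<lambda>(x, y). act u x * y) e = sA (u (S g)) 1"
      using translation_elements[of g] by blast
    have GD: "\<Gamma> \<in> D" using G by (simp add: integrals_def)
    let ?F = "\<lambda>a b. frag_extend (\<lambda>(x, y). frag_of (a * act \<Gamma> (b * x), y)) e"
    \<comment> \<open>Values of an integral lie in \<open>C\<close>, so over \<open>C\<close> one
      may move \<open>act \<Gamma> (b * x)\<close> from the second leg to the first.\<close>
    have 1: "frag_extend (\<lambda>(a, b). frag_of (a, act (\<lambda>x. \<Gamma> (x * S g)) b)) c - frag_extend (\<lambda>(a, b). ?F a b) c \<in> CR"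
    proof (rule frag_extend_cong_mod[OF s])
      fix p :: "'a \<times> 'a"
      obtain a b where p: "p = (a, b)" by (cases p)
      have "frag_of (a, frag_eval (\<lambda>(x, y). act \<Gamma> (b * x) * y) e)
          - frag_extend (\<lambda>q. frag_of (a, case q of (x, y) \<Rightarrow> act \<Gamma> (b * x) * y)) e \<in> CR"
        by (rule frag_of_frag_eval_right)
      moreover have "frag_extend (\<lambda>(x, y). frag_of (a * act \<Gamma> (b * x), y)) e
          - frag_extend (\<lambda>q. frag_of (a, case q of (x, y) \<Rightarrow> act \<Gamma> (b * x) * y)) e \<in> CR"
        by (rule frag_extend_cong_mod[OF s])
          (auto intro!: tensor_rels_scale act_integral G)
      ultimately have "frag_of (a, frag_eval (\<lambda>(x, y). act \<Gamma> (b * x) * y) e) - ?F a b \<in> CR"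
        using frag_subgroup_diff[OF s] by fastforce
      then show "(case p of (a, b) \<Rightarrow> frag_of (a, act (\<lambda>x. \<Gamma> (x * S g)) b)) - (case p of (a, b) \<Rightarrow> ?F a b) \<in> CR"
        by (simp add: p act_via_integral[OF D_lin[OF GD] e])
    qed
    have 2: "frag_extend (\<lambda>(a, b). ?F a b) c
        = frag_extend (\<lambda>q. frag_extend (\<lambda>p. frag_of (fst p * act \<Gamma> (snd p * fst q), snd q)) c) e"
      unfolding case_prod_unfold by (rule frag_extend_swap)
    \<comment> \<open>For fixed \<open>x\<close> the product rule reaches \<open>b\<close> only
      through the translates \<open>\<Gamma>(_ * m)\<close>. They lie in \<open>D\<close>, so the
      hypothesis on \<open>c\<close> makes the first leg vanish.\<close>
    have 3: "frag_extend (\<lambda>p. frag_of (fst p * act \<Gamma> (snd p * x), y)) c \<in> CR" for x y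
    proof -
      have "frag_eval (\<lambda>p. fst p * act \<Gamma> (snd p * x)) c
          = frag_eval (\<lambda>p. \<Sum>m\<in>B. (fst p * act (\<lambda>h. \<Gamma> (h * m)) (snd p)) * act (co m) x) c"
        by (rule frag_eval_cong) (simp add: act_mult[OF D_lin[OF GD]] act_sum_basis sum_distrib_left mult.assoc)
      also have "\<dots> = (\<Sum>m\<in>B. frag_eval (\<lambda>(a, b). a * act (\<lambda>h. \<Gamma> (h * m)) b) c * act (co m) x)"
        unfolding frag_eval_fun_sum case_prod_unfold
        by (rule sum.cong[OF refl], rule frag_eval_additive[symmetric]) (rule distrib_right)
      also have "\<dots> = 0" by (simp add: c D_translate[OF GD])
      finally have "frag_eval (\<lambda>p. fst p * act \<Gamma> (snd p * x)) c = 0" .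
      then have "frag_of (0, y) - frag_extend (\<lambda>p. frag_of (fst p * act \<Gamma> (snd p * x), y)) c \<in> CR"
        using frag_of_frag_eval_left[of y UNIV "\<lambda>p. fst p * act \<Gamma> (snd p * x)" c "(*)" C "(*)"] by simp
      from frag_subgroup_diff[OF s tensor_rels_zero_left[OF UNIV_I, where y = y] this] show ?thesis by simp
    qed
    have "frag_extend (\<lambda>(a, b). ?F a b) c \<in> CR"
      unfolding 2 by (rule frag_extend_mem[OF s]) (rule 3)
    from frag_subgroup_add[OF s 1 this] show ?thesis by simp
  qed
  interpret U: vector_space sU by (rule vs_U)
  show ?thesis
    using f unfolding integral_span_def
  proof (induction rule: U.span_induct_alt)
    case base
    have "act 0 b = 0" for b by (rule lin_0[OF act_lin_left])
    then show ?case
      by (intro frag_extend_mem[OF s]) (simp only: case_prod_unfold tensor_rels_zero_right[OF UNIV_I])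
  next
    case (step k x f)
    then obtain \<Gamma> g where x: "x = (\<lambda>x. \<Gamma> (x * S g))" and G: "\<Gamma> \<in> integrals" by blast
    have kG: "sU k \<Gamma> \<in> integrals"
      using G subsp_scale[OF vs_U subsp_D] by (simp add: integrals_def lin_scale[OF lin_conv_right])
        (simp add: fun_scale_def)
    have kx: "sU k x = (\<lambda>x. (sU k \<Gamma>) (x * S g))" by (simp add: x fun_scale_def)
    have 1: "frag_extend (\<lambda>(a, b). frag_of (a, act (sU k x) b)) c + frag_extend (\<lambda>(a, b). frag_of (a, act f b)) c \<in> CR"
      unfolding kx by (rule frag_subgroup_add[OF s base[OF kG] step.IH])
    have "frag_extend (\<lambda>(a, b). frag_of (a, act (sU k x + f) b)) c
      - frag_extend (\<lambda>p. (case p of (a, b) \<Rightarrow> frag_of (a, act (sU k x) b)) + (case p of (a, b) \<Rightarrow> frag_of (a, act f b))) c \<in> CR"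
    proof (rule frag_extend_cong_mod[OF s])
      fix p :: "'a \<times> 'a"
      obtain a b where p: "p = (a, b)" by (cases p)
      show "(case p of (a, b) \<Rightarrow> frag_of (a, act (sU k x + f) b)) - ((case p of (a, b) \<Rightarrow> frag_of (a, act (sU k x) b))
          + (case p of (a, b) \<Rightarrow> frag_of (a, act f b))) \<in> CR"
        using tensor_rels_add_right[of "act (sU k x) b" UNIV "act f b" a "(*)" C "(*)"]
        by (simp only: p prod.case lin_add[OF act_lin_left] diff_diff_eq UNIV_I simp_thms)
    qed
    from frag_subgroup_add[OF s this[unfolded frag_extend_add_fun] 1] show ?case
      by (simp only: diff_add_cancel)
  qed
qed

lemma kernel_CR:
  assumes "\<And>d. d \<in> D \<Longrightarrow> frag_eval (\<lambda>(a, b). a * act d b) c = 0"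
  shows "c \<in> CR"
  using integral_span_kernel[OF assms counit_in_integral_span]
  by (simp add: act_counit case_prod_unfold frag_expansion[symmetric])

end

section \<open>Translation to the coinvariants and the canonical map of the quotient\<close>

context galois_quotient
begin

sublocale vp: vector_pair sA sH I
  by (intro vector_pair.intro vector_pair_axioms.intro coaction.A.k_algebra_axioms A.k_algebra_axioms I_sub)

lemma fd_B: "finite_dimensional_vector_space sH B"
  by unfold_locales (rule finite_B indep_B span_B)+

lemma qrels_iff:
  assumes "Poly_Mapping.keys c \<subseteq> UNIV \<times> vp.Q"
  shows "c \<in> qtensor_rels sA sH vp.Q \<longleftrightarrow> (\<forall>d\<in>D. frag_eval (\<lambda>(x, X). sA (d (SOME h. h \<in> X)) x) c = 0)"
  unfolding vp.qtensor_rels_iff[OF fd_B assms] D_def by blast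

lemma D_some: "d \<in> D \<Longrightarrow> d (SOME g. g \<in> quot_proj vp.Q h) = d h"
  using A.lin_some[OF I_sub D_lin D_I] by (simp add: A.quot_proj_eq[OF I_sub])

lemma quot_coinvariants_eq: "quot_coinvariants sA sH \<delta> vp.Q = C"
proof -
  have "a \<in> quot_coinvariants sA sH \<delta> vp.Q \<longleftrightarrow> a \<in> C" for a
  proof -
    let ?l = "frag_extend (\<lambda>(x, h). frag_of (x, quot_proj vp.Q h)) (tensor_repr (\<delta> a))"
    let ?r = "frag_of (a, quot_proj vp.Q 1)"
    have "Poly_Mapping.keys ?l \<subseteq> UNIV \<times> vp.Q"
      using keys_frag_extend[of "\<lambda>(x, h). frag_of (x, quot_proj vp.Q h)" "tensor_repr (\<delta> a)"]
      by (auto simp: vp.quot_proj_in split: prod.splits)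
    then have k: "Poly_Mapping.keys (?l - ?r) \<subseteq> UNIV \<times> vp.Q"
      using keys_diff[of ?l ?r] vp.quot_proj_in by auto
    have "a \<in> quot_coinvariants sA sH \<delta> vp.Q \<longleftrightarrow> ?l - ?r \<in> qtensor_rels sA sH vp.Q"
      by (simp add: quot_coinvariants_def tensor_lift_def coset_eq_iff)
    also have "\<dots> \<longleftrightarrow> (\<forall>d\<in>D. act d a - sA (d 1) a = 0)"
      unfolding qrels_iff[OF k]
    proof (rule ball_cong[OF refl])
      fix d assume d: "d \<in> D"
      have "frag_eval (\<lambda>(x, h). sA (d h) x) (tensor_repr (\<delta> a)) = act d a"
        unfolding act_def using coA.frag_eval_coact[OF bilin_act[OF D_lin[OF d], of 1], of a] by simp
      then show "(frag_eval (\<lambda>(x, X). sA (d (SOME h. h \<in> X)) x) (?l - ?r) = 0) = (act d a - sA (d 1) a = 0)"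
        by (simp add: frag_eval_diff frag_eval_extend case_prod_unfold D_some[OF d])
    qed
    finally show ?thesis by (simp add: C_def)
  qed
  then show ?thesis by blast
qed

abbreviation K :: "('a \<times> 'a \<Rightarrow>\<^sub>0 int) \<Rightarrow> ('a \<times> 'h set \<Rightarrow>\<^sub>0 int)"
  where "K \<equiv> frag_extend (\<lambda>(a, b). frag_extend (\<lambda>(b0, b1). frag_of (a * b0, quot_proj vp.Q b1)) (tensor_repr (\<delta> b)))"

lemma keys_K: "Poly_Mapping.keys (K c) \<subseteq> UNIV \<times> vp.Q"
proof -
  have "Poly_Mapping.keys (frag_extend (\<lambda>(b0, b1). frag_of (a * b0, quot_proj vp.Q b1)) (tensor_repr (\<delta> b))) \<subseteq> UNIV \<times> vp.Q" for a b
    using keys_frag_extend[of "\<lambda>(b0, b1). frag_of (a * b0, quot_proj vp.Q b1)" "tensor_repr (\<delta> b)"]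
    by (auto simp: vp.quot_proj_in split: prod.splits)
  then show ?thesis
    using keys_frag_extend[of "\<lambda>(a, b). frag_extend (\<lambda>(b0, b1). frag_of (a * b0, quot_proj vp.Q b1)) (tensor_repr (\<delta> b))" c]
    by (fastforce split: prod.splits)
qed

lemma frag_eval_K: "d \<in> D \<Longrightarrow> frag_eval (\<lambda>(x, X). sA (d (SOME h. h \<in> X)) x) (K c) = frag_eval (\<lambda>(a, b). a * act d b) c"
  unfolding frag_eval_canonical[OF D_lin, symmetric]
  by (simp add: frag_eval_extend case_prod_unfold D_some)

lemma quotient_galois: "quot_galois sA sH \<delta> vp.Q"
  unfolding quot_galois_def quot_coinvariants_eq bij_betw_def
proof
  let ?can = "canonical_map \<delta> (quot_proj vp.Q) (qtensor_rels sA sH vp.Q)"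
  have can: "?can t = K (tensor_repr t) +o qtensor_rels sA sH vp.Q" for t
    by (simp add: canonical_map_def tensor_lift_def)
  have kd: "Poly_Mapping.keys (c - c') \<subseteq> UNIV \<times> vp.Q"
    if "Poly_Mapping.keys c \<subseteq> UNIV \<times> vp.Q" "Poly_Mapping.keys c' \<subseteq> UNIV \<times> vp.Q" for c c' :: "'a \<times> 'h set \<Rightarrow>\<^sub>0 int"
    using keys_diff[of c c'] that by blast
  show "inj_on ?can (ring_tensor C)"
  proof (rule inj_onI)
    fix t t' assume t: "t \<in> ring_tensor C" and t': "t' \<in> ring_tensor C" and eq: "?can t = ?can t'"
    have "K (tensor_repr t) - K (tensor_repr t') \<in> qtensor_rels sA sH vp.Q"
      using eq by (simp add: can coset_eq_iff)
    then have "frag_eval (\<lambda>(a, b). a * act d b) (tensor_repr t - tensor_repr t') = 0" if "d \<in> D" for d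
      unfolding qrels_iff[OF kd[OF keys_K keys_K]] using that by (simp add: frag_eval_diff frag_eval_K)
    then have "tensor_repr t - tensor_repr t' \<in> CR" by (rule kernel_CR)
    then have "tensor_repr t +o CR = tensor_repr t' +o CR" by (simp add: coset_eq_iff)
    moreover have "tensor_repr t +o CR = t" using t by (rule tensor_coset)
    moreover have "tensor_repr t' +o CR = t'" using t' by (rule tensor_coset)
    ultimately show "t = t'" by simp
  qed
  show "?can ` ring_tensor C = qtensor sA sH vp.Q"
  proof (intro equalityI subsetI)
    fix T assume "T \<in> ?can ` ring_tensor C"
    then show "T \<in> qtensor sA sH vp.Q" using keys_K by (auto simp: can tensor_def)
  next
    fix T assume "T \<in> qtensor sA sH vp.Q"
    then obtain c where c: "Poly_Mapping.keys c \<subseteq> UNIV \<times> vp.Q" "T = c +o qtensor_rels sA sH vp.Q"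
      unfolding tensor_def by blast
    obtain e where e: "\<And>g u. lin sH (*) u \<Longrightarrow> frag_eval (\<lambda>(a, b). a * act u b) (e g) = sA (u g) 1"
      using canonical_surj by metis
    \<comment> \<open>A preimage of \<open>x \<otimes> X\<close> is \<open>x\<close> times a
      preimage of \<open>1 \<otimes> h\<close>, for some representative \<open>h\<close> of the
      class \<open>X\<close>.\<close>
    let ?c = "frag_extend (\<lambda>(x, X). frag_extend (\<lambda>(p, q). frag_of (x * p, q)) (e (SOME h. h \<in> X))) c"
    let ?t = "?c +o CR"
    have "K (tensor_repr ?t) - c \<in> qtensor_rels sA sH vp.Q"
      unfolding qrels_iff[OF kd[OF keys_K c(1)]]
    proof
      fix d assume d: "d \<in> D"
      have "tensor_repr ?t - ?c \<in> CR" by (rule tensor_repr_coset(1)) simp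
      from frag_eval_CR[OF this d]
      have "frag_eval (\<lambda>(a, b). a * act d b) (tensor_repr ?t) = frag_eval (\<lambda>(a, b). a * act d b) ?c"
        by (simp add: frag_eval_diff)
      also have "\<dots> = frag_eval (\<lambda>(x, X). x * frag_eval (\<lambda>(a, b). a * act d b) (e (SOME h. h \<in> X))) c"
        by (simp add: frag_eval_extend case_prod_unfold frag_eval_additive[of "(*) _", OF distrib_left] mult.assoc)
      also have "\<dots> = frag_eval (\<lambda>(x, X). sA (d (SOME h. h \<in> X)) x) c"
        by (simp add: e D_lin[OF d] coaction.A.scale_mult_right)
      finally show "frag_eval (\<lambda>(x, X). sA (d (SOME h. h \<in> X)) x) (K (tensor_repr ?t) - c) = 0"
        by (simp add: frag_eval_diff frag_eval_K[OF d])
    qed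
    then have "?can ?t = T" by (simp add: can c(2) coset_eq_iff)
    moreover have "?t \<in> ring_tensor C" by (auto simp: tensor_def)
    ultimately show "T \<in> ?can ` ring_tensor C" by blast
  qed
qed

end

text \<open>The form \<open>u \<otimes> v\<close> is zero on \<open>I \<otimes> H\<close> because of
  \<open>u\<close>, and on \<open>H \<otimes> I\<close> because of \<open>v\<close>.\<close>

lemma (in fd_hopf_algebra) coideal_conv:
  assumes I: "coideal sH \<Delta> \<epsilon> I" and u: "lin sH (*) u" "\<And>x. x \<in> I \<Longrightarrow> u x = 0"
    and v: "lin sH (*) v" "\<And>x. x \<in> I \<Longrightarrow> v x = 0" and x: "x \<in> I"
  shows "conv u v x = 0"
proof -
  have "\<Delta> x \<in> tensor_image sH I UNIV + tensor_image sH UNIV I" using I x by (auto simp: coideal_def)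
  then obtain T T' where "\<Delta> x = T + T'" "T \<in> tensor_image sH I UNIV" "T' \<in> tensor_image sH UNIV I"
    by (rule set_plus_elim)
  then obtain c c' where c: "Poly_Mapping.keys c \<subseteq> I \<times> UNIV" "Poly_Mapping.keys c' \<subseteq> UNIV \<times> I"
    "\<Delta> x = (c +o ktensor_rels sH sH) + (c' +o ktensor_rels sH sH)"
    unfolding tensor_image_def by blast
  then have "\<Delta> x = (c + c') +o ktensor_rels sH sH" by (simp add: coset_add)
  moreover have "bilin sH sH (*) (\<lambda>a b. u a * v b)"
    by (intro lin_rules lin_compose[OF u(1)] lin_compose[OF v(1)])
  ultimately have "conv u v x = frag_eval (\<lambda>(a, b). u a * v b) (c + c')"
    using frag_eval_coact_coset[of "(*)" "\<lambda>a b. u a * v b" x] by (simp add: conv_def)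
  also have "\<dots> = frag_eval (\<lambda>_. 0) c + frag_eval (\<lambda>_. 0) c'"
    unfolding frag_eval_add by (intro arg_cong2[where f = "(+)"] frag_eval_cong) (use c u v in auto)
  finally show ?thesis by (simp add: frag_eval_def)
qed

theorem theorem4p5:
  fixes sH :: "'k::field \<Rightarrow> 'h::ring_1 \<Rightarrow> 'h"
    and \<Delta> :: "'h \<Rightarrow> ('h \<times> 'h \<Rightarrow>\<^sub>0 int) set"
    and \<epsilon> :: "'h \<Rightarrow> 'k"
    and S :: "'h \<Rightarrow> 'h"
    and sA :: "'k \<Rightarrow> 'a::ring_1 \<Rightarrow> 'a"
    and \<delta> :: "'a \<Rightarrow> ('a \<times> 'h \<Rightarrow>\<^sub>0 int) set"
    and B :: "'a set"
  assumes "hopf_galois_extension sH \<Delta> \<epsilon> S sA \<delta> B"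
    and "\<exists>Basis. finite_dimensional_vector_space sH Basis"
  shows "(\<forall>Q\<in>Quot_gen sH \<Delta> \<epsilon>. quot_galois sA sH \<delta> Q) \<and>
    poset_anti_iso (quot_coinvariants sA sH \<delta>)
      (Quot_gen sH \<Delta> \<epsilon>) (\<lambda>Q Q'. quot_ge sH \<Delta> \<epsilon> Q' Q)
      (Sub_ext sA sH \<Delta> \<epsilon> \<delta>) (\<subseteq>)"
proof -
  obtain E where E: "finite_dimensional_vector_space sH E" using assms(2) by blast
  interpret hopf_galois_extension sH \<Delta> \<epsilon> S sA \<delta> B by (rule assms(1))
  interpret E: finite_dimensional_vector_space sH E by (rule E)
  interpret fd_comodule_algebra sH \<Delta> \<epsilon> S E sA \<delta>
    by unfold_locales (rule E.finite_Basis E.independent_Basis E.span_Basis)+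
  obtain \<Lambda> where \<Lambda>: "lin sH (*) \<Lambda>" "\<And>u x. lin sH (*) u \<Longrightarrow> conv u \<Lambda> x = u 1 * \<Lambda> x" "\<exists>x. \<Lambda> x \<noteq> 0"
    by (rule exists_integral) blast
  have surj: "\<exists>e. \<forall>u. lin sH (*) u \<longrightarrow> frag_eval (\<lambda>(a, b). a * act u b) e = sA (u g) 1" for g
  proof -
    have "frag_of (1, g) +o ktensor_rels sA sH \<in> ktensor sA sH" by (auto simp: tensor_def)
    then obtain t where "canonical_map \<delta> id (ktensor_rels sA sH) t = frag_of (1, g) +o ktensor_rels sA sH"
      using canonical_bij unfolding bij_betw_def by (metis imageE)
    then have r: "frag_extend (\<lambda>(a, b). frag_extend (\<lambda>(b0, b1). frag_of (a * b0, b1)) (tensor_repr (\<delta> b))) (tensor_repr t)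
        - frag_of (1, g) \<in> ktensor_rels sA sH"
      by (simp add: canonical_map_def tensor_lift_def coset_eq_iff)
    have "frag_eval (\<lambda>(a, b). a * act u b) (tensor_repr t) = sA (u g) 1" if u: "lin sH (*) u" for u
    proof -
      have "bilin sA sH sA (\<lambda>x h. sA (u h) x)" using bilin_act[OF u, of 1] by simp
      from frag_eval_ktensor_rels[OF r this] show ?thesis
        by (simp add: frag_eval_diff frag_eval_canonical[OF u])
    qed
    then show ?thesis by blast
  qed
  have gq: "galois_quotient sH \<Delta> \<epsilon> S E sA \<delta> \<Lambda> I" if I: "coideal sH \<Delta> \<epsilon> I" "right_ideal I" for I
  proof (intro galois_quotient.intro fd_comodule_algebra_axioms galois_quotient_axioms.intro surj
      coideal_quotient.intro fd_hopf_integral.intro fd_hopf_integral_axioms.intro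
      fd_hopf_algebra_axioms coideal_quotient_axioms.intro)
    show "module.subspace sH I" using I(1) by (simp add: coideal_def)
    show "x \<in> I \<Longrightarrow> \<epsilon> x = 0" for x using I(1) by (simp add: coideal_def)
    show "x \<in> I \<Longrightarrow> x * h \<in> I" for x h using I(2) by (simp add: right_ideal_def)
  qed (use \<Lambda> coideal_conv[OF I(1)] in blast)+
  have order: "quot_coinvariants sA sH \<delta> (quotient_space I) \<subseteq> quot_coinvariants sA sH \<delta> (quotient_space J) \<longleftrightarrow> I \<subseteq> J"
    if I: "coideal sH \<Delta> \<epsilon> I" "right_ideal I" and J: "coideal sH \<Delta> \<epsilon> J" "right_ideal J" for I J
  proof -
    interpret i: galois_quotient sH \<Delta> \<epsilon> S E sA \<delta> \<Lambda> I by (rule gq[OF I])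
    interpret j: galois_quotient sH \<Delta> \<epsilon> S E sA \<delta> \<Lambda> J by (rule gq[OF J])
    show ?thesis
      unfolding i.quot_coinvariants_eq j.quot_coinvariants_eq
    proof
      assume le: "i.C \<subseteq> j.C"
      show "I \<subseteq> J"
      proof
        fix h assume h: "h \<in> I"
        \<comment> \<open>As \<open>h\<close> lies in \<open>I\<close>, the preimage
          \<open>e\<close> of \<open>1 \<otimes> h\<close> is killed by the canonical map of
          \<open>H/I\<close>, hence is zero over \<open>i.C\<close> and so over the larger
          \<open>j.C\<close>. The canonical map of \<open>H/J\<close> then gives
          \<open>1 \<otimes> h = 0\<close>, and \<open>1 \<noteq> 0\<close> in \<open>A\<close>
          forces \<open>h \<in> J\<close>.\<close>
        obtain e where e: "\<And>u. lin sH (*) u \<Longrightarrow> frag_eval (\<lambda>(a, b). a * act u b) e = sA (u h) 1"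
          using surj by blast
        have "e \<in> i.CR" by (rule i.kernel_CR) (simp add: e i.D_lin i.D_I[OF _ h])
        also have "i.CR \<subseteq> j.CR"
          unfolding tensor_rels_def by (rule frag_span_mono) (use le in blast)
        finally have "sA (d h) 1 = 0" if "d \<in> j.D" for d
          using j.frag_eval_CR[OF _ that] e[OF j.D_lin[OF that]] by simp
        then show "h \<in> J" by (intro j.in_I_if) simp
      qed
    next
      assume "I \<subseteq> J"
      then have "j.D \<subseteq> i.D" by (auto simp: i.D_def j.D_def)
      then show "i.C \<subseteq> j.C" by (auto simp: i.C_def j.C_def)
    qed
  qed
  have quotient_inj: "I = J" if "quotient_space I = quotient_space J"
    "coideal sH \<Delta> \<epsilon> I" "coideal sH \<Delta> \<epsilon> J" for I J
  proof -
    have s: "module.subspace sH I" "module.subspace sH J" using that by (auto simp: coideal_def)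
    \<comment> \<open>The subspace is recovered from the quotient as the class of 0.\<close>
    have "quot_proj (quotient_space I) 0 = quot_proj (quotient_space J) 0" using that by simp
    then show ?thesis by (simp add: A.quot_proj_eq[OF s(1)] A.quot_proj_eq[OF s(2)])
  qed
  have "quot_galois sA sH \<delta> Q" if "Q \<in> Quot_gen sH \<Delta> \<epsilon>" for Q
    using that galois_quotient.quotient_galois[OF gq] by (auto simp: Quot_gen_def)
  moreover have "inj_on (quot_coinvariants sA sH \<delta>) (Quot_gen sH \<Delta> \<epsilon>)"
  proof (rule inj_onI)
    fix Q Q' assume "Q \<in> Quot_gen sH \<Delta> \<epsilon>" "Q' \<in> Quot_gen sH \<Delta> \<epsilon>"
      and eq: "quot_coinvariants sA sH \<delta> Q = quot_coinvariants sA sH \<delta> Q'"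
    then obtain I J where "Q = quotient_space I" "Q' = quotient_space J" "coideal sH \<Delta> \<epsilon> I" "right_ideal I"
      "coideal sH \<Delta> \<epsilon> J" "right_ideal J" unfolding Quot_gen_def by blast
    then show "Q = Q'" using order[of I J] order[of J I] eq by auto
  qed
  moreover have "quot_ge sH \<Delta> \<epsilon> Q' Q \<longleftrightarrow> quot_coinvariants sA sH \<delta> Q' \<subseteq> quot_coinvariants sA sH \<delta> Q"
    if "Q \<in> Quot_gen sH \<Delta> \<epsilon>" "Q' \<in> Quot_gen sH \<Delta> \<epsilon>" for Q Q'
  proof -
    obtain I J where IJ: "Q' = quotient_space I" "Q = quotient_space J" "coideal sH \<Delta> \<epsilon> I" "right_ideal I"
      "coideal sH \<Delta> \<epsilon> J" "right_ideal J" using \<open>Q \<in> _\<close> \<open>Q' \<in> _\<close> unfolding Quot_gen_def by blast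
    have "quot_ge sH \<Delta> \<epsilon> Q' Q \<longleftrightarrow> I \<subseteq> J"
      unfolding quot_ge_def using IJ quotient_inj by metis
    then show ?thesis using order[of I J] IJ by simp
  qed
  ultimately show ?thesis
    by (simp add: poset_anti_iso_def bij_betw_def Sub_ext_def)
qed

end
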